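(* Let $(X_j)_{j\in\mathbb Z}$ be an i.i.d. sequence of standard Gaussian random variables, let $(a_m)_{m\in\mathbb Z}\in\ell_2(\mathbb Z)$ be real, and define the stationary centered Gaussian sequence \[ U_k=\sum_{m=-\infty}^{\infty} a_m X_{k-m}=\sum_{j=-\infty}^{\infty} a_{k-j}X_j,\qquad k\in\mathbb Z . \] Let $(d_k)_{k\in\mathbb Z}$ be positive coefficients such that, for some $p>\tfrac12$ and constants $d_+,d_-\ge 0$ not both zero, \[ d_k\sim d_{\pm}|k|^{-p}\quad\text{as } k\to\pm\infty \] (where for a limit constant equal to $0$ this means $d_k=o(|k|^{-p})$ in that direction). If $p<1$, assume in addition that $(a_m)\in\ell_r(\mathbb Z)$ for some $r<2$. Then \[ \ln \mathbb P\Big(\sum_{k\in\mathbb Z} d_k^2U_k^2\le \varepsilon^2\Big)\sim -B_p\Big(\frac{C}{\varepsilon^2}\Big)^{\frac1{2p-1}},\qquad \varepsilon\to0, \] where \[ B_p=\frac{2p-1}{2}\left(\frac{\pi}{2p\sin\big(\frac{\pi}{2p}\big)}\right)^{\frac{2p}{2p-1}},\qquad C=\left(\frac1{2\pi}\int_0^{2\pi}\Big|\sum_{m=-\infty}^{\infty}a_m e^{\mathrm i m x}\Big|^{1/p}dx\right)^{2p}\left(d_-^{1/p}+d_+^{1/p}\right)^{2p}. \]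
   Context: Here $f(\varepsilon)\sim g(\varepsilon)$ means $f/g\to1$. The series $\sum_m a_m e^{\mathrm i m x}$ converges in $L_2([0,2\pi])$. *)

theory Defs
  imports "HOL-Probability.Probability" "HOL-Library.Landau_Symbols"
begin

definition ma_partial :: "(int \<Rightarrow> real) \<Rightarrow> (int \<Rightarrow> 'a \<Rightarrow> real) \<Rightarrow> int \<Rightarrow> 'a \<Rightarrow> nat \<Rightarrow> real" where
  "ma_partial a X k \<omega> N = (\<Sum>m\<in>{- int N..int N}. a m * X (k - m) \<omega>)"

text \<open>U_k = sum_m a_m X_(k-m), as the (a.s. existing) limit of symmetric partial sums;
  set to 0 on the null set where the limit does not exist.\<close>
definition ma_U :: "(int \<Rightarrow> real) \<Rightarrow> (int \<Rightarrow> 'a \<Rightarrow> real) \<Rightarrow> int \<Rightarrow> 'a \<Rightarrow> real" where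
  "ma_U a X k \<omega> = (if convergent (ma_partial a X k \<omega>) then lim (ma_partial a X k \<omega>) else 0)"

definition is_L2_fourier_sum :: "(int \<Rightarrow> real) \<Rightarrow> (real \<Rightarrow> complex) \<Rightarrow> bool" where
  "is_L2_fourier_sum a f \<longleftrightarrow>
     f \<in> borel_measurable lborel \<and>
     set_integrable lborel {0..2*pi} (\<lambda>x. (cmod (f x))\<^sup>2) \<and>
     (\<lambda>N::nat. LINT x:{0..2*pi}|lborel.
        (cmod (f x - (\<Sum>m\<in>{- int N..int N}. complex_of_real (a m) * exp (\<i> * of_int m * of_real x))))\<^sup>2)
       \<longlonglongrightarrow> 0"

end

theory Submission
  imports Defs "HOL-Real_Asymp.Real_Asymp"
begin

text \<open>
  Write \<open>S\<close> for the weighted sum and \<open>\<Phi>(t) = - ln (E exp (- t S / 2))\<close>. By an exponential Tauberian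
  theorem it suffices to find the leading order of \<open>\<Phi>(t)\<close> as \<open>t \<rightarrow> \<infinity>\<close>, namely a constant times
  \<open>t powr (1 / (2 p))\<close>. Three properties of \<open>\<Phi>\<close> as a functional of the Gaussian family are used:
  it is monotone, additive over independent families, and adding one square \<open>g\<^sup>2\<close> increases it by at most
  \<open>ln (1 + E g\<^sup>2) / 2\<close>. All of them follow from the Hubbard-Stratonovich identity
  \<open>exp (- y\<^sup>2 / 2) = E cos (Z y)\<close>.

  The last property shows that replacing \<open>a\<close> by a finitely supported truncation costs an error of the right
  order with a small constant. For \<open>a\<close> supported in \<open>[- L, L]\<close>, blocks of indices separated by gaps of
  length \<open>2 L\<close> are independent; on a block the weights are almost constant, and up to \<open>O(L)\<close> squares the
  block agrees with a circulant model, whose Laplace transform is explicit in terms of the values of the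
  symbol \<open>\<Sum>m. a m * exp (i m x)\<close> at the points \<open>2 \<pi> l / B\<close>. Summing over blocks produces
  \<open>\<Sum>b. ln (1 + \<tau> * b powr (- 2 p))\<close>, asymptotic to
  \<open>\<tau> powr (1 / (2 p)) * \<pi> / sin (\<pi> / (2 p))\<close>, and Riemann sums of the symbol.
\<close>

section \<open>Laplace transforms of Gaussian quadratic forms\<close>

text \<open>Truncating \<open>a\<close> disturbs every square of an infinite sum. This is affordable
  because each square costs only a logarithm: the sum over \<open>k\<close> of
  \<open>ln (1 + x * (d k)\<^sup>2)\<close> is of order \<open>x powr (1 / (2 * p))\<close>, so for
  \<open>x\<close> equal to \<open>t\<close> times a small tail energy it is a small multiple of the
  leading order. Bounds from above hold for all finite index sets at once and bounds from below for
  some finite index set; this is what lets them pass to the full sum, on which no independence or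
  finiteness is available. Parameters are fixed in the order \<delta> (the cost of a comparison),
  range \<open>L\<close>, block length \<open>B\<close> with tolerance \<eta>, and last
  \<open>t\<close>. The constants converge as \<open>L\<close> grows because L2 convergence on a
  bounded interval controls the integrals of the power \<open>1 / p < 2\<close>. With
  \<open>b = 1 / (2 * p)\<close> the Tauberian theorem turns \<open>t powr b\<close> into the power
  \<open>- b / (1 - b) = - 1 / (2 * p - 1)\<close> of the radius. If the symbol vanishes there is no
  exponential scale left, so that case is separate: all \<open>a m\<close> are then 0.\<close>

abbreviation gauss_prod :: "'i set \<Rightarrow> ('i \<Rightarrow> real) measure" where
  "gauss_prod I \<equiv> PiM I (\<lambda>_. std_normal_distribution)"

lemma finite_int_bounded:
  fixes F :: "int set"
  assumes "finite F"
  obtains N :: nat where "F \<subseteq> {- int N..int N}"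
proof -
  from assms obtain m where "\<forall>k\<in>F. \<bar>k\<bar> \<le> m"
    by (metis finite_imageI finite_nat_set_iff_bounded_le imageI nat_le_iff)
  then show thesis by (intro that[of "nat m"]) force
qed

lemma at_right_0_obtain_less:
  fixes h :: "real \<Rightarrow> real"
  assumes "(h \<longlongrightarrow> c) (at_right 0)" "c < y"
  obtains x where "0 < x" "x < 1" "h x < y"
proof -
  have "\<forall>\<^sub>F x in at_right 0. h x < y" by (rule order_tendstoD(2)[OF assms])
  moreover have "\<forall>\<^sub>F x in at_right 0. x \<in> {0<..<1::real}" by (rule eventually_at_right_real) simp
  ultimately have "\<forall>\<^sub>F x in at_right 0. h x < y \<and> x \<in> {0<..<1}" by eventually_elim simp
  then obtain x where "h x < y" "x \<in> {0<..<1}"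
    using eventually_happens'[OF trivial_limit_at_right_real] by blast
  then show thesis by (intro that[of x]) auto
qed

lemma at_right_0_obtain_greater:
  fixes h :: "real \<Rightarrow> real"
  assumes "(h \<longlongrightarrow> c) (at_right 0)" "y < c"
  obtains x where "0 < x" "x < 1" "y < h x"
proof (rule at_right_0_obtain_less[OF tendsto_minus[OF assms(1)], of "- y"])
  show "- c < - y" using assms(2) by simp
qed (use that in auto)

lemma prob_space_std_normal: "prob_space std_normal_distribution"
  by (rule prob_space_normal_density) simp

lemma product_sigma_finite_std_normal:
  "product_sigma_finite (\<lambda>_. std_normal_distribution)"
  using prob_space_std_normal
  by (simp add: product_sigma_finite_def prob_space_imp_sigma_finite)

lemma prob_space_gauss_prod: "prob_space (gauss_prod I)"
  by (rule prob_space_PiM) (rule prob_space_std_normal)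

lemma measurable_gauss_prod_coord:
  "i \<in> I \<Longrightarrow> (\<lambda>z. z i) \<in> borel_measurable (gauss_prod I)"
  using measurable_component_singleton[of i I "\<lambda>_. std_normal_distribution"] by simp

lemma integrable_bounded_prob:
  fixes f :: "'b \<Rightarrow> real"
  assumes "prob_space N" "f \<in> borel_measurable N" "\<And>x. \<bar>f x\<bar> \<le> B"
  shows "integrable N f"
  by (rule finite_measure.integrable_const_bound[where B=B])
     (simp_all add: assms prob_space.finite_measure)

text \<open>The characteristic function of independent standard Gaussians factorizes over the
  coordinates; taking its real part keeps the later Fubini argument over the reals.\<close>

lemma gauss_prod_cos:
  assumes "finite I"
  shows "(\<integral>z. cos (\<Sum>i\<in>I. c i * z i) \<partial>gauss_prod I) = exp (- (\<Sum>i\<in>I. (c i)\<^sup>2) / 2)"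
proof -
  interpret product_sigma_finite "\<lambda>_::'a. std_normal_distribution"
    by (rule product_sigma_finite_std_normal)
  interpret P: prob_space "gauss_prod I" by (rule prob_space_gauss_prod)
  interpret R: real_distribution std_normal_distribution by (rule real_dist_normal_dist)
  have int: "integrable std_normal_distribution (\<lambda>x. iexp (c i * x))" for i
    by (rule R.integrable_const_bound[where B=1]) auto
  have eq: "(\<Prod>i\<in>I. iexp (c i * z i)) = iexp (\<Sum>i\<in>I. c i * z i)" for z
    by (simp add: exp_sum[OF assms] sum_distrib_left)
  have "(\<integral>z. iexp (\<Sum>i\<in>I. c i * z i) \<partial>gauss_prod I)
      = (\<Prod>i\<in>I. integral\<^sup>L std_normal_distribution (\<lambda>x. iexp (c i * x)))"
    unfolding eq[symmetric]
    by (rule product_integral_prod[OF assms, of "\<lambda>i x. iexp (c i * x)"]) (rule int)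
  also have "\<dots> = (\<Prod>i\<in>I. complex_of_real (exp (- (c i)\<^sup>2 / 2)))"
    using char_std_normal_distribution by (simp add: char_def fun_eq_iff)
  also have "\<dots> = complex_of_real (exp (- (\<Sum>i\<in>I. (c i)\<^sup>2) / 2))"
    by (simp add: exp_sum[OF assms, symmetric] sum_negf sum_divide_distrib flip: of_real_prod)
  finally have *: "(\<integral>z. iexp (\<Sum>i\<in>I. c i * z i) \<partial>gauss_prod I)
      = complex_of_real (exp (- (\<Sum>i\<in>I. (c i)\<^sup>2) / 2))" .
  have "integrable (gauss_prod I) (\<lambda>z. iexp (\<Sum>i\<in>I. c i * z i))"
    by (rule P.integrable_const_bound[where B=1]) auto
  then have "(\<integral>z. Re (iexp (\<Sum>i\<in>I. c i * z i)) \<partial>gauss_prod I)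
      = Re (\<integral>z. iexp (\<Sum>i\<in>I. c i * z i) \<partial>gauss_prod I)"
    by (rule integral_Re)
  then show ?thesis unfolding * by (simp add: Re_exp)
qed

text \<open>The value is \<open>det (1 + V V\<^sup>T) powr (- 1/2)\<close> for the matrix \<open>V = (v i j)\<close>.\<close>
definition gauss_int :: "'i set \<Rightarrow> 'j set \<Rightarrow> ('i \<Rightarrow> 'j \<Rightarrow> real) \<Rightarrow> real" where
  "gauss_int I S v = (\<integral>z. exp (- (\<Sum>j\<in>S. (\<Sum>i\<in>I. z i * v i j)\<^sup>2) / 2) \<partial>gauss_prod I)"

lemma measurable_gauss_quad:
  "(\<lambda>z. \<Sum>j\<in>S. (\<Sum>i\<in>I. z i * v i j)\<^sup>2) \<in> borel_measurable (gauss_prod I)"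
  by (intro borel_measurable_sum borel_measurable_power borel_measurable_times borel_measurable_const
      measurable_gauss_prod_coord)

lemma integrable_gauss_quad:
  "integrable (gauss_prod I) (\<lambda>z. exp (- (\<Sum>j\<in>S. (\<Sum>i\<in>I. z i * v i j)\<^sup>2) / 2))"
  by (rule integrable_bounded_prob[where B=1, OF prob_space_gauss_prod])
     (auto simp: sum_nonneg intro!: measurable_compose[OF measurable_gauss_quad borel_measurable_exp] borel_measurable_divide borel_measurable_uminus measurable_gauss_quad)

text \<open>Hubbard-Stratonovich: both sides are the mean of \<open>cos\<close> of the bilinear form
  \<open>\<Sum>i j. z i * v i j * x j\<close> in independent Gaussian vectors \<open>z\<close> and \<open>x\<close>.\<close>
lemma gauss_int_dual:
  assumes "finite I" "finite S"
  shows "gauss_int I S v = gauss_int S I (\<lambda>j i. v i j)"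
proof -
  interpret P: prob_space "gauss_prod I" by (rule prob_space_gauss_prod)
  interpret Q: prob_space "gauss_prod S" by (rule prob_space_gauss_prod)
  interpret PQ: pair_prob_space "gauss_prod I" "gauss_prod S" ..
  let ?f = "\<lambda>z x. cos (\<Sum>j\<in>S. \<Sum>i\<in>I. z i * v i j * x j)"
  have 1: "(\<integral>x. ?f z x \<partial>gauss_prod S) = exp (- (\<Sum>j\<in>S. (\<Sum>i\<in>I. z i * v i j)\<^sup>2) / 2)" for z
    using gauss_prod_cos[OF assms(2), of "\<lambda>j. \<Sum>i\<in>I. z i * v i j"]
    by (simp add: sum_distrib_right)
  have 2: "(\<integral>z. ?f z x \<partial>gauss_prod I) = exp (- (\<Sum>i\<in>I. (\<Sum>j\<in>S. x j * v i j)\<^sup>2) / 2)" for x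
  proof -
    have "(\<Sum>j\<in>S. \<Sum>i\<in>I. z i * v i j * x j) = (\<Sum>i\<in>I. (\<Sum>j\<in>S. x j * v i j) * z i)" for z
      by (subst sum.swap) (simp add: sum_distrib_left mult_ac)
    then show ?thesis using gauss_prod_cos[OF assms(1), of "\<lambda>i. \<Sum>j\<in>S. x j * v i j"] by simp
  qed
  have m: "(\<lambda>(z,x). ?f z x) \<in> borel_measurable (gauss_prod I \<Otimes>\<^sub>M gauss_prod S)"
  proof -
    have [measurable]: "(\<lambda>p. fst p i) \<in> borel_measurable (gauss_prod I \<Otimes>\<^sub>M gauss_prod S)" if "i \<in> I" for i
      by (rule measurable_compose[OF measurable_fst measurable_gauss_prod_coord[OF that]])
    have [measurable]: "(\<lambda>p. snd p j) \<in> borel_measurable (gauss_prod I \<Otimes>\<^sub>M gauss_prod S)" if "j \<in> S" for j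
      by (rule measurable_compose[OF measurable_snd measurable_gauss_prod_coord[OF that]])
    show ?thesis unfolding split_beta by measurable
  qed
  have "integrable (gauss_prod I \<Otimes>\<^sub>M gauss_prod S) (\<lambda>(z,x). ?f z x)"
    by (rule integrable_bounded_prob[where B=1]) (use m in \<open>auto intro: PQ.prob_space_axioms\<close>)
  then have "(\<integral>x. (\<integral>z. ?f z x \<partial>gauss_prod I) \<partial>gauss_prod S) =
      (\<integral>z. (\<integral>x. ?f z x \<partial>gauss_prod S) \<partial>gauss_prod I)"
    by (rule PQ.Fubini_integral)
  then show ?thesis unfolding gauss_int_def 1 2 by simp
qed

lemma gauss_int_cong:
  assumes "\<And>i j. i \<in> I \<Longrightarrow> j \<in> S \<Longrightarrow> v i j = w i j"
  shows "gauss_int I S v = gauss_int I S w"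
  unfolding gauss_int_def using assms by (simp cong: sum.cong)

lemma gauss_int_support:
  assumes "finite S" "S' \<subseteq> S" "\<And>i j. i \<in> I \<Longrightarrow> j \<in> S - S' \<Longrightarrow> v i j = 0"
  shows "gauss_int I S v = gauss_int I S' v"
proof -
  have "(\<Sum>j\<in>S. (\<Sum>i\<in>I. z i * v i j)\<^sup>2) = (\<Sum>j\<in>S'. (\<Sum>i\<in>I. z i * v i j)\<^sup>2)" for z
    by (rule sum.mono_neutral_right) (use assms in auto)
  then show ?thesis unfolding gauss_int_def by simp
qed

lemma gauss_int_pos: "gauss_int I S v > 0"
proof -
  interpret P: prob_space "gauss_prod I" by (rule prob_space_gauss_prod)
  show ?thesis unfolding gauss_int_def
    using integral_nonneg_eq_0_iff_AE[OF integrable_gauss_quad[where I=I and S=S and v=v]] P.AE_False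
    by (auto simp: less_le intro!: integral_nonneg)
qed

lemma gauss_int_reindex_snd:
  assumes "inj_on h S"
  shows "gauss_int I (h ` S) v = gauss_int I S (\<lambda>i j. v i (h j))"
  unfolding gauss_int_def by (simp add: sum.reindex[OF assms])

lemma gauss_int_reindex_fst:
  assumes "inj_on h I" "finite I" "finite S"
  shows "gauss_int (h ` I) S v = gauss_int I S (\<lambda>i. v (h i))"
  unfolding gauss_int_dual[OF finite_imageI[OF assms(2)] assms(3)] gauss_int_dual[OF assms(2,3)]
  by (rule gauss_int_reindex_snd[OF assms(1)])

text \<open>In the dual form the elements of \<open>I\<close> label the squares in the exponent, so
  a larger \<open>I\<close> only decreases the integrand.\<close>

lemma gauss_int_subset:
  assumes "finite I'" "finite S" "I \<subseteq> I'"
  shows "gauss_int I' S v \<le> gauss_int I S v"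
proof -
  have fI: "finite I" by (rule finite_subset[OF assms(3,1)])
  show ?thesis
    unfolding gauss_int_dual[OF assms(1,2)] gauss_int_dual[OF fI assms(2)] gauss_int_def[of S]
  proof (intro integral_mono integrable_gauss_quad)
    fix x
    have "(\<Sum>i\<in>I. (\<Sum>j\<in>S. x j * v i j)\<^sup>2) \<le> (\<Sum>i\<in>I'. (\<Sum>j\<in>S. x j * v i j)\<^sup>2)"
      by (rule sum_mono2) (use assms in auto)
    then show "exp (- (\<Sum>i\<in>I'. (\<Sum>j\<in>S. x j * v i j)\<^sup>2) / 2) \<le> exp (- (\<Sum>i\<in>I. (\<Sum>j\<in>S. x j * v i j)\<^sup>2) / 2)"
      by simp
  qed
qed

text \<open>Dually, \<open>s i\<close> multiplies the whole \<open>i\<close>-th square, so the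
  comparison is term by term and involves only \<open>(s i)\<^sup>2\<close>.\<close>

lemma gauss_int_scale_mono:
  assumes "finite I" "finite S" "\<And>i. i \<in> I \<Longrightarrow> (s i)\<^sup>2 \<le> (s' i)\<^sup>2"
  shows "gauss_int I S (\<lambda>i j. s' i * v i j) \<le> gauss_int I S (\<lambda>i j. s i * v i j)"
proof -
  have eq: "(\<Sum>j\<in>S. x j * (c * v i j))\<^sup>2 = c\<^sup>2 * (\<Sum>j\<in>S. x j * v i j)\<^sup>2" for c x i
  proof -
    have "(\<Sum>j\<in>S. x j * (c * v i j)) = c * (\<Sum>j\<in>S. x j * v i j)"
      by (subst sum_distrib_left) (simp add: mult_ac)
    then show ?thesis by (simp add: power_mult_distrib)
  qed
  show ?thesis
    unfolding gauss_int_dual[OF assms(1,2)] gauss_int_def[of S]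
  proof (intro integral_mono integrable_gauss_quad)
    fix x
    have "(\<Sum>i\<in>I. (\<Sum>j\<in>S. x j * (s i * v i j))\<^sup>2) \<le> (\<Sum>i\<in>I. (\<Sum>j\<in>S. x j * (s' i * v i j))\<^sup>2)"
      unfolding eq by (intro sum_mono mult_right_mono assms) auto
    then show "exp (- (\<Sum>i\<in>I. (\<Sum>j\<in>S. x j * (s' i * v i j))\<^sup>2) / 2)
        \<le> exp (- (\<Sum>i\<in>I. (\<Sum>j\<in>S. x j * (s i * v i j))\<^sup>2) / 2)"
      by simp
  qed
qed

section \<open>One-dimensional Gaussian integrals and the cost of one square\<close>

lemma std_normal_flip:
  fixes f :: "real \<Rightarrow> real"
  assumes [measurable]: "f \<in> borel_measurable borel"
  shows "(\<integral>y. f (- y) \<partial>std_normal_distribution) = (\<integral>y. f y \<partial>std_normal_distribution)"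
proof -
  have "(\<integral>y. f (- y) \<partial>std_normal_distribution) = (\<integral>y. std_normal_density y * f (-y) \<partial>lborel)"
    by (rule integral_real_density) simp_all
  also have "\<dots> = (\<integral>y. std_normal_density y * f y \<partial>lborel)"
    by (subst (2) lborel_integral_real_affine[of "-1" _ 0]) (simp_all add: std_normal_density_def)
  also have "\<dots> = (\<integral>y. f y \<partial>std_normal_distribution)"
    by (rule integral_real_density[symmetric]) simp_all
  finally show ?thesis .
qed

lemma std_normal_exp_square:
  assumes "c \<ge> 0"
  shows "(\<integral>y. exp (- c * y\<^sup>2 / 2) \<partial>std_normal_distribution) = 1 / sqrt (1 + c)"
proof -
  have pos: "1 + c > 0" using assms by simp
  \<comment> \<open>The standard normal density times \<open>exp (- c * y\<^sup>2 / 2)\<close> is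
    \<sigma> times the centered normal density of variance \<open>1 / (1 + c)\<close>.\<close>
  define \<sigma> where "\<sigma> = 1 / sqrt (1 + c)"
  have s: "\<sigma> > 0" "\<sigma>\<^sup>2 = 1 / (1+c)" using pos by (auto simp: \<sigma>_def power_divide)
  have "(\<integral>y. exp (- c * y\<^sup>2 / 2) \<partial>std_normal_distribution)
      = (\<integral>y. std_normal_density y * exp (- c * y\<^sup>2 / 2) \<partial>lborel)"
    by (rule integral_real_density) (simp_all add: normal_density_nonneg)
  also have "(\<lambda>y. std_normal_density y * exp (- c * y\<^sup>2 / 2)) = (\<lambda>y. \<sigma> * normal_density 0 \<sigma> y)"
  proof
    fix y
    have "sqrt (2 * pi * \<sigma>\<^sup>2) = sqrt (2*pi) * \<sigma>" using s(1) by (simp add: real_sqrt_mult)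
    moreover have "- y\<^sup>2 / 2 + (- c * y\<^sup>2 / 2) = - y\<^sup>2 / (2 * \<sigma>\<^sup>2)"
      unfolding s(2) by (simp add: field_simps)
    ultimately show "std_normal_density y * exp (- c * y\<^sup>2 / 2) = \<sigma> * normal_density 0 \<sigma> y"
      using s(1) unfolding std_normal_density_def normal_density_def
      by (simp add: exp_add[symmetric])
  qed
  also have "(\<integral>y. \<sigma> * normal_density 0 \<sigma> y \<partial>lborel) = \<sigma>"
    using s(1) by (simp add: integral_normal_density)
  finally show ?thesis by (simp add: \<sigma>_def)
qed

lemma sum_exp_ge: "exp ((a + b) / 2) \<le> (exp a + exp b) / (2::real)"
proof -
  have "0 \<le> (exp (a/2) - exp (b/2))\<^sup>2" by simp
  also have "\<dots> = exp a + exp b - 2 * exp ((a+b)/2)"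
    by (simp add: power2_diff exp_double[symmetric] exp_add[symmetric] add_divide_distrib)
  finally show ?thesis by simp
qed

lemma integrable_std_normal_bounded:
  fixes f :: "real \<Rightarrow> real"
  assumes "f \<in> borel_measurable borel" "\<And>x. \<bar>f x\<bar> \<le> B"
  shows "integrable std_normal_distribution f"
  by (rule integrable_bounded_prob[OF prob_space_std_normal _ assms(2)]) (simp add: assms(1))

text \<open>Averaging over \<open>y\<close> and \<open>- y\<close> removes the cross term \<open>a j * b j\<close>.\<close>
lemma std_normal_exp_shift_ge:
  assumes "finite S"
  shows "(\<integral>y. exp (- (\<Sum>j\<in>S. (a j + y * b j)\<^sup>2) / 2) \<partial>std_normal_distribution)
    \<ge> exp (- (\<Sum>j\<in>S. (a j)\<^sup>2) / 2) / sqrt (1 + (\<Sum>j\<in>S. (b j)\<^sup>2))"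
proof -
  let ?g = "\<lambda>y. exp (- (\<Sum>j\<in>S. (a j + y * b j)\<^sup>2) / 2)"
  let ?A = "\<Sum>j\<in>S. (a j)\<^sup>2" and ?B = "\<Sum>j\<in>S. (b j)\<^sup>2"
  have g [measurable]: "?g \<in> borel_measurable borel" by measurable
  have ig: "integrable std_normal_distribution ?g"
    by (rule integrable_std_normal_bounded[where B=1]) (use g in \<open>auto simp: sum_nonneg\<close>)
  have ig': "integrable std_normal_distribution (\<lambda>y. ?g (- y))"
    by (rule integrable_std_normal_bounded[where B=1]) (measurable, auto simp: sum_nonneg)
  have le: "exp (- ?A / 2) * exp (- ?B * y\<^sup>2 / 2) \<le> (?g y + ?g (- y)) / 2" for y
  proof -
    have "(\<Sum>j\<in>S. (a j + y * b j)\<^sup>2) + (\<Sum>j\<in>S. (a j + (- y) * b j)\<^sup>2) = (\<Sum>j\<in>S. 2 * (a j)\<^sup>2 + 2 * (y\<^sup>2 * (b j)\<^sup>2))"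
      unfolding sum.distrib[symmetric]
      by (rule sum.cong[OF refl]) (simp add: power2_eq_square algebra_simps)
    also have "\<dots> = 2 * ?A + 2 * (y\<^sup>2 * ?B)"
      by (simp add: sum.distrib sum_distrib_left)
    finally have "- (\<Sum>j\<in>S. (a j + y * b j)\<^sup>2) / 2 + - (\<Sum>j\<in>S. (a j + (- y) * b j)\<^sup>2) / 2
      = 2 * (- ?A / 2 + - ?B * y\<^sup>2 / 2)" by (simp add: field_simps)
    then show ?thesis
      using sum_exp_ge[of "- (\<Sum>j\<in>S. (a j + y * b j)\<^sup>2) / 2" "- (\<Sum>j\<in>S. (a j + (- y) * b j)\<^sup>2) / 2"]
      by (simp add: exp_add[symmetric] diff_divide_distrib)
  qed
  have "exp (- ?A / 2) / sqrt (1 + ?B) = exp (- ?A / 2) * (\<integral>y. exp (- ?B * y\<^sup>2 / 2) \<partial>std_normal_distribution)"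
    by (subst std_normal_exp_square) (auto simp: sum_nonneg)
  also have "\<dots> = (\<integral>y. exp (- ?A / 2) * exp (- ?B * y\<^sup>2 / 2) \<partial>std_normal_distribution)"
    by simp
  also have "\<dots> \<le> (\<integral>y. (?g y + ?g (- y)) / 2 \<partial>std_normal_distribution)"
  proof (rule integral_mono)
    show "integrable std_normal_distribution (\<lambda>y. exp (- ?A / 2) * exp (- ?B * y\<^sup>2 / 2))"
      by (intro integrable_mult_right integrable_std_normal_bounded[where B=1])
         (measurable, auto simp: sum_nonneg)
    show "integrable std_normal_distribution (\<lambda>y. (?g y + ?g (- y)) / 2)"
      using integrable_divide[OF Bochner_Integration.integrable_add[OF ig ig'], of 2] by simp
  qed (use le in auto)
  also have "\<dots> = ((\<integral>y. ?g y \<partial>std_normal_distribution) + (\<integral>y. ?g (- y) \<partial>std_normal_distribution)) / 2"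
    using ig ig' by simp
  also have "(\<integral>y. ?g (- y) \<partial>std_normal_distribution) = (\<integral>y. ?g y \<partial>std_normal_distribution)"
    by (rule std_normal_flip[OF g])
  finally show ?thesis by simp
qed

text \<open>In the undualized form the new row is one more integration variable, and the inner
  integral is bounded below for each fixed value of the others. In terms of determinants, adding a
  row to V multiplies \<open>det (1 + V V^T)\<close> by at most one plus the squared length of the
  row.\<close>

lemma gauss_int_insert_ge:
  assumes "finite I" "i \<notin> I" "finite S"
  shows "gauss_int (insert i I) S v \<ge> gauss_int I S v / sqrt (1 + (\<Sum>j\<in>S. (v i j)\<^sup>2))"
proof -
  interpret product_sigma_finite "\<lambda>_::'a. std_normal_distribution"
    by (rule product_sigma_finite_std_normal)
  let ?c = "sqrt (1 + (\<Sum>j\<in>S. (v i j)\<^sup>2))"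
  let ?h = "\<lambda>x. \<integral>y. exp (- (\<Sum>j\<in>S. ((\<Sum>k\<in>I. x k * v k j) + y * v i j)\<^sup>2) / 2) \<partial>std_normal_distribution"
  have eq: "(\<Sum>k\<in>insert i I. (x(i:=y)) k * v k j) = (\<Sum>k\<in>I. x k * v k j) + y * v i j" for x y j
  proof -
    have "(\<Sum>k\<in>I. (x(i:=y)) k * v k j) = (\<Sum>k\<in>I. x k * v k j)"
      by (rule sum.cong) (use assms in auto)
    then show ?thesis using assms by simp
  qed
  have J: "gauss_int (insert i I) S v = (\<integral>x. ?h x \<partial>gauss_prod I)"
    unfolding gauss_int_def product_integral_insert[OF assms(1,2) integrable_gauss_quad] eq ..
  have "gauss_int I S v / ?c = (\<integral>x. exp (- (\<Sum>j\<in>S. (\<Sum>k\<in>I. x k * v k j)\<^sup>2) / 2) / ?c \<partial>gauss_prod I)"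
    unfolding gauss_int_def by simp
  also have "\<dots> \<le> (\<integral>x. ?h x \<partial>gauss_prod I)"
  proof (rule integral_mono)
    show "integrable (gauss_prod I) (\<lambda>x. exp (- (\<Sum>j\<in>S. (\<Sum>k\<in>I. x k * v k j)\<^sup>2) / 2) / ?c)"
      by (intro integrable_divide integrable_gauss_quad)
    show "integrable (gauss_prod I) ?h"
    proof (rule integrable_bounded_prob[OF prob_space_gauss_prod, where B=1])
      have [measurable]: "(\<lambda>p. fst p k) \<in> borel_measurable (gauss_prod I \<Otimes>\<^sub>M borel)" if "k \<in> I" for k
        by (rule measurable_compose[OF measurable_fst measurable_gauss_prod_coord[OF that]])
      have m: "(\<lambda>(x,y). exp (- (\<Sum>j\<in>S. ((\<Sum>k\<in>I. x k * v k j) + y * v i j)\<^sup>2) / 2))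
          \<in> borel_measurable (gauss_prod I \<Otimes>\<^sub>M std_normal_distribution)"
        unfolding split_beta by measurable
      show "?h \<in> borel_measurable (gauss_prod I)"
        using sigma_finite_measure.borel_measurable_lebesgue_integral[OF
            prob_space_imp_sigma_finite[OF prob_space_std_normal] m] by simp
      show "\<bar>?h x\<bar> \<le> 1" for x
      proof -
        have "0 \<le> ?h x" by simp
        moreover have "?h x \<le> 1"
          by (rule prob_space.integral_le_const[OF prob_space_std_normal])
             (auto simp: sum_nonneg intro!: integrable_std_normal_bounded[where B=1])
        ultimately show ?thesis by simp
      qed
    qed
  qed (rule std_normal_exp_shift_ge[OF assms(3)])
  finally show ?thesis unfolding J .
qed

text \<open>The matrix is block diagonal: the exponent is a sum of two forms in separate variables,
  and the Gaussian product measure over the union is a product of two.\<close>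

lemma gauss_int_union:
  assumes fin: "finite I1" "finite I2" "finite S1" "finite S2"
    and disj: "I1 \<inter> I2 = {}" "S1 \<inter> S2 = {}"
    and v1: "\<And>i j. i \<in> I1 \<Longrightarrow> j \<in> S2 \<Longrightarrow> v i j = 0"
    and v2: "\<And>i j. i \<in> I2 \<Longrightarrow> j \<in> S1 \<Longrightarrow> v i j = 0"
  shows "gauss_int (I1 \<union> I2) (S1 \<union> S2) v = gauss_int I1 S1 v * gauss_int I2 S2 v"
proof -
  interpret product_sigma_finite "\<lambda>_::'a. std_normal_distribution"
    by (rule product_sigma_finite_std_normal)
  let ?q1 = "\<lambda>x. exp (- (\<Sum>j\<in>S1. (\<Sum>i\<in>I1. x i * v i j)\<^sup>2) / 2)"
  let ?q2 = "\<lambda>x. exp (- (\<Sum>j\<in>S2. (\<Sum>i\<in>I2. x i * v i j)\<^sup>2) / 2)"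
  let ?m = "\<lambda>x y. merge I1 I2 (x,y)"
  have s1: "(\<Sum>i\<in>I1 \<union> I2. ?m x y i * v i j) = (\<Sum>i\<in>I1. x i * v i j)" if "j \<in> S1" for x y j
  proof -
    have "(\<Sum>i\<in>I1 \<union> I2. ?m x y i * v i j) = (\<Sum>i\<in>I1. ?m x y i * v i j)"
      by (rule sum.mono_neutral_right) (use fin v2 that in auto)
    then show ?thesis by (simp add: merge_def)
  qed
  have s2: "(\<Sum>i\<in>I1 \<union> I2. ?m x y i * v i j) = (\<Sum>i\<in>I2. y i * v i j)" if "j \<in> S2" for x y j
  proof -
    have "(\<Sum>i\<in>I1 \<union> I2. ?m x y i * v i j) = (\<Sum>i\<in>I2. ?m x y i * v i j)"
      by (rule sum.mono_neutral_right) (use fin v1 that in auto)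
    also have "\<dots> = (\<Sum>i\<in>I2. y i * v i j)"
      by (rule sum.cong[OF refl]) (use disj(1) in \<open>auto simp: merge_def\<close>)
    finally show ?thesis .
  qed
  have "exp (- (\<Sum>j\<in>S1 \<union> S2. (\<Sum>i\<in>I1 \<union> I2. ?m x y i * v i j)\<^sup>2) / 2) = ?q1 x * ?q2 y" for x y
    by (simp add: sum.union_disjoint[OF fin(3,4) disj(2)] s1 s2 exp_add[symmetric] add_divide_distrib)
  then have "gauss_int (I1 \<union> I2) (S1 \<union> S2) v = (\<integral>x. (\<integral>y. ?q1 x * ?q2 y \<partial>gauss_prod I2) \<partial>gauss_prod I1)"
    unfolding gauss_int_def product_integral_fold[OF disj(1) fin(1,2) integrable_gauss_quad] by simp
  then show ?thesis by (simp add: gauss_int_def)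
qed

text \<open>Half of \<open>ln det (1 + V V^T)\<close>; equivalently
  \<open>- ln E exp (- S / 2)\<close>, where \<open>S\<close> is the sum over \<open>i\<close> of
  the squares of the Gaussian forms with coefficient rows \<open>v i\<close>.\<close>

definition gauss_phi :: "'i set \<Rightarrow> 'j set \<Rightarrow> ('i \<Rightarrow> 'j \<Rightarrow> real) \<Rightarrow> real" where
  "gauss_phi I S v = - ln (gauss_int I S v)"

lemma gauss_phi_cong:
  "(\<And>i j. i \<in> I \<Longrightarrow> j \<in> S \<Longrightarrow> v i j = w i j) \<Longrightarrow> gauss_phi I S v = gauss_phi I S w"
  unfolding gauss_phi_def using gauss_int_cong[where I=I and S=S and v=v and w=w] by simp

lemma gauss_phi_empty [simp]: "gauss_phi {} S v = 0"
  by (simp add: gauss_phi_def gauss_int_def prob_space.prob_space[OF prob_space_gauss_prod])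

lemma gauss_phi_subset:
  assumes "finite I'" "finite S" "I \<subseteq> I'"
  shows "gauss_phi I S v \<le> gauss_phi I' S v"
  unfolding gauss_phi_def
  using gauss_int_subset[OF assms, where v=v] gauss_int_pos[where I="I'" and S=S and v=v] by simp

lemma gauss_phi_scale_mono:
  assumes "finite I" "finite S" "\<And>i. i \<in> I \<Longrightarrow> (s i)\<^sup>2 \<le> (s' i)\<^sup>2"
  shows "gauss_phi I S (\<lambda>i j. s i * v i j) \<le> gauss_phi I S (\<lambda>i j. s' i * v i j)"
  unfolding gauss_phi_def
  using gauss_int_scale_mono[OF assms(1,2), of s s' v] assms(3) gauss_int_pos[of I S "\<lambda>i j. s' i * v i j"] by simp

lemma gauss_phi_insert_le:
  assumes "finite I" "i \<notin> I" "finite S"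
  shows "gauss_phi (insert i I) S v \<le> gauss_phi I S v + ln (1 + (\<Sum>j\<in>S. (v i j)\<^sup>2)) / 2"
proof -
  let ?c = "1 + (\<Sum>j\<in>S. (v i j)\<^sup>2)"
  have c: "?c > 0" by (smt (verit) sum_nonneg zero_le_power2)
  have "ln (gauss_int I S v) - ln (sqrt ?c) = ln (gauss_int I S v / sqrt ?c)"
    by (rule ln_divide_pos[symmetric]) (use c gauss_int_pos in auto)
  also have "\<dots> \<le> ln (gauss_int (insert i I) S v)"
    using gauss_int_insert_ge[OF assms, where v=v] c gauss_int_pos[where I="I" and S=S and v=v]
    by (intro ln_mono) auto
  finally show ?thesis unfolding gauss_phi_def using c by (simp add: ln_sqrt)
qed

lemma gauss_phi_Un_le:
  assumes "finite I1" "finite I2" "I1 \<inter> I2 = {}" "finite S"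
  shows "gauss_phi (I1 \<union> I2) S v \<le> gauss_phi I1 S v + (\<Sum>i\<in>I2. ln (1 + (\<Sum>j\<in>S. (v i j)\<^sup>2)) / 2)"
  using assms(2,3)
proof (induction I2)
  case (insert i I2)
  then have "gauss_phi (insert i (I1 \<union> I2)) S v \<le> gauss_phi (I1 \<union> I2) S v + ln (1 + (\<Sum>j\<in>S. (v i j)\<^sup>2)) / 2"
    using assms by (intro gauss_phi_insert_le) auto
  with insert show ?case by (auto simp: algebra_simps)
qed simp

lemma gauss_phi_UN:
  assumes "finite A" "\<And>b. b \<in> A \<Longrightarrow> finite (I b)" "\<And>b. b \<in> A \<Longrightarrow> finite (S b)"
    "\<And>b c. b \<in> A \<Longrightarrow> c \<in> A \<Longrightarrow> b \<noteq> c \<Longrightarrow> I b \<inter> I c = {}"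
    "\<And>b c. b \<in> A \<Longrightarrow> c \<in> A \<Longrightarrow> b \<noteq> c \<Longrightarrow> S b \<inter> S c = {}"
    "\<And>b c i j. b \<in> A \<Longrightarrow> c \<in> A \<Longrightarrow> b \<noteq> c \<Longrightarrow> i \<in> I b \<Longrightarrow> j \<in> S c \<Longrightarrow> v i j = 0"
  shows "gauss_phi (\<Union>b\<in>A. I b) (\<Union>b\<in>A. S b) v = (\<Sum>b\<in>A. gauss_phi (I b) (S b) v)"
  using assms
proof (induction A)
  case (insert b A)
  have "gauss_int (I b \<union> (\<Union>b\<in>A. I b)) (S b \<union> (\<Union>b\<in>A. S b)) v
      = gauss_int (I b) (S b) v * gauss_int (\<Union>b\<in>A. I b) (\<Union>b\<in>A. S b) v"
  proof (rule gauss_int_union)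
    show "I b \<inter> (\<Union>b\<in>A. I b) = {}" using insert.prems(3)[of b] insert.hyps by blast
    show "S b \<inter> (\<Union>b\<in>A. S b) = {}" using insert.prems(4)[of b] insert.hyps by blast
    show "v i j = 0" if "i \<in> I b" "j \<in> (\<Union>b\<in>A. S b)" for i j
      using that insert.prems(5)[of b _ i j] insert.hyps by blast
    show "v i j = 0" if "i \<in> (\<Union>b\<in>A. I b)" "j \<in> S b" for i j
      using that insert.prems(5)[of _ b i j] insert.hyps by blast
  qed (use insert in auto)
  then have "gauss_phi (\<Union>b\<in>insert b A. I b) (\<Union>b\<in>insert b A. S b) v
      = gauss_phi (I b) (S b) v + gauss_phi (\<Union>b\<in>A. I b) (\<Union>b\<in>A. S b) v"
    using gauss_int_pos[of "I b" "S b" v] gauss_int_pos[of "\<Union>b\<in>A. I b" "\<Union>b\<in>A. S b" v]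
    by (simp add: gauss_phi_def ln_mult_pos)
  also have "gauss_phi (\<Union>b\<in>A. I b) (\<Union>b\<in>A. S b) v = (\<Sum>b\<in>A. gauss_phi (I b) (S b) v)"
  proof (rule insert.IH)
    show "v i j = 0" if "b \<in> A" "c \<in> A" "b \<noteq> c" "i \<in> I b" "j \<in> S c" for b c i j
      by (rule insert.prems(5)[of b c]) (use that in auto)
  qed (use insert.prems(1-4) in auto)
  finally show ?case using insert.hyps by simp
qed simp

lemma gauss_phi_support:
  assumes "finite S" "S' \<subseteq> S" "\<And>i j. i \<in> I \<Longrightarrow> j \<in> S - S' \<Longrightarrow> v i j = 0"
  shows "gauss_phi I S v = gauss_phi I S' v"
  unfolding gauss_phi_def using gauss_int_support[OF assms(1,2), where I=I and v=v] assms(3) by simp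

text \<open>The inequality \<open>(a + b)\<^sup>2 \<le> (1 + \<delta>) * a\<^sup>2 + (1 + 1 /
  \<delta>) * b\<^sup>2\<close> replaces the rows \<open>u + w\<close> by two families of rows over
  the same columns. The rows of \<open>w\<close> are then removed one at a time at logarithmic cost,
  so \<open>u\<close> and \<open>w\<close> may be dependent.\<close>

lemma gauss_phi_perturb:
  assumes fin: "finite I" "finite S" and "\<delta> > 0"
  shows "gauss_phi I S (\<lambda>i j. u i j + w i j) \<le> gauss_phi I S (\<lambda>i j. sqrt (1 + \<delta>) * u i j)
    + (\<Sum>i\<in>I. ln (1 + (1 + 1 / \<delta>) * (\<Sum>j\<in>S. (w i j)\<^sup>2)) / 2)"
proof -
  \<comment> \<open>The sum type stacks the scaled rows of \<open>u\<close> and of \<open>w\<close>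
    into a single matrix.\<close>
  define V where "V = case_sum (\<lambda>i j. sqrt (1 + \<delta>) * u i j) (\<lambda>i j. sqrt (1 + 1 / \<delta>) * w i j)"
  have pos: "1 + \<delta> > 0" "1 + 1 / \<delta> > 0" using \<open>\<delta> > 0\<close> by (auto intro: add_pos_pos)
  have ab: "(a + b)\<^sup>2 \<le> (1 + \<delta>) * a\<^sup>2 + (1 + 1 / \<delta>) * b\<^sup>2" for a b :: real
  proof -
    have "(1 + \<delta>) * a\<^sup>2 + (1 + 1 / \<delta>) * b\<^sup>2 - (a + b)\<^sup>2 = (\<delta> * a - b)\<^sup>2 / \<delta>"
      using \<open>\<delta> > 0\<close> by (simp add: power2_eq_square field_simps)
    also have "\<dots> \<ge> 0" using \<open>\<delta> > 0\<close> by simp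
    finally show ?thesis by simp
  qed
  have sc: "(\<Sum>j\<in>S. x j * (sqrt c * f j))\<^sup>2 = c * (\<Sum>j\<in>S. x j * f j)\<^sup>2" if "c > 0" for c x f
  proof -
    have "(\<Sum>j\<in>S. x j * (sqrt c * f j)) = sqrt c * (\<Sum>j\<in>S. x j * f j)"
      by (subst sum_distrib_left) (simp add: mult_ac)
    then show ?thesis using that by (simp add: power_mult_distrib)
  qed
  have "gauss_int (Inl ` I \<union> Inr ` I) S V \<le> gauss_int I S (\<lambda>i j. u i j + w i j)"
    unfolding gauss_int_dual[OF fin] gauss_int_dual[OF finite_UnI[OF finite_imageI[OF fin(1)] finite_imageI[OF fin(1)]] fin(2)]
      gauss_int_def[of S]
  proof (intro integral_mono integrable_gauss_quad)
    fix x
    have "(\<Sum>i\<in>I. (\<Sum>j\<in>S. x j * (u i j + w i j))\<^sup>2)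
        \<le> (\<Sum>i\<in>I. (1 + \<delta>) * (\<Sum>j\<in>S. x j * u i j)\<^sup>2 + (1 + 1 / \<delta>) * (\<Sum>j\<in>S. x j * w i j)\<^sup>2)"
      unfolding distrib_left sum.distrib[of _ _ S] by (rule sum_mono) (rule ab)
    also have "\<dots> = (\<Sum>i\<in>Inl ` I \<union> Inr ` I. (\<Sum>j\<in>S. x j * V i j)\<^sup>2)"
      by (subst sum.union_disjoint)
         (auto simp: fin sum.reindex V_def sum.distrib sc pos)
    finally show "exp (- (\<Sum>i\<in>Inl ` I \<union> Inr ` I. (\<Sum>j\<in>S. x j * V i j)\<^sup>2) / 2)
        \<le> exp (- (\<Sum>i\<in>I. (\<Sum>j\<in>S. x j * (u i j + w i j))\<^sup>2) / 2)" by simp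
  qed
  then have "gauss_phi I S (\<lambda>i j. u i j + w i j) \<le> gauss_phi (Inl ` I \<union> Inr ` I) S V"
    unfolding gauss_phi_def using gauss_int_pos[of "Inl ` I \<union> Inr ` I" S V] by simp
  also have "\<dots> \<le> gauss_phi (Inl ` I) S V + (\<Sum>i\<in>Inr ` I. ln (1 + (\<Sum>j\<in>S. (V i j)\<^sup>2)) / 2)"
    by (rule gauss_phi_Un_le) (use fin in auto)
  also have "gauss_phi (Inl ` I) S V = gauss_phi I S (\<lambda>i j. sqrt (1 + \<delta>) * u i j)"
    unfolding gauss_phi_def by (subst gauss_int_reindex_fst) (auto simp: fin V_def)
  also have "(\<Sum>i\<in>Inr ` I. ln (1 + (\<Sum>j\<in>S. (V i j)\<^sup>2)) / 2)
      = (\<Sum>i\<in>I. ln (1 + (1 + 1 / \<delta>) * (\<Sum>j\<in>S. (w i j)\<^sup>2)) / 2)"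
    using pos by (subst sum.reindex) (auto simp: V_def power_mult_distrib sum_distrib_left)
  finally show ?thesis .
qed

section \<open>Circulant forms\<close>

text \<open>For fixed \<open>k\<close> the map \<open>j \<mapsto> k - j\<close> permutes the
  residues mod \<open>n\<close>, and \<open>g\<close> depends on the residue only.\<close>

lemma sum_periodic_reflect:
  fixes g :: "int \<Rightarrow> 'b::comm_monoid_add"
  assumes n: "n > 0" and per: "\<And>x. g (x mod n) = g x"
  shows "(\<Sum>j\<in>{0..<n}. g (k - j)) = (\<Sum>r\<in>{0..<n}. g r)"
proof (rule sum.reindex_bij_witness[where i="\<lambda>r. (k - r) mod n" and j="\<lambda>r. (k - r) mod n"])
  fix a assume a: "a \<in> {0..<n}"
  show "(k - (k - a) mod n) mod n = a"
    using a by (simp add: mod_diff_right_eq)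
  then show "(k - (k - a) mod n) mod n = a" .
  show "g ((k - a) mod n) = g (k - a)" by (rule per)
qed (use n in auto)

definition dft_char :: "int \<Rightarrow> int \<Rightarrow> complex" where
  "dft_char n x = cis (2 * pi * of_int x / of_int n)"

lemma dft_char_add: "dft_char n (x + y) = dft_char n x * dft_char n y"
  by (simp add: dft_char_def cis_mult add_divide_distrib distrib_left)

lemma dft_char_minus: "dft_char n (- x) = cnj (dft_char n x)"
  by (simp add: dft_char_def cis_cnj)

lemma dft_char_mult_n [simp]:
  assumes "n > 0"
  shows "dft_char n (n * x) = 1"
proof -
  have "2 * pi * of_int (n * x) / of_int n = 2 * pi * of_int x"
    using assms by simp
  then show ?thesis unfolding dft_char_def by (simp add: cis_multiple_2pi)
qed

lemma dft_char_mod: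
  assumes "n > 0"
  shows "dft_char n (x mod n) = dft_char n x"
proof -
  have "dft_char n x = dft_char n (n * (x div n) + x mod n)" by simp
  also have "\<dots> = dft_char n (x mod n)" using assms by (simp only: dft_char_add dft_char_mult_n mult_1)
  finally show ?thesis ..
qed

lemma dft_char_cong:
  assumes "n > 0" "x mod n = y mod n"
  shows "dft_char n x = dft_char n y"
  using dft_char_mod[OF assms(1), of x] dft_char_mod[OF assms(1), of y] assms(2) by simp

lemma dft_char_eq_1:
  assumes n: "n > 0" and "dft_char n x = 1"
  shows "n dvd x"
proof -
  have "cis (2 * pi * of_int x / of_int n) = 1" using assms(2) by (simp add: dft_char_def)
  then have "cos (2 * pi * of_int x / of_int n) = 1"
    by (metis cis.simps(1) one_complex.sel(1))
  then obtain m :: int where "2 * pi * of_int x / of_int n = of_int m * 2 * pi"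
    by (auto simp: cos_one_2pi_int)
  then have "real_of_int x = of_int m * of_int n" using n by (simp add: field_simps)
  then have "x = m * n" by (metis of_int_eq_iff of_int_mult)
  then show ?thesis by simp
qed

lemma sum_dft_char:
  assumes n: "n > 0"
  shows "(\<Sum>l\<in>{0..<n}. dft_char n (x * l)) = (if n dvd x then of_int n else 0)"
proof (cases "n dvd x")
  case True
  then obtain y where "x = n * y" by auto
  then have "dft_char n (x * l) = 1" for l
    using dft_char_mult_n[OF n, of "y * l"] by (simp add: mult_ac)
  then show ?thesis using True n by simp
next
  case False
  let ?S = "\<Sum>l\<in>{0..<n}. dft_char n (x * l)"
  \<comment> \<open>Multiplication by the character shifts the summation index by one; the shift is
    carried out as two reflections.\<close>
  have "dft_char n x * ?S = (\<Sum>l\<in>{0..<n}. (\<lambda>l. dft_char n (- x * l)) (- 1 - l))"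
    unfolding sum_distrib_left dft_char_add[symmetric] by (rule sum.cong) (auto simp: algebra_simps)
  also have "\<dots> = (\<Sum>l\<in>{0..<n}. dft_char n (- x * l))"
    by (rule sum_periodic_reflect[OF n]) (rule dft_char_cong[OF n], rule mod_mult_right_eq)
  also have "\<dots> = (\<Sum>l\<in>{0..<n}. (\<lambda>l. dft_char n (x * l)) (0 - l))" by simp
  also have "\<dots> = ?S"
    by (rule sum_periodic_reflect[OF n]) (rule dft_char_cong[OF n], simp add: mod_mult_right_eq)
  finally have "(dft_char n x - 1) * ?S = 0" by (simp add: algebra_simps)
  then show ?thesis using dft_char_eq_1[OF n, of x] False by auto
qed

definition dft :: "int \<Rightarrow> (int \<Rightarrow> real) \<Rightarrow> int \<Rightarrow> complex" where
  "dft n z l = (\<Sum>k\<in>{0..<n}. of_real (z k) * dft_char n (k * l))"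

lemma dft_minus: "dft n z (- l) = cnj (dft n z l)"
  by (simp add: dft_def dft_char_minus)

lemma dft_mod:
  assumes "n > 0" shows "dft n z (l mod n) = dft n z l"
  unfolding dft_def
  by (intro sum.cong refl arg_cong2[where f="(*)"] dft_char_cong[OF assms])
     (simp add: mod_mult_right_eq)

lemma dft_parseval:
  assumes n: "n > 0"
  shows "(\<Sum>l\<in>{0..<n}. (cmod (dft n z l))\<^sup>2) = of_int n * (\<Sum>k\<in>{0..<n}. (z k)\<^sup>2)"
proof -
  have "complex_of_real (\<Sum>l\<in>{0..<n}. (cmod (dft n z l))\<^sup>2) = (\<Sum>l\<in>{0..<n}. dft n z l * cnj (dft n z l))"
    by (simp only: of_real_sum complex_norm_square)
  also have "\<dots> = (\<Sum>l\<in>{0..<n}. \<Sum>k\<in>{0..<n}. \<Sum>k'\<in>{0..<n}. of_real (z k * z k') * dft_char n ((k - k') * l))"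
    unfolding dft_def cnj_sum sum_product complex_cnj_mult
    by (intro sum.cong refl) (simp add: dft_char_minus[symmetric] dft_char_add[symmetric] algebra_simps
        flip: dft_char_add)
  also have "\<dots> = (\<Sum>k\<in>{0..<n}. \<Sum>k'\<in>{0..<n}. of_real (z k * z k') * (\<Sum>l\<in>{0..<n}. dft_char n ((k - k') * l)))"
    unfolding sum_distrib_left
    by (subst sum.swap, rule sum.cong[OF refl], rule sum.swap)
  also have "\<dots> = (\<Sum>k\<in>{0..<n}. \<Sum>k'\<in>{0..<n}. if k' = k then of_real (z k * z k') * of_int n else 0)"
  proof (intro sum.cong refl)
    fix k k' assume k: "k \<in> {0..<n}" "k' \<in> {0..<n}"
    then have "n dvd k - k' \<longleftrightarrow> k' = k"
      by (auto simp: mod_eq_dvd_iff[symmetric])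
    then show "of_real (z k * z k') * (\<Sum>l\<in>{0..<n}. dft_char n ((k - k') * l)) =
      (if k' = k then of_real (z k * z k') * of_int n else (0::complex))"
      unfolding sum_dft_char[OF n] by simp
  qed
  also have "\<dots> = (\<Sum>k\<in>{0..<n}. of_real (z k * z k) * of_int n)"
    by (intro sum.cong refl) (simp add: sum.delta)
  also have "\<dots> = complex_of_real (of_int n * (\<Sum>k\<in>{0..<n}. (z k)\<^sup>2))"
    by (simp add: sum_distrib_left power2_eq_square mult_ac)
  finally show ?thesis by (simp only: of_real_eq_iff)
qed

text \<open>In \<open>j\<close> the sum is a correlation rather than a convolution: writing
  \<open>j = k - (k - j)\<close> in the character conjugates the transform of
  \<open>w\<close>.\<close>

lemma dft_convolution:
  assumes n: "n > 0" and per: "\<And>x. w (x mod n) = w x"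
  shows "dft n (\<lambda>j. \<Sum>k\<in>{0..<n}. z k * w (k - j)) l = dft n z l * cnj (dft n w l)"
proof -
  have cw: "(\<Sum>j\<in>{0..<n}. (\<lambda>r. of_real (w r) * dft_char n (- r * l)) (k - j)) = cnj (dft n w l)" for k
  proof -
    have "(\<Sum>j\<in>{0..<n}. (\<lambda>r. of_real (w r) * dft_char n (- r * l)) (k - j))
        = (\<Sum>r\<in>{0..<n}. of_real (w r) * dft_char n (- r * l))"
    proof (rule sum_periodic_reflect[OF n])
      fix x
      have "dft_char n (- (x mod n) * l) = dft_char n (- x * l)"
        by (rule dft_char_cong[OF n]) (metis mod_minus_eq mod_mult_left_eq)
      then show "of_real (w (x mod n)) * dft_char n (- (x mod n) * l) = of_real (w x) * dft_char n (- x * l)"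
        by (simp add: per)
    qed
    then show ?thesis by (simp add: dft_def dft_char_minus[symmetric])
  qed
  have "dft n (\<lambda>j. \<Sum>k\<in>{0..<n}. z k * w (k - j)) l
      = (\<Sum>k\<in>{0..<n}. \<Sum>j\<in>{0..<n}. of_real (z k * w (k - j)) * dft_char n (j * l))"
    unfolding dft_def of_real_sum sum_distrib_right by (rule sum.swap)
  also have "\<dots> = (\<Sum>k\<in>{0..<n}. of_real (z k) * dft_char n (k * l) *
      (\<Sum>j\<in>{0..<n}. (\<lambda>r. of_real (w r) * dft_char n (- r * l)) (k - j)))"
    unfolding sum_distrib_left
  proof (intro sum.cong refl)
    fix k j
    have "dft_char n (j * l) = dft_char n (k * l) * dft_char n (- (k - j) * l)"
      unfolding dft_char_add[symmetric] by (simp add: algebra_simps)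
    then show "of_real (z k * w (k - j)) * dft_char n (j * l) =
      of_real (z k) * dft_char n (k * l) * (of_real (w (k - j)) * dft_char n (- (k - j) * l))" by simp
  qed
  also have "\<dots> = (\<Sum>k\<in>{0..<n}. of_real (z k) * dft_char n (k * l) * cnj (dft n w l))"
    by (simp only: cw)
  finally show ?thesis by (simp add: dft_def sum_distrib_right)
qed

definition cas :: "int \<Rightarrow> int \<Rightarrow> real" where
  "cas n x = Re (dft_char n x) + Im (dft_char n x)"

text \<open>The cross terms \<open>Re * Im\<close> cancel under \<open>l \<mapsto> -l\<close>, so a real orthogonal basis
  (the Hartley basis) diagonalizes every symmetric circulant form.\<close>
lemma hartley_square_sum:
  assumes n: "n > 0" and per: "\<And>x. m (x mod n) = m x" and even: "\<And>x. m (- x) = m x"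
  shows "(\<Sum>l\<in>{0..<n}. m l * (\<Sum>k\<in>{0..<n}. z k * cas n (k * l))\<^sup>2) = (\<Sum>l\<in>{0..<n}. m l * (cmod (dft n z l))\<^sup>2)"
proof -
  have h: "(\<Sum>k\<in>{0..<n}. z k * cas n (k * l)) = Re (dft n z l) + Im (dft n z l)" for l
    by (simp add: dft_def cas_def distrib_left sum.distrib)
  let ?g = "\<lambda>l. m l * (Re (dft n z l) * Im (dft n z l))"
  have "(\<Sum>l\<in>{0..<n}. ?g (0 - l)) = (\<Sum>l\<in>{0..<n}. ?g l)"
    by (rule sum_periodic_reflect[OF n]) (simp add: per dft_mod[OF n])
  then have "(\<Sum>l\<in>{0..<n}. ?g l) = 0"
    by (simp add: even dft_minus sum_negf)
  moreover have "m l * (Re (dft n z l) + Im (dft n z l))\<^sup>2 = m l * (cmod (dft n z l))\<^sup>2 + 2 * ?g l" for l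
    by (simp add: cmod_power2 power2_sum algebra_simps)
  ultimately show ?thesis
    unfolding h by (simp add: sum.distrib sum_distrib_left[symmetric])
qed

text \<open>Parseval rewrites the form in the Hartley basis with the squared moduli of the
  eigenvalues as weights. This basis is orthogonal, so after exchanging rows and columns the
  exponent is a weighted sum of single squares and the integral is a product.\<close>

lemma gauss_phi_circulant:
  assumes n: "n > 0" and per: "\<And>x. w (x mod n) = w x"
  shows "gauss_phi {0..<n} {0..<n} (\<lambda>k j. w (k - j)) = (\<Sum>l\<in>{0..<n}. ln (1 + (cmod (dft n w l))\<^sup>2) / 2)"
proof -
  interpret product_sigma_finite "\<lambda>_::int. std_normal_distribution"
    by (rule product_sigma_finite_std_normal)
  define m where "m l = (cmod (dft n w l))\<^sup>2" for l
  define I where "I = {0..<n}"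
  have fin: "finite I" by (simp add: I_def)
  have m: "m l \<ge> 0" for l by (simp add: m_def)
  \<comment> \<open>The division by \<open>n\<close> normalizes the vectors
    \<open>cas n (k * l)\<close>, whose squared length is \<open>n\<close>.\<close>
  define s where "s l = sqrt (m l / of_int n)" for l
  have s2: "(s l)\<^sup>2 = m l / of_int n" for l using n m by (simp add: s_def)
  have mper: "m (l mod n) = m l" and meven: "m (- l) = m l" for l
    by (simp_all add: m_def dft_mod[OF n] dft_minus)
  have 1: "(\<Sum>j\<in>I. (\<Sum>k\<in>I. z k * w (k - j))\<^sup>2) = (\<Sum>l\<in>I. (\<Sum>k\<in>I. z k * (s l * cas n (k * l)))\<^sup>2)" for z
  proof -
    have "of_int n * (\<Sum>j\<in>I. (\<Sum>k\<in>I. z k * w (k - j))\<^sup>2)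
        = (\<Sum>l\<in>I. (cmod (dft n (\<lambda>j. \<Sum>k\<in>{0..<n}. z k * w (k - j)) l))\<^sup>2)"
      unfolding I_def by (rule dft_parseval[OF n, symmetric])
    also have "\<dots> = (\<Sum>l\<in>I. m l * (cmod (dft n z l))\<^sup>2)"
      unfolding dft_convolution[where w=w, OF n per] by (simp add: norm_mult power_mult_distrib m_def mult_ac)
    also have "\<dots> = (\<Sum>l\<in>I. m l * (\<Sum>k\<in>I. z k * cas n (k * l))\<^sup>2)"
      unfolding I_def by (rule hartley_square_sum[OF n mper meven, symmetric])
    also have "\<dots> = (\<Sum>l\<in>I. of_int n * (\<Sum>k\<in>I. z k * (s l * cas n (k * l)))\<^sup>2)"
    proof (rule sum.cong[OF refl])
      fix l
      have "(\<Sum>k\<in>I. z k * (s l * cas n (k * l))) = s l * (\<Sum>k\<in>I. z k * cas n (k * l))"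
        by (subst sum_distrib_left) (simp add: mult_ac)
      then show "m l * (\<Sum>k\<in>I. z k * cas n (k * l))\<^sup>2 = of_int n * (\<Sum>k\<in>I. z k * (s l * cas n (k * l)))\<^sup>2"
        using n by (simp add: power_mult_distrib s2)
    qed
    also have "\<dots> = of_int n * (\<Sum>l\<in>I. (\<Sum>k\<in>I. z k * (s l * cas n (k * l)))\<^sup>2)"
      by (simp add: sum_distrib_left)
    finally show ?thesis using n by simp
  qed
  \<comment> \<open>Orthogonality of the Hartley basis, obtained from
    \<open>hartley_square_sum\<close> with constant multiplier 1 and from Parseval.\<close>
  have 2: "(\<Sum>k\<in>I. (\<Sum>l\<in>I. x l * (s l * cas n (k * l)))\<^sup>2) = (\<Sum>l\<in>I. m l * (x l)\<^sup>2)" for x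
  proof -
    have "(\<Sum>k\<in>I. (\<Sum>l\<in>I. x l * (s l * cas n (k * l)))\<^sup>2)
        = (\<Sum>k\<in>{0..<n}. 1 * (\<Sum>l\<in>{0..<n}. (x l * s l) * cas n (l * k))\<^sup>2)"
      unfolding I_def by (simp add: mult_ac)
    also have "\<dots> = (\<Sum>k\<in>{0..<n}. 1 * (cmod (dft n (\<lambda>l. x l * s l) k))\<^sup>2)"
      by (rule hartley_square_sum[OF n]) auto
    also have "\<dots> = of_int n * (\<Sum>k\<in>{0..<n}. (x k * s k)\<^sup>2)"
      using dft_parseval[OF n] by simp
    also have "\<dots> = (\<Sum>l\<in>I. m l * (x l)\<^sup>2)"
      unfolding sum_distrib_left I_def using n by (simp add: power_mult_distrib s2 mult_ac)
    finally show ?thesis .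
  qed
  have "gauss_int I I (\<lambda>k j. w (k - j)) = gauss_int I I (\<lambda>k l. s l * cas n (k * l))"
    unfolding gauss_int_def 1 ..
  also have "\<dots> = gauss_int I I (\<lambda>l k. s l * cas n (k * l))"
    by (rule gauss_int_dual[OF fin fin])
  also have "\<dots> = (\<integral>x. (\<Prod>l\<in>I. exp (- m l * (x l)\<^sup>2 / 2)) \<partial>gauss_prod I)"
    unfolding gauss_int_def 2 by (simp add: exp_sum[OF fin, symmetric] sum_negf sum_divide_distrib)
  also have "\<dots> = (\<Prod>l\<in>I. \<integral>y. exp (- m l * y\<^sup>2 / 2) \<partial>std_normal_distribution)"
    by (rule product_integral_prod[OF fin]) (auto intro!: integrable_std_normal_bounded[where B=1] simp: m)
  also have "\<dots> = (\<Prod>l\<in>I. 1 / sqrt (1 + m l))"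
    by (intro prod.cong refl std_normal_exp_square m)
  finally have J: "gauss_int I I (\<lambda>k j. w (k - j)) = (\<Prod>l\<in>I. 1 / sqrt (1 + m l))" .
  have pos: "1 + m l > 0" for l using m[of l] by linarith
  have ne: "1 + m l \<noteq> 0" for l using pos[of l] by simp
  have lnl: "ln (1 / sqrt (1 + m l)) = - (ln (1 + m l) / 2)" for l
    using pos[of l] by (simp add: ln_div ln_sqrt)
  have "ln (\<Prod>l\<in>{0..<n}. 1 / sqrt (1 + m l)) = (\<Sum>l\<in>{0..<n}. ln (1 / sqrt (1 + m l)))"
    by (rule ln_prod) (use pos ne in auto)
  then show ?thesis
    unfolding gauss_phi_def J[unfolded I_def] lnl by (simp add: sum_negf m_def)
qed

section \<open>Moving averages of finite range\<close>

text \<open>Row \<open>k\<close> holds the coefficients of \<open>s k * U_k\<close> in the variables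
  \<open>X_j\<close>. The columns are those within distance \<open>L\<close> of \<open>I\<close>, so
  no common window has to be carried along.\<close>

definition band_phi :: "int \<Rightarrow> (int \<Rightarrow> real) \<Rightarrow> (int \<Rightarrow> real) \<Rightarrow> int set \<Rightarrow> real" where
  "band_phi L a s I = gauss_phi I (\<Union>k\<in>I. {k-L..k+L}) (\<lambda>k j. s k * a (k - j))"

locale finite_range =
  fixes L :: int and a :: "int \<Rightarrow> real"
  assumes L0: "L \<ge> 0" and supp: "\<And>m. \<bar>m\<bar> > L \<Longrightarrow> a m = 0"
begin

abbreviation "bphi \<equiv> band_phi L a"

text \<open>The variance of each moving-average variable, equal to the squared length of each
  unweighted row.\<close>

definition energy :: real where "energy = (\<Sum>m\<in>{-L..L}. (a m)\<^sup>2)"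

lemma energy_nonneg: "energy \<ge> 0"
  by (simp add: energy_def sum_nonneg)

text \<open>Columns out of reach of \<open>I\<close> are zero, so different index sets can be
  compared over one common set of columns.\<close>

lemma bphi_eq:
  assumes "finite S" "\<And>k. k \<in> I \<Longrightarrow> {k-L..k+L} \<subseteq> S"
  shows "bphi s I = gauss_phi I S (\<lambda>k j. s k * a (k - j))"
  unfolding band_phi_def
proof (rule gauss_phi_support[symmetric])
  fix k j assume kj: "k \<in> I" "j \<in> S - (\<Union>k\<in>I. {k-L..k+L})"
  then have "\<bar>k - j\<bar> > L" by force
  then show "s k * a (k - j) = 0" by (simp add: supp)
qed (use assms in auto)

lemma bphi_mono:
  assumes "finite I'" "I \<subseteq> I'"
  shows "bphi s I \<le> bphi s I'"
proof -
  let ?S = "\<Union>k\<in>I'. {k-L..k+L}"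
  have "bphi s I = gauss_phi I ?S (\<lambda>k j. s k * a (k - j))"
    by (rule bphi_eq) (use assms in auto)
  also have "\<dots> \<le> gauss_phi I' ?S (\<lambda>k j. s k * a (k - j))"
    by (rule gauss_phi_subset) (use assms in auto)
  finally show ?thesis by (simp add: band_phi_def)
qed

lemma bphi_scale_mono:
  assumes "finite I" "\<And>k. k \<in> I \<Longrightarrow> (s k)\<^sup>2 \<le> (s' k)\<^sup>2"
  shows "bphi s I \<le> bphi s' I"
  unfolding band_phi_def by (rule gauss_phi_scale_mono) (use assms in auto)

lemma row_energy:
  assumes "finite S" "{k-L..k+L} \<subseteq> S"
  shows "(\<Sum>j\<in>S. (c * a (k - j))\<^sup>2) = c\<^sup>2 * energy"
proof -
  have "(\<Sum>j\<in>S. (a (k - j))\<^sup>2) = (\<Sum>j\<in>{k-L..k+L}. (a (k - j))\<^sup>2)"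
    by (rule sum.mono_neutral_right) (use assms in \<open>auto simp: supp\<close>)
  also have "\<dots> = energy" unfolding energy_def
    by (rule sum.reindex_bij_witness[where i="\<lambda>m. k - m" and j="\<lambda>j. k - j"]) auto
  finally show ?thesis by (simp add: power_mult_distrib sum_distrib_left[symmetric])
qed

lemma bphi_Un_le:
  assumes "finite I1" "finite I2" "I1 \<inter> I2 = {}"
  shows "bphi s (I1 \<union> I2) \<le> bphi s I1 + (\<Sum>k\<in>I2. ln (1 + (s k)\<^sup>2 * energy) / 2)"
proof -
  let ?S = "\<Union>k\<in>I1 \<union> I2. {k-L..k+L}"
  have S: "finite ?S" using assms by auto
  have "bphi s (I1 \<union> I2) = gauss_phi (I1 \<union> I2) ?S (\<lambda>k j. s k * a (k - j))"
    by (simp add: band_phi_def)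
  also have "\<dots> \<le> gauss_phi I1 ?S (\<lambda>k j. s k * a (k - j)) +
      (\<Sum>k\<in>I2. ln (1 + (\<Sum>j\<in>?S. (s k * a (k - j))\<^sup>2)) / 2)"
    by (rule gauss_phi_Un_le) (use assms S in auto)
  also have "gauss_phi I1 ?S (\<lambda>k j. s k * a (k - j)) = bphi s I1"
    by (rule bphi_eq[symmetric]) (use S in auto)
  also have "(\<Sum>k\<in>I2. ln (1 + (\<Sum>j\<in>?S. (s k * a (k - j))\<^sup>2)) / 2) = (\<Sum>k\<in>I2. ln (1 + (s k)\<^sup>2 * energy) / 2)"
  proof (rule sum.cong[OF refl])
    fix k assume "k \<in> I2"
    then show "ln (1 + (\<Sum>j\<in>?S. (s k * a (k - j))\<^sup>2)) / 2 = ln (1 + (s k)\<^sup>2 * energy) / 2"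
      by (subst row_energy[OF S]) auto
  qed
  finally show ?thesis .
qed

text \<open>The rows \<open>k\<close> of \<open>a (k - j)\<close> in different cores have disjoint supports in \<open>j\<close>.\<close>
definition core :: "int \<Rightarrow> int \<Rightarrow> int set" where
  "core B b = {b * B..<b * B + B - 2 * L}"

lemma finite_core [simp]: "finite (core B b)"
  by (simp add: core_def)

lemma block_disjoint:
  fixes b c B :: int
  assumes "b \<noteq> c" "B > 0"
  shows "{b * B + x..<b * B + B + x} \<inter> {c * B + x..<c * B + B + x} = {}"
proof -
  have "b * B + B \<le> c * B \<or> c * B + B \<le> b * B"
  proof (cases "b < c")
    case True
    then have "(b + 1) * B \<le> c * B" using assms by (intro mult_right_mono) auto
    then show ?thesis by (simp add: algebra_simps)
  next
    case False
    then have "(c + 1) * B \<le> b * B" using assms by (intro mult_right_mono) auto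
    then show ?thesis by (simp add: algebra_simps)
  qed
  then show ?thesis by auto
qed

lemma core_disjoint:
  assumes "b \<noteq> c" "B > 0"
  shows "core B b \<inter> core B c = {}"
  using block_disjoint[OF assms, of 0] L0 unfolding core_def by fastforce

lemma bphi_cores:
  assumes "finite A" "B > 0"
  shows "bphi s (\<Union>b\<in>A. core B b) = (\<Sum>b\<in>A. bphi s (core B b))"
proof -
  \<comment> \<open>A core has length \<open>B - 2 * L\<close>; widened by \<open>L\<close> on both
    sides it occupies exactly one interval of a partition into lengths \<open>B\<close>.\<close>
  let ?S = "\<lambda>b. {b * B + - L..<b * B + B + - L}"
  let ?v = "\<lambda>k j. s k * a (k - j)"
  have near: "j \<in> ?S b" if "k \<in> core B b" "\<bar>k - j\<bar> \<le> L" for k j b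
    using that by (auto simp: core_def)
  have "bphi s (\<Union>b\<in>A. core B b) = gauss_phi (\<Union>b\<in>A. core B b) (\<Union>b\<in>A. ?S b) ?v"
  proof (rule bphi_eq)
    fix k assume "k \<in> (\<Union>b\<in>A. core B b)"
    then obtain b where "b \<in> A" "k \<in> core B b" by auto
    then show "{k-L..k+L} \<subseteq> (\<Union>b\<in>A. ?S b)" using near[of k b] by force
  qed (use assms in auto)
  also have "\<dots> = (\<Sum>b\<in>A. gauss_phi (core B b) (?S b) ?v)"
  proof (rule gauss_phi_UN)
    fix b c i j assume "b \<noteq> c" and ij: "i \<in> core B b" "j \<in> ?S c"
    then have "j \<notin> ?S b" using block_disjoint[OF \<open>b \<noteq> c\<close> assms(2), of "-L"] by blast
    then have "\<bar>i - j\<bar> > L" using near[OF ij(1), of j] by linarith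
    then show "s i * a (i - j) = 0" by (simp add: supp)
  next
    fix b c :: int assume bc: "b \<noteq> c"
    show "core B b \<inter> core B c = {}" by (rule core_disjoint[OF bc assms(2)])
    show "?S b \<inter> ?S c = {}" by (rule block_disjoint[OF bc assms(2)])
  qed (use assms in auto)
  also have "\<dots> = (\<Sum>b\<in>A. bphi s (core B b))"
    by (intro sum.cong refl bphi_eq[symmetric]) (auto simp: core_def)
  finally show ?thesis .
qed

text \<open>Stationarity: with constant weights an entry depends on \<open>k - j\<close> only, so
  rows and columns can be translated together.\<close>

lemma bphi_core_shift:
  "bphi (\<lambda>_. c) (core B b) = bphi (\<lambda>_. c) (core B 0)"
proof -
  let ?v = "\<lambda>k j. c * a (k - j)" and ?h = "\<lambda>x. x + b * B"
  have inj: "inj_on ?h X" for X by (simp add: inj_on_def)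
  let ?S = "{-L..<B-L}"
  have im: "core B b = ?h ` core B 0" "?h ` ?S = {b * B - L..<b * B + B - L}"
    unfolding core_def image_add_int_atLeastLessThan by (simp_all add: algebra_simps)
  have "bphi (\<lambda>_. c) (core B b) = gauss_phi (core B b) (?h ` ?S) ?v"
    unfolding im(2) by (rule bphi_eq) (auto simp: core_def)
  also have "\<dots> = gauss_phi (core B 0) ?S ?v"
    unfolding im(1) gauss_phi_def gauss_int_reindex_snd[OF inj]
    by (subst gauss_int_reindex_fst[OF inj]) auto
  also have "\<dots> = bphi (\<lambda>_. c) (core B 0)"
    by (rule bphi_eq[symmetric]) (auto simp: core_def)
  finally show ?thesis .
qed

section \<open>Comparison of a core with the circulant model\<close>

definition symbol :: "real \<Rightarrow> complex" where
  "symbol x = (\<Sum>m\<in>{-L..L}. of_real (a m) * exp (\<i> * of_int m * of_real x))"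

text \<open>For \<open>B > 2 * L\<close> this is \<open>gauss_phi\<close> of the circulant matrix of
  size \<open>B\<close> made from \<open>sqrt c * a\<close> (see \<open>circ_phi_eq\<close>); the
  samples of the symbol give the moduli of its eigenvalues.\<close>

definition circ_phi :: "int \<Rightarrow> real \<Rightarrow> real" where
  "circ_phi B c = (\<Sum>l\<in>{0..<B}. ln (1 + c * (cmod (symbol (2 * pi * of_int l / of_int B)))\<^sup>2) / 2)"

context
  fixes B :: int and c :: real
  assumes B: "B > 2 * L" and c: "c \<ge> 0"
begin

text \<open>The \<open>B\<close>-periodization of \<open>sqrt c * a\<close>; on a core both give the same rows.\<close>
private definition w :: "int \<Rightarrow> real" where
  "w r = sqrt c * a ((r + L) mod B - L)"

private lemma B0: "B > 0" using B L0 by simp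

private lemma w_mod: "w (r mod B) = w r"
  unfolding w_def by (simp add: mod_add_left_eq)

private lemma w_eq: "w m = sqrt c * a m" if "m \<in> {-L..<B-L}"
  using that unfolding w_def by (subst mod_pos_pos_trivial) auto

text \<open>\<open>{-L..<B-L}\<close> is the system of residues on which \<open>w\<close> equals
  \<open>sqrt c * a\<close> without wrapping.\<close>

private lemma reindex_residues:
  fixes g :: "int \<Rightarrow> 'b::comm_monoid_add"
  assumes "\<And>r. g (r mod B) = g r"
  shows "(\<Sum>r\<in>{0..<B}. g r) = (\<Sum>m\<in>{-L..<B-L}. g m)"
proof (rule sum.reindex_bij_witness[where i="\<lambda>m. m mod B" and j="\<lambda>r. (r + L) mod B - L"])
  fix r assume r: "r \<in> {0..<B}"
  show "((r + L) mod B - L) mod B = r" using r by (simp add: mod_diff_left_eq)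
  show "(r + L) mod B - L \<in> {-L..<B-L}" using B0 by simp
  have "g ((r + L) mod B - L) = g (((r + L) mod B - L) mod B)" by (simp add: assms)
  then show "g ((r + L) mod B - L) = g r"
    using r by (simp add: mod_diff_left_eq)
next
  fix m assume m: "m \<in> {-L..<B-L}"
  show "(m mod B + L) mod B - L = m" using m by (simp add: mod_add_left_eq)
  show "m mod B \<in> {0..<B}" using B0 by simp
qed

private lemma restrict_range:
  fixes g :: "int \<Rightarrow> 'b::comm_monoid_add"
  assumes "\<And>m. a m = 0 \<Longrightarrow> g m = 0"
  shows "(\<Sum>m\<in>{-L..<B-L}. g m) = (\<Sum>m\<in>{-L..L}. g m)"
proof (rule sum.mono_neutral_right)
  show "\<forall>m\<in>{-L..<B-L} - {-L..L}. g m = 0" by (auto intro!: assms supp)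
qed (use B in auto)

private lemma w_energy: "(\<Sum>r\<in>{0..<B}. (w r)\<^sup>2) = c * energy"
proof -
  have "(\<Sum>r\<in>{0..<B}. (w r)\<^sup>2) = (\<Sum>m\<in>{-L..<B-L}. (w m)\<^sup>2)"
    by (rule reindex_residues) (simp add: w_mod)
  also have "\<dots> = (\<Sum>m\<in>{-L..<B-L}. c * (a m)\<^sup>2)"
    using c by (intro sum.cong refl) (simp add: w_eq power_mult_distrib)
  also have "\<dots> = (\<Sum>m\<in>{-L..L}. c * (a m)\<^sup>2)" by (rule restrict_range) simp
  finally show ?thesis by (simp add: energy_def sum_distrib_left)
qed

private lemma w_dft: "(cmod (dft B w l))\<^sup>2 = c * (cmod (symbol (2 * pi * of_int l / of_int B)))\<^sup>2"
proof -
  have "dft B w l = (\<Sum>m\<in>{-L..<B-L}. of_real (w m) * dft_char B (m * l))"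
    unfolding dft_def
    by (rule reindex_residues) (simp add: w_mod dft_char_cong[OF B0, of "x mod B * l" "x * l" for x] mod_mult_left_eq)
  also have "\<dots> = (\<Sum>m\<in>{-L..<B-L}. of_real (sqrt c * a m) * dft_char B (m * l))"
    by (intro sum.cong refl) (simp only: w_eq)
  also have "\<dots> = (\<Sum>m\<in>{-L..L}. of_real (sqrt c * a m) * dft_char B (m * l))"
    by (rule restrict_range) simp
  also have "\<dots> = of_real (sqrt c) * symbol (2 * pi * of_int l / of_int B)"
    unfolding symbol_def sum_distrib_left
    by (intro sum.cong refl) (simp add: dft_char_def cis_conv_exp mult_ac)
  finally show ?thesis using c by (simp add: norm_mult power_mult_distrib)
qed

text \<open>A symbol of degree at most \<open>L\<close> suffers no aliasing when sampled at more
  than \<open>2 * L\<close> points, so discrete Parseval is exact. The continuous identity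
  \<open>symbol_mean_square\<close> is deduced from it.\<close>

lemma symbol_parseval_scaled:
  "(\<Sum>l\<in>{0..<B}. c * (cmod (symbol (2 * pi * of_int l / of_int B)))\<^sup>2) = of_int B * (c * energy)"
  using dft_parseval[OF B0, of w] unfolding w_dft w_energy .

private lemma circ_phi_eq: "circ_phi B c = gauss_phi {0..<B} {0..<B} (\<lambda>k j. w (k - j))"
  unfolding gauss_phi_circulant[where w=w, OF B0 w_mod] circ_phi_def w_dft ..

private lemma core_eq: "bphi (\<lambda>_. sqrt c) (core B 0) = gauss_phi {0..<B-2*L} {0..<B} (\<lambda>k j. w (k - j))"
proof -
  let ?S = "{-L..<B-L}" and ?h = "\<lambda>j. j mod B"
  have inj: "inj_on ?h ?S"
  proof (rule inj_onI)
    fix x y assume xy: "x \<in> ?S" "y \<in> ?S" "x mod B = y mod B"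
    then have "(x + L) mod B = (y + L) mod B" by (metis mod_add_left_eq)
    then show "x = y" using xy by simp
  qed
  have im: "?h ` ?S = {0..<B}"
  proof (rule card_subset_eq)
    show "?h ` ?S \<subseteq> {0..<B}" using B0 by auto
    show "card (?h ` ?S) = card {0..<B}" by (simp add: card_image[OF inj])
  qed simp
  have "bphi (\<lambda>_. sqrt c) (core B 0) = gauss_phi {0..<B-2*L} ?S (\<lambda>k j. sqrt c * a (k - j))"
    by (subst bphi_eq[of ?S]) (auto simp: core_def)
  also have "\<dots> = gauss_phi {0..<B-2*L} ?S (\<lambda>k j. w (k - j))"
  proof (rule gauss_phi_cong)
    fix k j assume kj: "k \<in> {0..<B-2*L}" "j \<in> ?S"
    show "sqrt c * a (k - j) = w (k - j)"
    proof (cases "k - j \<ge> - L")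
      case True
      then show ?thesis using kj by (subst w_eq) auto
    next
      case False
      \<comment> \<open>Here the gap is used: since \<open>0 \<le> k\<close> and
        \<open>j < B - L\<close>, the wrapped index \<open>k - j + B\<close> exceeds
        \<open>L\<close>, so both entries vanish.\<close>
      have "w (k - j) = w (k - j + B)" by (metis mod_add_self2 w_mod)
      also have "\<dots> = sqrt c * a (k - j + B)" using False kj L0 by (subst w_eq) auto
      moreover have "a (k - j) = 0" "a (k - j + B) = 0" by (rule supp, use False kj in auto)+
      ultimately show ?thesis by simp
    qed
  qed
  also have "\<dots> = gauss_phi {0..<B-2*L} ?S (\<lambda>k j. w (k - ?h j))"
    by (rule gauss_phi_cong) (metis mod_diff_right_eq w_mod)
  also have "\<dots> = gauss_phi {0..<B-2*L} {0..<B} (\<lambda>k j. w (k - j))"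
    unfolding im[symmetric] gauss_phi_def gauss_int_reindex_snd[OF inj] ..
  finally show ?thesis .
qed

lemma core_le_circ: "bphi (\<lambda>_. sqrt c) (core B 0) \<le> circ_phi B c"
  unfolding core_eq circ_phi_eq by (rule gauss_phi_subset) (use L0 in auto)

text \<open>The circulant has \<open>2 * L\<close> more rows than the core, each of squared length
  \<open>c * energy\<close>, and each costs half a logarithm.\<close>

lemma circ_le_core: "circ_phi B c \<le> bphi (\<lambda>_. sqrt c) (core B 0) + of_int L * ln (1 + c * energy)"
proof -
  have ws: "(\<Sum>j\<in>{0..<B}. (w (k - j))\<^sup>2) = c * energy" for k
    using sum_periodic_reflect[OF B0, of "\<lambda>r. (w r)\<^sup>2" k] w_energy by (simp add: w_mod)
  have "gauss_phi ({0..<B-2*L} \<union> {B-2*L..<B}) {0..<B} (\<lambda>k j. w (k - j))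
      \<le> gauss_phi {0..<B-2*L} {0..<B} (\<lambda>k j. w (k - j))
        + (\<Sum>k\<in>{B-2*L..<B}. ln (1 + (\<Sum>j\<in>{0..<B}. (w (k - j))\<^sup>2)) / 2)"
    by (rule gauss_phi_Un_le) auto
  also have "{0..<B-2*L} \<union> {B-2*L..<B} = {0..<B}" using B L0 by auto
  finally show ?thesis unfolding core_eq circ_phi_eq ws using L0 by simp
qed

end

end

section \<open>Logarithmic sums\<close>

lemma Beta_reflection:
  assumes "0 < b" "b < (1::real)"
  shows "Beta b (1 - b) = pi / sin (pi * b)"
proof -
  have "complex_of_real (Gamma b * Gamma (1 - b)) = complex_of_real (pi / sin (pi * b))"
    using Gamma_reflection_complex[of "complex_of_real b"]
    by (metis Gamma_complex_of_real of_real_1 of_real_diff of_real_divide of_real_mult sin_of_real)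
  then have "Gamma b * Gamma (1 - b) = pi / sin (pi * b)" by (simp only: of_real_eq_iff)
  then show ?thesis by (simp add: Beta_def)
qed

locale log_sum =
  fixes \<alpha> :: real
  assumes \<alpha>1: "\<alpha> > 1"
begin

definition \<beta> :: real where "\<beta> = 1 / \<alpha>"

lemma \<beta>: "0 < \<beta>" "\<beta> < 1" "\<alpha> * \<beta> = 1" "\<beta> * \<alpha> = 1"
  using \<alpha>1 by (auto simp: \<beta>_def)

text \<open>The value of the integral of \<open>ln (1 + y powr (- \<alpha>))\<close> over the
  positive half-line (see \<open>prim_tendsto_C0\<close>), which reduces to
  \<open>Beta \<beta> (1 - \<beta>)\<close>.\<close>

definition C0 :: real where "C0 = pi / sin (pi * \<beta>)"

lemma C0_pos: "C0 > 0"
  unfolding C0_def using \<beta> by (intro divide_pos_pos sin_gt_zero) auto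

definition incbeta :: "real \<Rightarrow> real" where
  "incbeta u = integral {0..u} (\<lambda>t. t powr (\<beta> - 1) * (1 - t) powr (- \<beta>))"

lemma beta_has_integral:
  "((\<lambda>t. t powr (\<beta> - 1) * (1 - t) powr (- \<beta>)) has_integral C0) {0..1}"
  using has_integral_Beta_real[of \<beta> "1 - \<beta>"] \<beta> by (simp add: Beta_reflection C0_def)

lemma beta_integrable: "(\<lambda>t. t powr (\<beta> - 1) * (1 - t) powr (- \<beta>)) integrable_on {0..1}"
  using beta_has_integral by blast

lemma incbeta_0: "incbeta 0 = 0" and incbeta_1: "incbeta 1 = C0"
  using beta_has_integral by (auto simp: incbeta_def)

lemma continuous_on_incbeta: "continuous_on {0..1} incbeta"
  unfolding incbeta_def by (rule indefinite_integral_continuous_1[OF beta_integrable])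

lemma incbeta_deriv:
  assumes "0 < u" "u < 1"
  shows "(incbeta has_real_derivative u powr (\<beta> - 1) * (1 - u) powr (- \<beta>)) (at u)"
proof -
  have "(incbeta has_vector_derivative u powr (\<beta> - 1) * (1 - u) powr (- \<beta>)) (at u within {0..1})"
    unfolding incbeta_def
  proof -
    have "continuous (at u within {0..1}) (\<lambda>t. t powr (\<beta> - 1) * (1 - t) powr (- \<beta>))"
      using assms by (intro continuous_intros) auto
    then show "((\<lambda>u. integral {0..u} (\<lambda>t. t powr (\<beta> - 1) * (1 - t) powr (- \<beta>))) has_vector_derivative
        u powr (\<beta> - 1) * (1 - u) powr (- \<beta>)) (at u within {0..1})"
      using integral_has_vector_derivative_continuous_at[OF beta_integrable, of u "{}"] assms by simp
  qed
  moreover have "at u within {0..1} = at u"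
    by (rule at_within_interior) (use assms in auto)
  ultimately show ?thesis by (simp add: has_real_derivative_iff_has_vector_derivative)
qed

text \<open>\<open>prim\<close> is the integral of \<open>ln (1 + y powr (- \<alpha>))\<close> over \<open>[0, x]\<close>: integrate by parts and
  substitute \<open>u = y powr \<alpha> / (1 + y powr \<alpha>)\<close>.\<close>
definition beta_arg :: "real \<Rightarrow> real" where "beta_arg x = x powr \<alpha> / (1 + x powr \<alpha>)"

definition prim :: "real \<Rightarrow> real" where
  "prim x = x * ln (1 + x powr (- \<alpha>)) + incbeta (beta_arg x)"

lemma prim_0: "prim 0 = 0"
  by (simp add: prim_def beta_arg_def incbeta_0)

lemma beta_arg_bounds:
  assumes "x > 0" shows "0 < beta_arg x" "beta_arg x < 1"
proof -
  have "x powr \<alpha> > 0" using assms by simp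
  then have "0 < x powr \<alpha> / (1 + x powr \<alpha>)" "x powr \<alpha> / (1 + x powr \<alpha>) < 1" by (simp_all add: divide_less_eq_1 add_pos_pos)
  then show "0 < beta_arg x" "beta_arg x < 1" unfolding beta_arg_def by simp_all
qed

text \<open>Differentiating the boundary term leaves an extra \<open>- \<alpha> / (1 + y)\<close>
  with \<open>y = x powr \<alpha>\<close>; the chain rule for the incomplete beta integral produces
  its negative.\<close>

lemma prim_deriv:
  assumes x: "x > 0"
  shows "(prim has_real_derivative ln (1 + x powr (- \<alpha>))) (at x)"
proof -
  define y where "y = x powr \<alpha>"
  have y: "y > 0" "x powr (- \<alpha>) = 1 / y" using x by (auto simp: y_def powr_minus divide_simps)
  have u: "beta_arg x = y / (1 + y)" by (simp add: beta_arg_def y_def)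
  have d1: "((\<lambda>x. x * ln (1 + x powr (- \<alpha>))) has_real_derivative
      ln (1 + x powr (- \<alpha>)) - \<alpha> / (1 + y)) (at x)"
  proof -
    have "((\<lambda>x. x * ln (1 + x powr (- \<alpha>))) has_real_derivative
      ln (1 + x powr (- \<alpha>)) + x * ((- \<alpha> * x powr (- \<alpha> - 1)) / (1 + x powr (- \<alpha>)))) (at x)"
      using x by (auto intro!: derivative_eq_intros add_pos_pos)
    moreover have "x * ((- \<alpha> * x powr (- \<alpha> - 1)) / (1 + x powr (- \<alpha>))) = - (\<alpha> / (1 + y))"
    proof -
      have "x * x powr (- \<alpha> - 1) = x powr (- \<alpha>)"
        using x powr_mult_base[of x "- \<alpha> - 1"] by simp
      then have "x * ((- \<alpha> * x powr (- \<alpha> - 1)) / (1 + x powr (- \<alpha>))) = - \<alpha> * x powr (- \<alpha>) / (1 + x powr (- \<alpha>))"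
        by (simp add: mult.left_commute)
      also have "\<dots> = - (\<alpha> / (1 + y))"
        unfolding y(2) using y(1) by (simp add: field_simps)
      finally show ?thesis .
    qed
    ultimately show ?thesis by simp
  qed
  have d2: "(beta_arg has_real_derivative \<alpha> * x powr (\<alpha> - 1) / (1 + y)\<^sup>2) (at x)"
  proof -
    have "1 + y \<noteq> 0" using y(1) by simp
    then show ?thesis unfolding beta_arg_def[abs_def] y_def using x
      by (auto intro!: derivative_eq_intros simp: power2_eq_square field_simps)
  qed
  have "((\<lambda>x. incbeta (beta_arg x)) has_real_derivative
      (beta_arg x powr (\<beta> - 1) * (1 - beta_arg x) powr (- \<beta>)) * (\<alpha> * x powr (\<alpha> - 1) / (1 + y)\<^sup>2)) (at x)"
    by (rule DERIV_chain2[OF incbeta_deriv d2]) (use beta_arg_bounds[OF x] in auto)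
  also have "(beta_arg x powr (\<beta> - 1) * (1 - beta_arg x) powr (- \<beta>)) * (\<alpha> * x powr (\<alpha> - 1) / (1 + y)\<^sup>2)
      = \<alpha> / (1 + y)"
  proof -
    have 1: "beta_arg x powr (\<beta> - 1) = x powr (1 - \<alpha>) * (1 + y) powr (1 - \<beta>)"
    proof -
      have "beta_arg x powr (\<beta> - 1) = y powr (\<beta> - 1) / (1 + y) powr (\<beta> - 1)"
        unfolding u using y(1) by (simp add: powr_divide)
      also have "y powr (\<beta> - 1) = x powr (1 - \<alpha>)"
        unfolding y_def powr_powr by (simp add: right_diff_distrib \<beta>)
      also have "(1 + y) powr (\<beta> - 1) = 1 / (1 + y) powr (1 - \<beta>)"
        by (simp add: powr_minus_divide[symmetric])
      finally show ?thesis by simp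
    qed
    have 2: "(1 - beta_arg x) powr (- \<beta>) = (1 + y) powr \<beta>"
    proof -
      have "1 - beta_arg x = 1 / (1 + y)" unfolding u using y(1) by (simp add: field_simps)
      then show ?thesis using y(1) by (simp add: powr_divide powr_minus_divide)
    qed
    have 3: "x powr (1 - \<alpha>) * x powr (\<alpha> - 1) = 1" using x by (simp add: powr_add[symmetric])
    have 4: "(1 + y) powr (1 - \<beta>) * (1 + y) powr \<beta> = 1 + y" using y(1) by (simp add: powr_add[symmetric])
    have "(beta_arg x powr (\<beta> - 1) * (1 - beta_arg x) powr (- \<beta>)) * (\<alpha> * x powr (\<alpha> - 1) / (1 + y)\<^sup>2)
      = (x powr (1 - \<alpha>) * x powr (\<alpha> - 1)) * ((1 + y) powr (1 - \<beta>) * (1 + y) powr \<beta>) * \<alpha> / (1 + y)\<^sup>2"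
      unfolding 1 2 by (simp add: mult_ac)
    also have "\<dots> = \<alpha> / (1 + y)" unfolding 3 4 using y(1) by (simp add: power2_eq_square)
    finally show ?thesis .
  qed
  finally show ?thesis
    unfolding prim_def[abs_def] using DERIV_add[OF d1] by fastforce
qed

lemma prim_tendsto_0: "(prim \<longlongrightarrow> 0) (at_right 0)"
proof -
  have "(beta_arg \<longlongrightarrow> 0) (at_right 0)"
    unfolding beta_arg_def[abs_def] using \<alpha>1 by real_asymp
  moreover have "\<forall>\<^sub>F x in at_right 0. beta_arg x \<in> {0..1}"
    using eventually_at_right_less[of 0] by eventually_elim (use beta_arg_bounds in \<open>auto simp: less_imp_le\<close>)
  ultimately have "((\<lambda>x. incbeta (beta_arg x)) \<longlongrightarrow> incbeta 0) (at_right 0)"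
    by (intro continuous_on_tendsto_compose[OF continuous_on_incbeta]) auto
  moreover have "((\<lambda>x. x * ln (1 + x powr (- \<alpha>))) \<longlongrightarrow> 0) (at_right 0)"
    using \<alpha>1 by real_asymp
  ultimately show ?thesis unfolding prim_def[abs_def] incbeta_0 by (auto intro: tendsto_add_zero)
qed

lemma prim_tendsto_C0: "(prim \<longlongrightarrow> C0) at_top"
proof -
  have "(beta_arg \<longlongrightarrow> 1) at_top"
    unfolding beta_arg_def[abs_def] using \<alpha>1 by real_asymp
  moreover have "\<forall>\<^sub>F x in at_top. beta_arg x \<in> {0..1}"
    using eventually_gt_at_top[of 0] by eventually_elim (use beta_arg_bounds in \<open>auto simp: less_imp_le\<close>)
  ultimately have "((\<lambda>x. incbeta (beta_arg x)) \<longlongrightarrow> incbeta 1) at_top"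
    by (intro continuous_on_tendsto_compose[OF continuous_on_incbeta]) auto
  moreover have "((\<lambda>x. x * ln (1 + x powr (- \<alpha>))) \<longlongrightarrow> 0) at_top"
    using \<alpha>1 by real_asymp
  ultimately show ?thesis
    unfolding prim_def[abs_def] incbeta_1 using tendsto_add[of _ 0 at_top _ C0] by fastforce
qed

lemma prim_cont: "x \<ge> 0 \<Longrightarrow> continuous (at x within {0..}) prim"
proof (cases "x = 0")
  case True
  have "at 0 within {0..} = at_right (0::real)"
    by (simp add: at_within_eq_bot_iff at_within_def) (auto intro!: arg_cong2[where f=inf] simp: )
  then show ?thesis using True prim_tendsto_0 by (simp add: continuous_within prim_0)
next
  case False
  assume "x \<ge> 0"
  then show ?thesis using False DERIV_isCont[OF prim_deriv, of x] by (simp add: continuous_at_imp_continuous_at_within)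
qed

text \<open>Mean value theorem with a decreasing derivative. The upper bound excludes
  \<open>x = 0\<close>: the derivative is unbounded there, while \<open>0 powr (- \<alpha>)\<close>
  has the value 0.\<close>

lemma prim_diff:
  assumes "0 \<le> x" "x < y"
  shows "ln (1 + y powr (- \<alpha>)) * (y - x) \<le> prim y - prim x"
    and "0 < x \<Longrightarrow> prim y - prim x \<le> ln (1 + x powr (- \<alpha>)) * (y - x)"
proof -
  have "continuous_on {x..y} prim"
    unfolding continuous_on_eq_continuous_within
  proof
    fix z assume "z \<in> {x..y}"
    then show "continuous (at z within {x..y}) prim"
      using assms by (intro continuous_within_subset[OF prim_cont]) auto
  qed
  then obtain l z where z: "x < z" "z < y" "DERIV prim z :> l" "prim y - prim x = (y - x) * l"
    using MVT[OF assms(2), of prim] prim_deriv assms(1)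
    by (metis le_less_trans real_differentiable_def)
  then have z: "x < z" "z < y" "prim y - prim x = (y - x) * ln (1 + z powr (- \<alpha>))"
    using DERIV_unique[OF z(3) prim_deriv] assms(1) by auto
  have "y powr (- \<alpha>) \<le> z powr (- \<alpha>)"
    using z assms \<alpha>1 by (intro powr_mono2') auto
  then have "ln (1 + y powr (- \<alpha>)) \<le> ln (1 + z powr (- \<alpha>))" by (simp add: add_pos_nonneg)
  then show "ln (1 + y powr (- \<alpha>)) * (y - x) \<le> prim y - prim x"
    unfolding z(3) using assms by (simp add: mult.commute mult_left_mono)
  assume "0 < x"
  then have "z powr (- \<alpha>) \<le> x powr (- \<alpha>)"
    using z assms \<alpha>1 by (intro powr_mono2') auto
  then have "ln (1 + z powr (- \<alpha>)) \<le> ln (1 + x powr (- \<alpha>))" by (simp add: add_pos_nonneg)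
  then show "prim y - prim x \<le> ln (1 + x powr (- \<alpha>)) * (y - x)"
    unfolding z(3) using assms by (simp add: mult.commute mult_left_mono)
qed

lemma prim_mono: "0 \<le> x \<Longrightarrow> x \<le> y \<Longrightarrow> prim x \<le> prim y"
proof (cases "x = y")
  case False
  assume "0 \<le> x" "x \<le> y"
  with False have "0 \<le> ln (1 + y powr (- \<alpha>)) * (y - x)" by simp
  also have "\<dots> \<le> prim y - prim x" by (rule prim_diff) (use \<open>0 \<le> x\<close> \<open>x \<le> y\<close> False in auto)
  finally show ?thesis by simp
qed simp

lemma prim_le_C0: "0 \<le> x \<Longrightarrow> prim x \<le> C0"
  by (rule tendsto_lowerbound[OF prim_tendsto_C0])
     (auto intro!: eventually_mono[OF eventually_ge_at_top[of x]] prim_mono)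

section \<open>Comparison of logarithmic sums with the integral\<close>

lemma scaled_term:
  assumes "\<tau> > 0" "x > 0"
  shows "\<tau> * x powr (- \<alpha>) = (x * \<tau> powr (- \<beta>)) powr (- \<alpha>)"
  using assms by (simp add: powr_mult powr_powr \<beta>)

text \<open>With mesh \<open>\<tau> powr (- \<beta>)\<close> the sum is
  \<open>\<tau> powr \<beta>\<close> times a right-endpoint Riemann sum of the decreasing function
  \<open>ln (1 + y powr (- \<alpha>))\<close>, which lies below the integral.\<close>

lemma lnsum_le_prim:
  assumes "\<tau> > 0"
  shows "(\<Sum>b=1..n. ln (1 + \<tau> * real b powr (- \<alpha>))) \<le> \<tau> powr \<beta> * prim (real n * \<tau> powr (- \<beta>))"
proof (induction n)
  case (Suc n)
  define \<sigma> where "\<sigma> = \<tau> powr (- \<beta>)"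
  have s: "\<sigma> > 0" "\<tau> powr \<beta> * \<sigma> = 1" using assms by (auto simp: \<sigma>_def powr_add[symmetric])
  have "ln (1 + \<tau> * real (Suc n) powr (- \<alpha>)) * \<sigma> \<le> prim (real (Suc n) * \<sigma>) - prim (real n * \<sigma>)"
    using prim_diff(1)[of "real n * \<sigma>" "real (Suc n) * \<sigma>"] s scaled_term[OF assms, of "real (Suc n)"]
    by (simp add: \<sigma>_def[symmetric] algebra_simps)
  then have "\<tau> powr \<beta> * (ln (1 + \<tau> * real (Suc n) powr (- \<alpha>)) * \<sigma>)
      \<le> \<tau> powr \<beta> * (prim (real (Suc n) * \<sigma>) - prim (real n * \<sigma>))"
    by (rule mult_left_mono) simp
  then have "ln (1 + \<tau> * real (Suc n) powr (- \<alpha>)) \<le> \<tau> powr \<beta> * (prim (real (Suc n) * \<sigma>) - prim (real n * \<sigma>))"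
    using s(2) by (metis mult.commute mult.left_commute mult.right_neutral)
  then show ?case using Suc.IH by (simp add: \<sigma>_def[symmetric] right_diff_distrib)
qed (simp add: prim_0)

lemma lnsum_le:
  assumes "\<tau> \<ge> 0"
  shows "(\<Sum>b=1..n. ln (1 + \<tau> * real b powr (- \<alpha>))) \<le> C0 * \<tau> powr \<beta>"
proof (cases "\<tau> = 0")
  case False
  then have "\<tau> > 0" using assms by simp
  from lnsum_le_prim[OF this, of n] show ?thesis
    using mult_left_mono[OF prim_le_C0[of "real n * \<tau> powr (- \<beta>)"], of "\<tau> powr \<beta>"]
    by (simp add: mult.commute)
qed simp

text \<open>Left endpoints overestimate the integral of a decreasing function; starting at
  \<open>m > 0\<close> keeps away from the singularity at 0.\<close>

lemma lnsum_ge_prim: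
  assumes "\<tau> > 0" "m > 0"
  shows "(\<Sum>b<n. ln (1 + \<tau> * real (b + m) powr (- \<alpha>)))
    \<ge> \<tau> powr \<beta> * (prim (real (n + m) * \<tau> powr (- \<beta>)) - prim (real m * \<tau> powr (- \<beta>)))"
proof (induction n)
  case (Suc n)
  define \<sigma> where "\<sigma> = \<tau> powr (- \<beta>)"
  have s: "\<sigma> > 0" "\<tau> powr \<beta> * \<sigma> = 1" using assms by (auto simp: \<sigma>_def powr_add[symmetric])
  have "prim (real (Suc n + m) * \<sigma>) - prim (real (n + m) * \<sigma>) \<le> ln (1 + \<tau> * real (n + m) powr (- \<alpha>)) * \<sigma>"
    using prim_diff(2)[of "real (n + m) * \<sigma>" "real (Suc n + m) * \<sigma>"] s scaled_term[OF assms(1), of "real (n + m)"] assms(2)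
      mult_pos_pos[of "real (n + m)" \<sigma>]
    by (simp add: \<sigma>_def[symmetric] algebra_simps)
  then have "\<tau> powr \<beta> * (prim (real (Suc n + m) * \<sigma>) - prim (real (n + m) * \<sigma>)) \<le>
      \<tau> powr \<beta> * (ln (1 + \<tau> * real (n + m) powr (- \<alpha>)) * \<sigma>)"
    by (rule mult_left_mono) simp
  then have "\<tau> powr \<beta> * (prim (real (Suc n + m) * \<sigma>) - prim (real (n + m) * \<sigma>)) \<le> ln (1 + \<tau> * real (n + m) powr (- \<alpha>))"
    using s(2) by (metis mult.commute mult.left_commute mult.right_neutral)
  then show ?case using Suc.IH unfolding \<sigma>_def[symmetric] by (simp add: right_diff_distrib)
qed simp

text \<open>The offset \<open>m\<close> drops the initial blocks, where the weights are not yet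
  close to a power. By \<open>lntail_tendsto\<close> the limit does not depend on it.\<close>

definition lntail :: "nat \<Rightarrow> real \<Rightarrow> real" where
  "lntail m \<tau> = (\<Sum>b. ln (1 + \<tau> * real (b + m) powr (- \<alpha>)))"

lemma lnpart_le:
  assumes "\<tau> \<ge> 0" "m > 0"
  shows "(\<Sum>b<n. ln (1 + \<tau> * real (b + m) powr (- \<alpha>))) \<le> C0 * \<tau> powr \<beta>"
proof -
  have "(\<Sum>b<n. ln (1 + \<tau> * real (b + m) powr (- \<alpha>))) = (\<Sum>b\<in>{m..<n+m}. ln (1 + \<tau> * real b powr (- \<alpha>)))"
    by (rule sum.reindex_bij_witness[where i="\<lambda>b. b - m" and j="\<lambda>b. b + m"]) auto
  also have "\<dots> \<le> (\<Sum>b=1..n+m. ln (1 + \<tau> * real b powr (- \<alpha>)))"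
    by (rule sum_mono2) (use assms in auto)
  also have "\<dots> \<le> C0 * \<tau> powr \<beta>" by (rule lnsum_le[OF assms(1)])
  finally show ?thesis .
qed

lemma summable_lntail:
  assumes "\<tau> \<ge> 0" "m > 0"
  shows "summable (\<lambda>b. ln (1 + \<tau> * real (b + m) powr (- \<alpha>)))"
  by (rule summableI_nonneg_bounded[where x="C0 * \<tau> powr \<beta>"])
     (use assms lnpart_le in auto)

lemma lntail_tendsto:
  assumes "m > 0"
  shows "((\<lambda>\<tau>. lntail m \<tau> / \<tau> powr \<beta>) \<longlongrightarrow> C0) at_top"
proof (rule tendsto_sandwich)
  show "\<forall>\<^sub>F \<tau> in at_top. lntail m \<tau> / \<tau> powr \<beta> \<le> C0"
    using eventually_gt_at_top[of 0]
  proof eventually_elim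
    case (elim \<tau>)
    have "lntail m \<tau> \<le> C0 * \<tau> powr \<beta>" unfolding lntail_def
      by (rule suminf_le_const[OF summable_lntail]) (use elim assms lnpart_le in auto)
    then show ?case using elim by (simp add: divide_le_eq)
  qed
  show "\<forall>\<^sub>F \<tau> in at_top. C0 - prim (real m * \<tau> powr (- \<beta>)) \<le> lntail m \<tau> / \<tau> powr \<beta>"
    using eventually_gt_at_top[of 0]
  proof eventually_elim
    case (elim \<tau>)
    have lim: "(\<lambda>n. \<tau> powr \<beta> * (prim (real (n + m) * \<tau> powr (- \<beta>)) - prim (real m * \<tau> powr (- \<beta>))))
        \<longlonglongrightarrow> \<tau> powr \<beta> * (C0 - prim (real m * \<tau> powr (- \<beta>)))"
    proof (intro tendsto_intros filterlim_compose[OF prim_tendsto_C0])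
      show "filterlim (\<lambda>n. real (n + m) * \<tau> powr (- \<beta>)) at_top sequentially"
        using elim by real_asymp
    qed
    have "(\<lambda>n. \<Sum>b<n. ln (1 + \<tau> * real (b + m) powr (- \<alpha>))) \<longlonglongrightarrow> lntail m \<tau>"
      unfolding lntail_def by (rule summable_LIMSEQ[OF summable_lntail]) (use elim assms in auto)
    from LIMSEQ_le[OF lim this] have "\<tau> powr \<beta> * (C0 - prim (real m * \<tau> powr (- \<beta>))) \<le> lntail m \<tau>"
      using lnsum_ge_prim[OF elim assms] by auto
    then show ?case using elim by (simp add: le_divide_eq mult.commute)
  qed
  have "((\<lambda>\<tau>. prim (real m * \<tau> powr (- \<beta>))) \<longlongrightarrow> 0) at_top"
    by (rule filterlim_compose[OF prim_tendsto_0]) (use assms \<beta> in real_asymp)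
  then have "((\<lambda>\<tau>. C0 - prim (real m * \<tau> powr (- \<beta>))) \<longlongrightarrow> C0 - 0) at_top"
    by (intro tendsto_intros)
  then show "((\<lambda>\<tau>. C0 - prim (real m * \<tau> powr (- \<beta>))) \<longlongrightarrow> C0) at_top" by simp
qed auto

lemma lntail_scaled:
  assumes "m > 0" "c \<ge> 0"
  shows "((\<lambda>t. lntail m (t * c) / t powr \<beta>) \<longlongrightarrow> C0 * c powr \<beta>) at_top"
proof (cases "c = 0")
  case True
  then show ?thesis by (simp add: lntail_def)
next
  case False
  then have c: "c > 0" using assms by simp
  have "((\<lambda>t. lntail m (t * c) / (t * c) powr \<beta>) \<longlongrightarrow> C0) at_top"
    by (rule filterlim_compose[OF lntail_tendsto[OF assms(1)]]) (use c in real_asymp)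
  then have "((\<lambda>t. lntail m (t * c) / (t * c) powr \<beta> * c powr \<beta>) \<longlongrightarrow> C0 * c powr \<beta>) at_top"
    by (intro tendsto_intros)
  then show ?thesis
  proof (rule Lim_transform_eventually)
    show "\<forall>\<^sub>F t in at_top. lntail m (t * c) / (t * c) powr \<beta> * c powr \<beta> = lntail m (t * c) / t powr \<beta>"
      using eventually_gt_at_top[of 0] by eventually_elim (use c in \<open>simp add: powr_mult\<close>)
  qed
qed

end

section \<open>Weights of regular decay\<close>

text \<open>Additive tolerances around \<open>dp\<close> and \<open>dm\<close> treat a positive and
  a zero limit constant alike; a ratio condition could not express the zero case.\<close>

locale weights =
  fixes d :: "int \<Rightarrow> real" and p dp dm :: real
  assumes d_pos: "\<And>k. d k > 0"
    and p_gt: "p > 1/2"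
    and dpm: "dp \<ge> 0" "dm \<ge> 0"
    and d_at_top: "\<And>\<eta>. \<eta> > 0 \<Longrightarrow> \<forall>\<^sub>F k in at_top. (dp - \<eta>) * \<bar>real_of_int k\<bar> powr (- p) \<le> d k
        \<and> d k \<le> (dp + \<eta>) * \<bar>real_of_int k\<bar> powr (- p)"
    and d_at_bot: "\<And>\<eta>. \<eta> > 0 \<Longrightarrow> \<forall>\<^sub>F k in at_bot. (dm - \<eta>) * \<bar>real_of_int k\<bar> powr (- p) \<le> d k
        \<and> d k \<le> (dm + \<eta>) * \<bar>real_of_int k\<bar> powr (- p)"
begin

sublocale log_sum "2 * p"
  using p_gt by unfold_locales simp

lemma p_pos: "p > 0" using p_gt by simp

lemma two_\<beta>: "2 * \<beta> = 1 / p"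
  using p_pos by (simp add: \<beta>_def)

lemma square_powr_\<beta>: "x \<ge> 0 \<Longrightarrow> (x\<^sup>2) powr \<beta> = x powr (1 / p)"
  by (simp add: powr_numeral[symmetric] powr_powr two_\<beta> del: powr_numeral)

text \<open>Blocks \<open>\<plusminus>b\<close> of length \<open>B\<close>: block \<open>b \<ge> 0\<close> starts at \<open>b * B\<close>, and its mirror image is
  block \<open>- b - 1\<close>, so that in both of them \<open>b * B \<le> \<bar>k\<bar> \<le> (b + 1) * B\<close>.\<close>
definition blk :: "bool \<Rightarrow> nat \<Rightarrow> int" where
  "blk s b = (if s then int b else - int b - 1)"

definition side :: "bool \<Rightarrow> real" where "side s = (if s then dp else dm)"

lemma side_nonneg: "side s \<ge> 0" using dpm by (simp add: side_def)

lemma blk_bounds: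
  assumes "k \<in> {blk s b * B..<blk s b * B + B}" "B > 0"
  shows "int b * B \<le> \<bar>k\<bar>" "\<bar>k\<bar> \<le> int (Suc b) * B"
proof -
  have 0: "0 \<le> int b * B" using assms(2) by simp
  have 1: "int (Suc b) * B = int b * B + B" by (simp add: distrib_right)
  have 2: "(- int b - 1) * B = - (int b * B) - B" by (simp add: left_diff_distrib)
  have "int b * B \<le> \<bar>k\<bar> \<and> \<bar>k\<bar> \<le> int (Suc b) * B"
  proof (cases s)
    case True
    then have "int b * B \<le> k" "k < int b * B + B" using assms by (auto simp: blk_def)
    then show ?thesis using 0 1 by linarith
  next
    case False
    then have "- (int b * B) - B \<le> k" "k < - (int b * B) - B + B" using assms 2 by (auto simp: blk_def)
    then show ?thesis using 0 1 by linarith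
  qed
  then show "int b * B \<le> \<bar>k\<bar>" "\<bar>k\<bar> \<le> int (Suc b) * B" by auto
qed

text \<open>The upper bound is taken at the near end of the block and the lower bound at the far
  end. The \<open>max 0\<close> keeps the lower bound valid after squaring when
  \<open>side s < \<eta>\<close>.\<close>

lemma d_block_bounds:
  assumes "\<eta> > 0" "B > 0"
  obtains b0 :: nat where "b0 > 0"
    "\<And>s b k. b \<ge> b0 \<Longrightarrow> k \<in> {blk s b * B..<blk s b * B + B} \<Longrightarrow>
      (d k)\<^sup>2 \<le> (side s + \<eta>)\<^sup>2 * (real b * of_int B) powr (- (2 * p)) \<and>
      (max 0 (side s - \<eta>))\<^sup>2 * (real (Suc b) * of_int B) powr (- (2 * p)) \<le> (d k)\<^sup>2"
proof -
  obtain K1 where K1: "\<And>k. k \<ge> K1 \<Longrightarrow> (dp - \<eta>) * \<bar>real_of_int k\<bar> powr (- p) \<le> d k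
        \<and> d k \<le> (dp + \<eta>) * \<bar>real_of_int k\<bar> powr (- p)"
    using d_at_top[OF assms(1)] unfolding eventually_at_top_linorder by blast
  obtain K2 where K2: "\<And>k. k \<le> K2 \<Longrightarrow> (dm - \<eta>) * \<bar>real_of_int k\<bar> powr (- p) \<le> d k
        \<and> d k \<le> (dm + \<eta>) * \<bar>real_of_int k\<bar> powr (- p)"
    using d_at_bot[OF assms(1)] unfolding eventually_at_bot_linorder by blast
  \<comment> \<open>In block \<open>b\<close> one has
    \<open>\<bar>k\<bar> \<ge> b * B \<ge> b\<close>, so this index puts \<open>k\<close> beyond
    both thresholds, for every block length.\<close>
  define b0 where "b0 = Suc (nat \<bar>K1\<bar> + nat \<bar>K2\<bar>)"
  show thesis
  proof
    show "b0 > 0" by (simp add: b0_def)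
    fix s b k assume b: "b \<ge> b0" and k: "k \<in> {blk s b * B..<blk s b * B + B}"
    have bB: "int b \<le> int b * B" using mult_left_mono[of 1 B "int b"] assms(2) by simp
    have kb: "int b * B \<le> \<bar>k\<bar>" "\<bar>k\<bar> \<le> int (Suc b) * B" using blk_bounds[OF k assms(2)] by auto
    have big: "\<bar>K1\<bar> < \<bar>k\<bar>" "\<bar>K2\<bar> < \<bar>k\<bar>"
    proof -
      have "\<bar>K1\<bar> < int b" "\<bar>K2\<bar> < int b" using b by (auto simp: b0_def)
      then show "\<bar>K1\<bar> < \<bar>k\<bar>" "\<bar>K2\<bar> < \<bar>k\<bar>" using bB kb by linarith+
    qed
    have bnd: "(side s - \<eta>) * \<bar>real_of_int k\<bar> powr (- p) \<le> d k
        \<and> d k \<le> (side s + \<eta>) * \<bar>real_of_int k\<bar> powr (- p)"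
    proof (cases s)
      case True
      then have "k \<ge> 0" using k assms(2) by (auto simp: blk_def intro: order_trans[of 0 "int b * B"])
      then show ?thesis using True K1[of k] big by (simp add: side_def)
    next
      case False
      then have "k < 0" using k assms(2) bB by (auto simp: blk_def algebra_simps)
      then show ?thesis using False K2[of k] big by (simp add: side_def)
    qed
    have r: "real b * of_int B \<le> \<bar>real_of_int k\<bar>" "\<bar>real_of_int k\<bar> \<le> real (Suc b) * of_int B"
      using kb by (metis of_int_abs of_int_le_iff of_int_mult of_int_of_nat_eq)+
    have pos: "0 < real b * of_int B" using b assms(2) by (simp add: b0_def)
    have sq: "(x powr (- p))\<^sup>2 = x powr (- (2 * p))" for x :: real
      by (simp add: power2_eq_square powr_add[symmetric])
    have "d k \<le> (side s + \<eta>) * (real b * of_int B) powr (- p)"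
    proof -
      have "(side s + \<eta>) * \<bar>real_of_int k\<bar> powr (- p) \<le> (side s + \<eta>) * (real b * of_int B) powr (- p)"
        using pos r side_nonneg[of s] assms(1) p_pos
        by (intro mult_left_mono powr_mono2') auto
      then show ?thesis using bnd by linarith
    qed
    then have "(d k)\<^sup>2 \<le> ((side s + \<eta>) * (real b * of_int B) powr (- p))\<^sup>2"
      by (rule power_mono) (use d_pos[of k] in simp)
    then have u: "(d k)\<^sup>2 \<le> (side s + \<eta>)\<^sup>2 * (real b * of_int B) powr (- (2 * p))"
      by (simp add: power_mult_distrib sq)
    have "max 0 (side s - \<eta>) * (real (Suc b) * of_int B) powr (- p) \<le> d k"
    proof (cases "side s - \<eta> \<ge> 0")
      case True
      have "(real (Suc b) * of_int B) powr (- p) \<le> \<bar>real_of_int k\<bar> powr (- p)"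
        using pos r p_pos by (intro powr_mono2') auto
      then have "(side s - \<eta>) * (real (Suc b) * of_int B) powr (- p) \<le> (side s - \<eta>) * \<bar>real_of_int k\<bar> powr (- p)"
        using True by (rule mult_left_mono)
      then show ?thesis using True bnd by simp
    next
      case False
      then show ?thesis using d_pos[of k] by simp
    qed
    then have "(max 0 (side s - \<eta>) * (real (Suc b) * of_int B) powr (- p))\<^sup>2 \<le> (d k)\<^sup>2"
      by (rule power_mono) simp
    then show "(d k)\<^sup>2 \<le> (side s + \<eta>)\<^sup>2 * (real b * of_int B) powr (- (2 * p)) \<and>
      (max 0 (side s - \<eta>))\<^sup>2 * (real (Suc b) * of_int B) powr (- (2 * p)) \<le> (d k)\<^sup>2"
      using u by (simp add: power_mult_distrib sq)
  qed
qed

text \<open>Unit blocks with tolerance 1 give the tail, and a finite constant absorbs the remaining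
  \<open>k\<close>. Using \<open>1 + \<bar>k\<bar>\<close> makes the bound meaningful at
  \<open>k = 0\<close>.\<close>

lemma d_bound:
  obtains D where "D > 0" "\<And>k. (d k)\<^sup>2 \<le> D * (1 + \<bar>real_of_int k\<bar>) powr (- (2 * p))"
proof -
  obtain b0 where b0: "b0 > 0" "\<And>s b k. b \<ge> b0 \<Longrightarrow> k \<in> {blk s b * 1..<blk s b * 1 + 1} \<Longrightarrow>
      (d k)\<^sup>2 \<le> (side s + 1)\<^sup>2 * (real b * of_int 1) powr (- (2 * p))"
    by (rule d_block_bounds[of 1 1]) auto
  have far: "(d k)\<^sup>2 \<le> (dp + dm + 1)\<^sup>2 * 2 powr (2 * p) * (1 + \<bar>real_of_int k\<bar>) powr (- (2 * p))"
    if k: "\<bar>k\<bar> > int b0 + 1" for k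
  proof -
    define s b where "s = (k \<ge> 0)" and "b = (if k \<ge> 0 then nat k else nat (- k - 1))"
    have kb: "k = blk s b" "b \<ge> b0" using k by (auto simp: s_def b_def blk_def)
    \<comment> \<open>A negative \<open>k\<close> lies in block \<open>- k - 1\<close>, one less
      than \<open>\<bar>k\<bar>\<close>; halving absorbs the shift because
      \<open>\<bar>k\<bar> > 2\<close>.\<close>
    have b2: "(1 + \<bar>real_of_int k\<bar>) / 2 \<le> real b" using k b0(1) by (auto simp: b_def)
    have bp: "real b > 0" using kb(2) b0(1) by simp
    have "(d k)\<^sup>2 \<le> (side s + 1)\<^sup>2 * real b powr (- (2 * p))"
      using b0(2)[OF kb(2), of k s] kb(1) by simp
    also have "\<dots> \<le> (dp + dm + 1)\<^sup>2 * ((1 + \<bar>real_of_int k\<bar>) / 2) powr (- (2 * p))"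
    proof (rule mult_mono)
      show "(side s + 1)\<^sup>2 \<le> (dp + dm + 1)\<^sup>2"
        using dpm by (intro power_mono) (auto simp: side_def)
      show "real b powr (- (2 * p)) \<le> ((1 + \<bar>real_of_int k\<bar>) / 2) powr (- (2 * p))"
        using b2 p_pos by (intro powr_mono2') auto
    qed auto
    also have "((1 + \<bar>real_of_int k\<bar>) / 2) powr (- (2 * p)) = 2 powr (2 * p) * (1 + \<bar>real_of_int k\<bar>) powr (- (2 * p))"
      by (simp add: powr_divide powr_minus field_simps)
    finally show ?thesis by (simp add: mult_ac)
  qed
  define F where "F = {- (int b0 + 1)..int b0 + 1}"
  define E where "E = (\<Sum>k\<in>F. (d k)\<^sup>2 * (1 + \<bar>real_of_int k\<bar>) powr (2 * p))"
  have E: "E \<ge> 0" by (simp add: E_def sum_nonneg)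
  have near: "(d k)\<^sup>2 \<le> E * (1 + \<bar>real_of_int k\<bar>) powr (- (2 * p))" if "k \<in> F" for k
  proof -
    have "(d k)\<^sup>2 * (1 + \<bar>real_of_int k\<bar>) powr (2 * p) \<le> E" unfolding E_def
      by (rule member_le_sum[of k F "\<lambda>k. (d k)\<^sup>2 * (1 + \<bar>real_of_int k\<bar>) powr (2 * p)"]) (use that in \<open>auto simp: F_def\<close>)
    then have "(d k)\<^sup>2 * (1 + \<bar>real_of_int k\<bar>) powr (2 * p) * (1 + \<bar>real_of_int k\<bar>) powr (- (2 * p))
        \<le> E * (1 + \<bar>real_of_int k\<bar>) powr (- (2 * p))" by (rule mult_right_mono) simp
    moreover have "1 + \<bar>real_of_int k\<bar> \<noteq> 0" by linarith
    ultimately show ?thesis by (simp add: mult.assoc powr_add[symmetric])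
  qed
  define D where "D = E + (dp + dm + 1)\<^sup>2 * 2 powr (2 * p)"
  have "(dp + dm + 1)\<^sup>2 * 2 powr (2 * p) > 0" using dpm by (intro mult_pos_pos) auto
  then have D: "D > 0" "E \<le> D" "(dp + dm + 1)\<^sup>2 * 2 powr (2 * p) \<le> D" using E by (auto simp: D_def)
  show thesis
  proof (rule that[OF D(1)])
    fix k
    show "(d k)\<^sup>2 \<le> D * (1 + \<bar>real_of_int k\<bar>) powr (- (2 * p))"
    proof (cases "k \<in> F")
      case True
      show ?thesis by (rule order_trans[OF near[OF True] mult_right_mono[OF D(2)]]) simp
    next
      case False
      then have "\<bar>k\<bar> > int b0 + 1" by (auto simp: F_def)
      then show ?thesis by (rule order_trans[OF far mult_right_mono[OF D(3)]]) simp
    qed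
  qed
qed

text \<open>This is the total price of discarding squares of variance
  \<open>x * (d k)\<^sup>2\<close>. It is uniform in \<open>I\<close>, and when \<open>x\<close> is
  a small multiple of \<open>t\<close> it is a small multiple of the leading order
  \<open>t powr \<beta>\<close>.\<close>

lemma ln_weights_sum_le:
  obtains K where "K > 0" "\<And>I x. finite I \<Longrightarrow> x \<ge> 0 \<Longrightarrow> (\<Sum>k\<in>I. ln (1 + x * (d k)\<^sup>2) / 2) \<le> K * x powr \<beta>"
proof -
  obtain D where D: "D > 0" "\<And>k. (d k)\<^sup>2 \<le> D * (1 + \<bar>real_of_int k\<bar>) powr (- (2 * p))"
    using d_bound by blast
  show thesis
  proof
    show "C0 * D powr \<beta> > 0" using C0_pos D(1) by simp
    fix I :: "int set" and x :: real assume I: "finite I" and x: "x \<ge> 0"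
    define g where "g k = ln (1 + x * D * real k powr (- (2 * p)))" for k :: nat
    have g0: "g k \<ge> 0" for k using x D(1) by (simp add: g_def)
    obtain N where N: "I \<subseteq> {- int N..int N}" by (rule finite_int_bounded[OF I])
    have "(\<Sum>k\<in>I. ln (1 + x * (d k)\<^sup>2) / 2) \<le> (\<Sum>k\<in>I. g (nat (1 + \<bar>k\<bar>)) / 2)"
    proof (rule sum_mono)
      fix k
      have "x * (d k)\<^sup>2 \<le> x * D * (1 + \<bar>real_of_int k\<bar>) powr (- (2 * p))"
        using mult_left_mono[OF D(2)[of k] x] by (simp add: mult_ac)
      moreover have "real (nat (1 + \<bar>k\<bar>)) = 1 + \<bar>real_of_int k\<bar>" by simp
      moreover have "1 + x * (d k)\<^sup>2 > 0" using x by (simp add: add_pos_nonneg)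
      ultimately show "ln (1 + x * (d k)\<^sup>2) / 2 \<le> g (nat (1 + \<bar>k\<bar>)) / 2"
        unfolding g_def by simp
    qed
    also have "\<dots> \<le> (\<Sum>k\<in>{- int N..int N}. g (nat (1 + \<bar>k\<bar>)) / 2)"
      by (rule sum_mono2) (use N g0 in auto)
    \<comment> \<open>Each value \<open>n = 1 + \<bar>k\<bar>\<close> is attained by at most two
      integers \<open>k\<close>, which cancels the division by 2.\<close>
    also have "\<dots> \<le> (\<Sum>k\<in>(\<lambda>n. int n - 1) ` {1..N+1} \<union> (\<lambda>n. 1 - int n) ` {1..N+1}. g (nat (1 + \<bar>k\<bar>)) / 2)"
    proof (rule sum_mono2)
      show "{- int N..int N} \<subseteq> (\<lambda>n. int n - 1) ` {1..N+1} \<union> (\<lambda>n. 1 - int n) ` {1..N+1}"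
      proof
        fix k assume k: "k \<in> {- int N..int N}"
        have "k = int (nat (1 + k)) - 1 \<and> nat (1 + k) \<in> {1..N+1} \<or> k = 1 - int (nat (1 - k)) \<and> nat (1 - k) \<in> {1..N+1}"
          using k by auto
        then show "k \<in> (\<lambda>n. int n - 1) ` {1..N+1} \<union> (\<lambda>n. 1 - int n) ` {1..N+1}" by blast
      qed
    qed (use g0 in auto)
    also have "\<dots> \<le> (\<Sum>k\<in>(\<lambda>n. int n - 1) ` {1..N+1}. g (nat (1 + \<bar>k\<bar>)) / 2)
        + (\<Sum>k\<in>(\<lambda>n. 1 - int n) ` {1..N+1}. g (nat (1 + \<bar>k\<bar>)) / 2)"
      by (subst sum_Un) (auto simp: g0 sum_nonneg)
    also have "\<dots> = (\<Sum>n\<in>{1..N+1}. g n / 2) + (\<Sum>n\<in>{1..N+1}. g n / 2)"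
      by (subst (1 2) sum.reindex) (auto simp: inj_on_def intro!: arg_cong2[where f="(+)"] sum.cong arg_cong[where f=g])
    also have "\<dots> = (\<Sum>n=1..N+1. g n)" by (simp add: sum_divide_distrib[symmetric])
    also have "\<dots> \<le> C0 * (x * D) powr \<beta>"
      unfolding g_def by (rule lnsum_le) (use x D(1) in simp)
    also have "\<dots> = C0 * D powr \<beta> * x powr \<beta>" using x D(1) by (simp add: powr_mult)
    finally show "(\<Sum>k\<in>I. ln (1 + x * (d k)\<^sup>2) / 2) \<le> C0 * D powr \<beta> * x powr \<beta>" .
  qed
qed

end

lemma sum_UN_le:
  fixes g :: "'b \<Rightarrow> real"
  assumes "finite A" "\<And>i. i \<in> A \<Longrightarrow> finite (F i)" "\<And>x. g x \<ge> 0"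
  shows "sum g (\<Union>i\<in>A. F i) \<le> (\<Sum>i\<in>A. sum g (F i))"
  using assms(1,2)
proof (induction A)
  case (insert i A)
  have "sum g (F i \<union> (\<Union>i\<in>A. F i)) \<le> sum g (F i) + sum g (\<Union>i\<in>A. F i)"
    using insert.prems insert.hyps by (subst sum_Un) (auto intro!: sum_nonneg assms(3))
  also have "\<dots> \<le> sum g (F i) + (\<Sum>i\<in>A. sum g (F i))" using insert by simp
  finally show ?case using insert by simp
qed simp

section \<open>Block decomposition for finite range and regular weights\<close>

locale band_weights = finite_range L a + weights d p dp dm
  for L a d p dp dm
begin

definition riem :: "int \<Rightarrow> real" where
  "riem B = (\<Sum>l\<in>{0..<B}. cmod (symbol (2 * pi * of_int l / of_int B)) powr (1 / p)) / of_int B"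

text \<open>Minus the log-Laplace transform at \<open>t / 2\<close> of the sum of
  \<open>(d k)\<^sup>2 * U_k\<^sup>2\<close> over \<open>I\<close>; the argument \<open>t\<close>
  enters through the weights.\<close>

definition tphi :: "real \<Rightarrow> int set \<Rightarrow> real" where
  "tphi t I = bphi (\<lambda>k. sqrt t * d k) I"

context
  fixes B :: int and t :: real
  assumes B: "B > 2 * L" and t: "t \<ge> 0"
begin

lemma B_pos: "B > 0" using B L0 by simp

lemma tphi_core_le:
  assumes "c \<ge> 0" "\<And>k. k \<in> core B b \<Longrightarrow> (d k)\<^sup>2 \<le> c"
  shows "tphi t (core B b) \<le> circ_phi B (t * c)"
proof -
  have "tphi t (core B b) \<le> bphi (\<lambda>_. sqrt (t * c)) (core B b)"
    unfolding tphi_def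
    by (rule bphi_scale_mono) (use assms t in \<open>auto simp: power_mult_distrib intro!: mult_left_mono\<close>)
  also have "\<dots> \<le> circ_phi B (t * c)"
    by (subst bphi_core_shift, rule core_le_circ[OF B]) (use assms t in simp)
  finally show ?thesis .
qed

lemma tphi_core_ge:
  assumes "c \<ge> 0" "\<And>k. k \<in> core B b \<Longrightarrow> c \<le> (d k)\<^sup>2"
  shows "circ_phi B (t * c) - of_int L * ln (1 + t * c * energy) \<le> tphi t (core B b)"
proof -
  have "circ_phi B (t * c) \<le> bphi (\<lambda>_. sqrt (t * c)) (core B b) + of_int L * ln (1 + t * c * energy)"
    by (subst bphi_core_shift, rule circ_le_core[OF B]) (use assms t in simp)
  moreover have "bphi (\<lambda>_. sqrt (t * c)) (core B b) \<le> tphi t (core B b)"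
    unfolding tphi_def
    by (rule bphi_scale_mono) (use assms t in \<open>auto simp: power_mult_distrib intro!: mult_left_mono\<close>)
  ultimately show ?thesis by simp
qed

text \<open>Because \<open>2 * p * \<beta> = 1\<close>, the block length survives exactly as
  \<open>1 / B\<close>, which is the mesh weight in the Riemann sum \<open>riem B\<close>.\<close>

lemma tau_powr:
  assumes "D \<ge> 0" "y \<ge> 0"
  shows "(t * (D\<^sup>2 * of_int B powr (- (2 * p)) * y\<^sup>2)) powr \<beta> = t powr \<beta> * (D powr (1 / p) * y powr (1 / p) / of_int B)"
proof -
  have "(of_int B powr (- (2 * p))) powr \<beta> = 1 / real_of_int B"
  proof -
    have "- (2 * p) * \<beta> = - 1" using \<beta>(3) by simp
    then show ?thesis using B_pos unfolding powr_powr by (simp only:) (simp add: powr_minus_divide)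
  qed
  then show ?thesis using assms t B_pos
    by (simp add: powr_mult square_powr_\<beta>)
qed

lemma tau_term:
  assumes "m > 0"
  shows "t * (D\<^sup>2 * (real (b + m) * of_int B) powr (- (2 * p))) * y\<^sup>2
    = t * (D\<^sup>2 * of_int B powr (- (2 * p)) * y\<^sup>2) * real (b + m) powr (- (2 * p))"
  using B_pos by (simp add: powr_mult)

lemma ln_block_sum_le:
  assumes "D \<ge> 0" "y \<ge> 0" "m > 0"
  shows "(\<Sum>b<n. ln (1 + t * (D\<^sup>2 * (real (b + m) * of_int B) powr (- (2 * p))) * y\<^sup>2))
    \<le> C0 * D powr (1 / p) * y powr (1 / p) / of_int B * t powr \<beta>"
proof -
  have "(\<Sum>b<n. ln (1 + t * (D\<^sup>2 * (real (b + m) * of_int B) powr (- (2 * p))) * y\<^sup>2))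
      \<le> C0 * (t * (D\<^sup>2 * of_int B powr (- (2 * p)) * y\<^sup>2)) powr \<beta>"
    unfolding tau_term[OF assms(3)] by (rule lnpart_le) (use t assms in auto)
  then show ?thesis unfolding tau_powr[OF assms(1,2)] by (simp add: mult_ac)
qed

text \<open>Exchanging blocks and frequencies: for a fixed frequency the sum over blocks is a
  logarithmic sum, with its own \<tau>.\<close>

lemma circ_sum_eq:
  "(\<Sum>b\<in>X. circ_phi B (t * (D\<^sup>2 * (real (b + m) * of_int B) powr (- (2 * p)))))
    = (\<Sum>l\<in>{0..<B}. (\<Sum>b\<in>X. ln (1 + t * (D\<^sup>2 * (real (b + m) * of_int B) powr (- (2 * p)))
        * (cmod (symbol (2 * pi * of_int l / of_int B)))\<^sup>2)) / 2)"
  unfolding circ_phi_def sum_divide_distrib by (rule sum.swap)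

lemma circ_sum_le:
  assumes "D \<ge> 0" "m > 0"
  shows "(\<Sum>b<n. circ_phi B (t * (D\<^sup>2 * (real (b + m) * of_int B) powr (- (2 * p)))))
    \<le> C0 / 2 * D powr (1 / p) * riem B * t powr \<beta>"
proof -
  have "(\<Sum>b<n. circ_phi B (t * (D\<^sup>2 * (real (b + m) * of_int B) powr (- (2 * p)))))
    \<le> (\<Sum>l\<in>{0..<B}. (C0 * D powr (1 / p) * cmod (symbol (2 * pi * of_int l / of_int B)) powr (1 / p) / of_int B * t powr \<beta>) / 2)"
    unfolding circ_sum_eq
    by (intro sum_mono divide_right_mono ln_block_sum_le assms) auto
  also have "\<dots> = C0 / 2 * D powr (1 / p) * riem B * t powr \<beta>"
    unfolding riem_def sum_divide_distrib sum_distrib_left sum_distrib_right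
    by (intro sum.cong refl) (simp add: field_simps)
  finally show ?thesis .
qed

lemma circ_sum_tendsto:
  assumes "m > 0"
  shows "(\<lambda>n. \<Sum>b<n. circ_phi B (t * (D\<^sup>2 * (real (b + m) * of_int B) powr (- (2 * p)))))
    \<longlonglongrightarrow> (\<Sum>l\<in>{0..<B}. lntail m (t * (D\<^sup>2 * of_int B powr (- (2 * p)) * (cmod (symbol (2 * pi * of_int l / of_int B)))\<^sup>2)) / 2)"
  unfolding circ_sum_eq tau_term[OF assms] lntail_def
  by (intro tendsto_sum tendsto_divide summable_LIMSEQ summable_lntail tendsto_const)
     (use assms t in auto)

end

lemma lntail_sum_tendsto:
  assumes "m > 0" "B > 2 * L" "D \<ge> 0"
  shows "((\<lambda>t. (\<Sum>l\<in>{0..<B}. lntail m (t * (D\<^sup>2 * of_int B powr (- (2 * p)) * (cmod (symbol (2 * pi * of_int l / of_int B)))\<^sup>2)) / 2) / t powr \<beta>)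
    \<longlongrightarrow> C0 / 2 * D powr (1 / p) * riem B) at_top"
proof -
  have "((\<lambda>t. (\<Sum>l\<in>{0..<B}. lntail m (t * (D\<^sup>2 * of_int B powr (- (2 * p)) * (cmod (symbol (2 * pi * of_int l / of_int B)))\<^sup>2)) / t powr \<beta> / 2))
    \<longlongrightarrow> (\<Sum>l\<in>{0..<B}. C0 * (D\<^sup>2 * of_int B powr (- (2 * p)) * (cmod (symbol (2 * pi * of_int l / of_int B)))\<^sup>2) powr \<beta> / 2)) at_top"
    by (intro tendsto_sum tendsto_divide lntail_scaled tendsto_const) (use assms in auto)
  also have "(\<Sum>l\<in>{0..<B}. C0 * (D\<^sup>2 * of_int B powr (- (2 * p)) * (cmod (symbol (2 * pi * of_int l / of_int B)))\<^sup>2) powr \<beta> / 2)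
    = C0 / 2 * D powr (1 / p) * riem B"
    unfolding riem_def sum_divide_distrib sum_distrib_left
  proof (rule sum.cong[OF refl])
    fix l
    let ?y = "cmod (symbol (2 * pi * of_int l / of_int B))"
    have "(D\<^sup>2 * of_int B powr (- (2 * p)) * ?y\<^sup>2) powr \<beta> = D powr (1 / p) * ?y powr (1 / p) / of_int B"
      using tau_powr[OF assms(2), of 1 D ?y] assms(3) by simp
    then show "C0 * (D\<^sup>2 * of_int B powr (- (2 * p)) * ?y\<^sup>2) powr \<beta> / 2 = C0 / 2 * D powr (1 / p) * (?y powr (1 / p) / of_int B)"
      by (simp only:) simp
  qed
  also have "(\<lambda>t. (\<Sum>l\<in>{0..<B}. lntail m (t * (D\<^sup>2 * of_int B powr (- (2 * p)) * (cmod (symbol (2 * pi * of_int l / of_int B)))\<^sup>2)) / t powr \<beta> / 2))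
    = (\<lambda>t. (\<Sum>l\<in>{0..<B}. lntail m (t * (D\<^sup>2 * of_int B powr (- (2 * p)) * (cmod (symbol (2 * pi * of_int l / of_int B)))\<^sup>2)) / 2) / t powr \<beta>)"
    by (simp add: sum_divide_distrib mult.commute)
  finally show ?thesis .
qed

lemma blk_inj: "blk s b = blk s' b' \<longleftrightarrow> s = s' \<and> b = b'"
  by (auto simp: blk_def split: if_splits)

lemma tphi_cores:
  assumes "B > 0"
  shows "tphi t (\<Union>(s,b)\<in>UNIV \<times> {..<n}. core B (blk s (b + b0))) = (\<Sum>s\<in>UNIV. \<Sum>b<n. tphi t (core B (blk s (b + b0))))"
proof -
  let ?h = "\<lambda>(s,b). blk s (b + b0)" and ?T = "(UNIV :: bool set) \<times> {..<n}"
  have inj: "inj_on ?h ?T" by (auto simp: inj_on_def blk_inj)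
  have "(\<Union>(s,b)\<in>?T. core B (blk s (b + b0))) = (\<Union>c\<in>?h ` ?T. core B c)" by auto
  then have "tphi t (\<Union>(s,b)\<in>?T. core B (blk s (b + b0))) = (\<Sum>c\<in>?h ` ?T. tphi t (core B c))"
    unfolding tphi_def using assms by (simp only:) (rule bphi_cores, auto)
  also have "\<dots> = (\<Sum>x\<in>?T. tphi t (core B (?h x)))" by (simp add: sum.reindex[OF inj])
  also have "\<dots> = (\<Sum>s\<in>UNIV. \<Sum>b<n. tphi t (core B (blk s (b + b0))))"
    by (simp add: sum.cartesian_product case_prod_unfold)
  finally show ?thesis .
qed

text \<open>Rows outside the cores are charged logarithmically. The \<open>2 * L\<close> gap rows of
  each block produce the term with \<open>L / B\<close>; the rows near the origin, where the weights
  are uncontrolled, are finitely many and fit into the last \<eta>.\<close>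

lemma tphi_upper_B:
  assumes B: "B > 2 * L" and \<eta>: "\<eta> > 0"
  shows "\<forall>\<^sub>F t in at_top. \<forall>I. finite I \<longrightarrow> tphi t I \<le>
    (C0 / 2 * ((dp + \<eta>) powr (1 / p) + (dm + \<eta>) powr (1 / p))
      * (riem B + 2 * of_int L / of_int B * sqrt energy powr (1 / p)) + \<eta>) * t powr \<beta>"
proof -
  have Bp: "B > 0" using B L0 by simp
  obtain b0 :: nat where b0: "b0 > 0"
    "\<And>s b k. b \<ge> b0 \<Longrightarrow> k \<in> {blk s b * B..<blk s b * B + B} \<Longrightarrow>
      (d k)\<^sup>2 \<le> (side s + \<eta>)\<^sup>2 * (real b * of_int B) powr (- (2 * p))"
    using d_block_bounds[OF \<eta> Bp] by metis
  define ctr where "ctr = {- int b0 * B..<int b0 * B}"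
  define g where "g t k = ln (1 + t * (d k)\<^sup>2 * energy) / 2" for t k
  define cc where "cc s b = (side s + \<eta>)\<^sup>2 * (real (b + b0) * of_int B) powr (- (2 * p))" for s b
  define Y where "Y = C0 / 2 * ((dp + \<eta>) powr (1 / p) + (dm + \<eta>) powr (1 / p))
      * (riem B + 2 * of_int L / of_int B * sqrt energy powr (1 / p))"
  have main: "tphi t I \<le> Y * t powr \<beta> + sum (g t) ctr" if t: "t \<ge> 0" and I: "finite I" for t I
  proof -
    have g0: "g t k \<ge> 0" for k using t energy_nonneg by (simp add: g_def)
    obtain n where n: "I \<subseteq> {- (int (n + b0) * B)..<int (n + b0) * B}"
    proof -
      obtain m :: nat where m: "I \<subseteq> {- int m..int m}" by (rule finite_int_bounded[OF I])
      have "int (Suc m + b0) \<le> int (Suc m + b0) * B"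
        using mult_left_mono[of 1 B "int (Suc m + b0)"] Bp by simp
      moreover have "\<bar>k\<bar> < int (Suc m + b0)" if "k \<in> I" for k
        using m that by force
      ultimately have "\<bar>k\<bar> < int (Suc m + b0) * B" if "k \<in> I" for k
        using that by (meson less_le_trans)
      then show thesis by (intro that[of "Suc m"]) force
    qed
    let ?T = "(UNIV :: bool set) \<times> {..<n}"
    let ?J = "{- (int (n + b0) * B)..<int (n + b0) * B}"
    let ?C = "\<Union>(s,b)\<in>?T. core B (blk s (b + b0))"
    let ?gap = "\<lambda>(s,b). {blk s (b + b0) * B + B - 2 * L..<blk s (b + b0) * B + B}"
    \<comment> \<open>The block number \<open>k div B\<close> tells whether \<open>k\<close> is
      central or on one of the two sides; inside its block \<open>k\<close> lies in the core or in
      the trailing gap.\<close>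
    have cover: "?J \<subseteq> ?C \<union> (ctr \<union> (\<Union>x\<in>?T. ?gap x))"
    proof
      fix k assume k: "k \<in> ?J"
      define q where "q = k div B"
      have kq: "q * B \<le> k" "k < q * B + B"
      proof -
        have "k = q * B + k mod B" by (simp add: q_def)
        moreover have "0 \<le> k mod B" "k mod B < B" using Bp by auto
        ultimately show "q * B \<le> k" "k < q * B + B" by linarith+
      qed
      have "q < int (n + b0)"
      proof (rule ccontr)
        assume "\<not> ?thesis"
        then have "int (n + b0) * B \<le> q * B" using Bp by (intro mult_right_mono) auto
        then show False using k kq unfolding atLeastLessThan_iff by linarith
      qed
      have "q \<ge> - int (n + b0)"
      proof (rule ccontr)
        assume "\<not> ?thesis"
        then have "(q + 1) * B \<le> - int (n + b0) * B" using Bp by (intro mult_right_mono) auto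
        then show False using k kq by (simp add: algebra_simps)
      qed
      consider "- int b0 \<le> q \<and> q < int b0" | "q \<ge> int b0" | "q < - int b0" by linarith
      then show "k \<in> ?C \<union> (ctr \<union> (\<Union>x\<in>?T. ?gap x))"
      proof cases
        case 1
        have "- int b0 * B \<le> q * B" using 1 Bp by (intro mult_right_mono) auto
        moreover have "(q + 1) * B \<le> int b0 * B" using 1 Bp by (intro mult_right_mono) auto
        ultimately have "k \<in> ctr" using kq by (simp add: ctr_def algebra_simps)
        then show ?thesis by simp
      next
        case 2
        define b where "b = nat (q - int b0)"
        have b: "blk True (b + b0) = q" "b < n" using 2 \<open>q < int (n + b0)\<close> by (auto simp: blk_def b_def)
        have "k \<in> core B q \<or> k \<in> {q * B + B - 2 * L..<q * B + B}" using kq by (auto simp: core_def)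
        then have "k \<in> core B (blk True (b + b0)) \<or> k \<in> ?gap (True, b)" by (simp add: b)
        moreover have "(True, b) \<in> ?T" using b by simp
        ultimately show ?thesis by blast
      next
        case 3
        define b where "b = nat (- q - 1 - int b0)"
        have b: "blk False (b + b0) = q" "b < n" using 3 \<open>q \<ge> - int (n + b0)\<close> by (auto simp: blk_def b_def)
        have "k \<in> core B q \<or> k \<in> {q * B + B - 2 * L..<q * B + B}" using kq by (auto simp: core_def)
        then have "k \<in> core B (blk False (b + b0)) \<or> k \<in> ?gap (False, b)" by (simp add: b)
        moreover have "(False, b) \<in> ?T" using b by simp
        ultimately show ?thesis by blast
      qed
    qed
    \<comment> \<open>Rows already in a core are taken out, since \<open>bphi_Un_le\<close> charges
      a set disjoint from the first.\<close>
    define R where "R = (ctr \<union> (\<Union>x\<in>?T. ?gap x)) - ?C"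
    have finC: "finite ?C" and finR: "finite R" by (auto simp: R_def ctr_def)
    have "tphi t I \<le> tphi t (?C \<union> R)"
      unfolding tphi_def by (rule bphi_mono) (use finC finR n cover in \<open>auto simp: R_def\<close>)
    also have "\<dots> \<le> tphi t ?C + sum (g t) R"
      using bphi_Un_le[OF finC finR, of "\<lambda>k. sqrt t * d k"] t
      by (simp add: tphi_def g_def power_mult_distrib R_def)
    also have "sum (g t) R \<le> sum (g t) (ctr \<union> (\<Union>x\<in>?T. ?gap x))"
      by (rule sum_mono2) (auto simp: R_def ctr_def g0)
    also have "\<dots> \<le> sum (g t) ctr + sum (g t) (\<Union>x\<in>?T. ?gap x)"
      by (subst sum_Un) (auto simp: ctr_def intro!: sum_nonneg g0)
    also have "sum (g t) (\<Union>x\<in>?T. ?gap x) \<le> (\<Sum>x\<in>?T. sum (g t) (?gap x))"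
      by (rule sum_UN_le) (auto simp: g0)
    also have "\<dots> \<le> (\<Sum>x\<in>?T. of_int L * ln (1 + t * cc (fst x) (snd x) * (sqrt energy)\<^sup>2))"
    proof (rule sum_mono)
      fix x assume "x \<in> ?T"
      obtain s b where x: "x = (s,b)" by (cases x)
      have "g t k \<le> ln (1 + t * cc s b * energy) / 2" if "k \<in> ?gap x" for k
      proof -
        have "(d k)\<^sup>2 \<le> cc s b"
          using b0(2)[of "b + b0" k s] that L0 B by (auto simp: x cc_def)
        then have "t * (d k)\<^sup>2 * energy \<le> t * cc s b * energy"
          using t energy_nonneg by (intro mult_right_mono mult_left_mono) auto
        moreover have "t * (d k)\<^sup>2 * energy \<ge> 0" using t energy_nonneg by simp
        ultimately show ?thesis unfolding g_def by simp
      qed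
      then have "sum (g t) (?gap x) \<le> (\<Sum>k\<in>?gap x. ln (1 + t * cc s b * energy) / 2)"
        by (rule sum_mono)
      also have "\<dots> = of_int L * ln (1 + t * cc s b * energy)"
        using L0 by (simp add: x)
      finally show "sum (g t) (?gap x) \<le> of_int L * ln (1 + t * cc (fst x) (snd x) * (sqrt energy)\<^sup>2)"
        using energy_nonneg by (simp add: x)
    qed
    also have "\<dots> = of_int L * (\<Sum>s\<in>UNIV. \<Sum>b<n. ln (1 + t * cc s b * (sqrt energy)\<^sup>2))"
      by (simp add: sum.cartesian_product case_prod_unfold sum_distrib_left)
    also have "\<dots> \<le> of_int L * (\<Sum>s\<in>UNIV. C0 * (side s + \<eta>) powr (1 / p) * sqrt energy powr (1 / p) / of_int B * t powr \<beta>)"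
      unfolding cc_def
      by (intro mult_left_mono sum_mono ln_block_sum_le[OF B t])
         (use L0 \<eta> side_nonneg b0(1) energy_nonneg in \<open>auto intro: add_nonneg_nonneg\<close>)
    also have "tphi t ?C = (\<Sum>s\<in>UNIV. \<Sum>b<n. tphi t (core B (blk s (b + b0))))"
      by (rule tphi_cores[OF Bp])
    also have "\<dots> \<le> (\<Sum>s\<in>UNIV. \<Sum>b<n. circ_phi B (t * cc s b))"
    proof (intro sum_mono tphi_core_le[OF B t])
      fix s b k assume "k \<in> core B (blk s (b + b0))"
      then show "(d k)\<^sup>2 \<le> cc s b"
        using b0(2)[of "b + b0" k s] L0 by (auto simp: core_def cc_def)
    qed (simp add: cc_def)
    also have "\<dots> \<le> (\<Sum>s\<in>UNIV. C0 / 2 * (side s + \<eta>) powr (1 / p) * riem B * t powr \<beta>)"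
      unfolding cc_def
      by (intro sum_mono circ_sum_le[OF B t]) (use \<eta> side_nonneg b0(1) in \<open>auto intro: add_nonneg_nonneg\<close>)
    finally show ?thesis
      by (simp add: Y_def UNIV_bool side_def field_simps)
  qed
  \<comment> \<open>Finitely many terms, each growing at most like \<open>ln t\<close>, are
    negligible against \<open>t powr \<beta>\<close>.\<close>
  have "((\<lambda>t. sum (g t) ctr / t powr \<beta>) \<longlongrightarrow> (\<Sum>k\<in>ctr. 0)) at_top"
    unfolding sum_divide_distrib
  proof (rule tendsto_sum)
    fix k
    have "((\<lambda>t. ln (1 + t * c) / 2 / t powr \<beta>) \<longlongrightarrow> 0) at_top" if "c > 0" for c
      using that \<beta> by real_asymp
    moreover have "(d k)\<^sup>2 * energy = 0 \<or> (d k)\<^sup>2 * energy > 0"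
      using energy_nonneg d_pos[of k] by (auto simp: less_le)
    ultimately show "((\<lambda>t. g t k / t powr \<beta>) \<longlongrightarrow> 0) at_top"
      unfolding g_def mult.assoc by (auto simp del: mult_eq_0_iff)
  qed
  then have "\<forall>\<^sub>F t in at_top. sum (g t) ctr / t powr \<beta> < \<eta>"
    by (rule order_tendstoD) (use \<eta> in simp)
  then show ?thesis
    using eventually_gt_at_top[of 0]
  proof eventually_elim
    case (elim t)
    then have "sum (g t) ctr \<le> \<eta> * t powr \<beta>" by (simp add: divide_less_eq)
    show ?case unfolding Y_def[symmetric]
    proof (intro allI impI)
      fix I :: "int set" assume "finite I"
      then have "tphi t I \<le> Y * t powr \<beta> + sum (g t) ctr" using main[of t] elim(2) by simp
      with \<open>sum (g t) ctr \<le> \<eta> * t powr \<beta>\<close> show "tphi t I \<le> (Y + \<eta>) * t powr \<beta>"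
        unfolding distrib_right by linarith
    qed
  qed
qed

text \<open>It suffices to exhibit finitely many cores. Each is below its circulant model by at most
  the cost of the \<open>2 * L\<close> extra rows, and these costs sum to the term with
  \<open>L / B\<close>.\<close>

lemma tphi_lower_B:
  assumes B: "B > 2 * L" and \<eta>: "\<eta> > 0"
  shows "\<forall>\<^sub>F t in at_top. \<exists>I. finite I \<and> tphi t I \<ge>
    (C0 / 2 * (max 0 (dp - \<eta>) powr (1 / p) + max 0 (dm - \<eta>) powr (1 / p))
      * (riem B - 2 * of_int L / of_int B * sqrt energy powr (1 / p)) - \<eta>) * t powr \<beta>"
proof -
  have Bp: "B > 0" using B L0 by simp
  obtain b0 :: nat where b0: "b0 > 0"
    "\<And>s b k. b \<ge> b0 \<Longrightarrow> k \<in> {blk s b * B..<blk s b * B + B} \<Longrightarrow>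
      (max 0 (side s - \<eta>))\<^sup>2 * (real (Suc b) * of_int B) powr (- (2 * p)) \<le> (d k)\<^sup>2"
    using d_block_bounds[OF \<eta> Bp] by metis
  define D where "D s = max 0 (side s - \<eta>)" for s
  have D0: "D s \<ge> 0" for s by (simp add: D_def)
  \<comment> \<open>The lower bound for \<open>(d k)\<^sup>2\<close> sits at the far end of the
    block, so block \<open>b + b0\<close> carries the index \<open>b + Suc b0\<close>.\<close>
  define m where "m = Suc b0"
  have m: "m > 0" by (simp add: m_def)
  define cc where "cc s b = (D s)\<^sup>2 * (real (b + m) * of_int B) powr (- (2 * p))" for s b
  define G where "G t = (\<Sum>s\<in>UNIV. \<Sum>l\<in>{0..<B}. lntail m (t * ((D s)\<^sup>2 * of_int B powr (- (2 * p)) * (cmod (symbol (2 * pi * of_int l / of_int B)))\<^sup>2)) / 2)" for t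
  define E where "E = (\<Sum>s\<in>UNIV. C0 * D s powr (1 / p) * sqrt energy powr (1 / p) / of_int B)"
  have main: "\<exists>I. finite I \<and> tphi t I \<ge> G t - 1 - of_int L * E * t powr \<beta>" if t: "t \<ge> 0" for t
  proof -
    have "(\<lambda>n. \<Sum>s\<in>UNIV. \<Sum>b<n. circ_phi B (t * cc s b)) \<longlonglongrightarrow> G t"
      unfolding G_def cc_def by (intro tendsto_sum circ_sum_tendsto B t m)
    \<comment> \<open>A slack of 1 pays for replacing the infinite series by finitely many blocks;
      it disappears after division by \<open>t powr \<beta>\<close>.\<close>
    then have "\<forall>\<^sub>F n in sequentially. (\<Sum>s\<in>UNIV. \<Sum>b<n. circ_phi B (t * cc s b)) > G t - 1"
      by (rule order_tendstoD) simp
    then obtain n where n: "(\<Sum>s\<in>UNIV. \<Sum>b<n. circ_phi B (t * cc s b)) > G t - 1"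
      by (meson eventually_sequentially order_refl)
    let ?C = "\<Union>(s,b)\<in>UNIV \<times> {..<n}. core B (blk s (b + b0))"
    have "(\<Sum>s\<in>UNIV. \<Sum>b<n. circ_phi B (t * cc s b) - of_int L * ln (1 + t * cc s b * energy))
        \<le> (\<Sum>s\<in>UNIV. \<Sum>b<n. tphi t (core B (blk s (b + b0))))"
    proof (intro sum_mono tphi_core_ge[OF B t])
      fix s b k assume "k \<in> core B (blk s (b + b0))"
      then show "cc s b \<le> (d k)\<^sup>2"
        using b0(2)[of "b + b0" k s] L0 by (auto simp: core_def cc_def D_def m_def)
    qed (simp add: cc_def)
    also have "\<dots> = tphi t ?C" by (rule tphi_cores[OF Bp, symmetric])
    finally have 1: "(\<Sum>s\<in>UNIV. \<Sum>b<n. circ_phi B (t * cc s b)) - of_int L * (\<Sum>s\<in>UNIV. \<Sum>b<n. ln (1 + t * cc s b * energy)) \<le> tphi t ?C"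
      by (simp add: sum_subtractf sum_distrib_left)
    have "(\<Sum>s\<in>UNIV. \<Sum>b<n. ln (1 + t * cc s b * (sqrt energy)\<^sup>2)) \<le> (\<Sum>s\<in>UNIV. C0 * D s powr (1 / p) * sqrt energy powr (1 / p) / of_int B * t powr \<beta>)"
      unfolding cc_def by (intro sum_mono ln_block_sum_le B t m D0) (use energy_nonneg in simp)
    also have "\<dots> = E * t powr \<beta>" by (simp add: E_def sum_distrib_right)
    finally have "of_int L * (\<Sum>s\<in>UNIV. \<Sum>b<n. ln (1 + t * cc s b * energy)) \<le> of_int L * (E * t powr \<beta>)"
      using L0 energy_nonneg by (intro mult_left_mono) auto
    then have "G t - 1 - of_int L * E * t powr \<beta> \<le> tphi t ?C" using 1 n by simp
    then show ?thesis by (intro exI[of _ ?C]) auto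
  qed
  have lim: "((\<lambda>t. G t / t powr \<beta> - 1 / t powr \<beta> - of_int L * E) \<longlongrightarrow>
      (\<Sum>s\<in>UNIV. C0 / 2 * D s powr (1 / p) * riem B) - 0 - of_int L * E) at_top"
  proof (intro tendsto_diff tendsto_const)
    show "((\<lambda>t. G t / t powr \<beta>) \<longlongrightarrow> (\<Sum>s\<in>UNIV. C0 / 2 * D s powr (1 / p) * riem B)) at_top"
      unfolding G_def sum_divide_distrib[of _ UNIV] by (intro tendsto_sum lntail_sum_tendsto m B D0)
    show "((\<lambda>t. 1 / t powr \<beta>) \<longlongrightarrow> 0) at_top" using \<beta> by real_asymp
  qed
  let ?Y = "C0 / 2 * (max 0 (dp - \<eta>) powr (1 / p) + max 0 (dm - \<eta>) powr (1 / p))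
      * (riem B - 2 * of_int L / of_int B * sqrt energy powr (1 / p))"
  have Y: "(\<Sum>s\<in>UNIV. C0 / 2 * D s powr (1 / p) * riem B) - 0 - of_int L * E = ?Y"
    by (simp add: E_def UNIV_bool D_def side_def field_simps)
  have "\<forall>\<^sub>F t in at_top. G t / t powr \<beta> - 1 / t powr \<beta> - of_int L * E > ?Y - \<eta>"
    by (rule order_tendstoD(1)[OF lim[unfolded Y]]) (use \<eta> in simp)
  then show ?thesis using eventually_gt_at_top[of 0]
  proof eventually_elim
    case (elim t)
    then obtain I where I: "finite I" "tphi t I \<ge> G t - 1 - of_int L * E * t powr \<beta>"
      using main[of t] by auto
    have "(?Y - \<eta>) * t powr \<beta> \<le> (G t / t powr \<beta> - 1 / t powr \<beta> - of_int L * E) * t powr \<beta>"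
      using elim by (intro mult_right_mono) auto
    also have "\<dots> = G t - 1 - of_int L * E * t powr \<beta>"
      using elim by (simp add: left_diff_distrib)
    finally show ?case using I by (intro exI[of _ I]) auto
  qed
qed

end

section \<open>Riemann sums and the rate for a fixed finite range\<close>

lemma riemann_sum_tendsto:
  fixes g :: "real \<Rightarrow> real"
  assumes g: "continuous_on {0..c} g" and c: "c > 0"
  shows "(\<lambda>n. (\<Sum>l<n. g (c * real l / real n)) / real n) \<longlonglongrightarrow> integral {0..c} g / c"
proof (rule LIMSEQ_I)
  fix r :: real assume r: "r > 0"
  define F where "F x = integral {0..x} g" for x
  have F: "(F has_real_derivative g x) (at x within {0..c})" if "x \<in> {0..c}" for x
    unfolding F_def using integral_has_real_derivative[OF g that] .
  have "uniformly_continuous_on {0..c} g"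
    by (rule compact_uniformly_continuous[OF g]) simp
  then obtain \<delta> where \<delta>: "\<delta> > 0"
    "\<And>x y. x \<in> {0..c} \<Longrightarrow> y \<in> {0..c} \<Longrightarrow> dist y x < \<delta> \<Longrightarrow> dist (g y) (g x) < r / 2"
    unfolding uniformly_continuous_on_def using r by (metis half_gt_zero)
  obtain N where N: "real N > c / \<delta>" using reals_Archimedean2 by blast
  have N0: "real N > 0" using N c \<delta>(1) by (meson divide_pos_pos less_trans)
  show "\<exists>no. \<forall>n\<ge>no. norm ((\<Sum>l<n. g (c * real l / real n)) / real n - integral {0..c} g / c) < r"
  proof (intro exI[of _ N] allI impI)
    fix n assume n: "n \<ge> N"
    then have n0: "real n > 0" and nd: "c / real n < \<delta>"
      using N0 N c \<delta>(1) by (auto simp: field_simps intro: less_le_trans)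
    define h where "h = c / real n"
    have h: "h > 0" "h < \<delta>" "real n * h = c" using n0 nd c by (auto simp: h_def)
    define x where "x l = real l * h" for l :: nat
    have xb: "0 \<le> x l \<and> x l \<le> c" if "l \<le> n" for l
    proof -
      have "real l * h \<le> real n * h" using that h by (intro mult_right_mono) auto
      then show ?thesis using h by (simp add: x_def)
    qed
    \<comment> \<open>On each cell the integral is \<open>h\<close> times a value of
      \<open>g\<close> at an intermediate point, which uniform continuity compares with the value at
      the left end.\<close>
    have step: "\<bar>F (x (Suc l)) - F (x l) - h * g (x l)\<bar> \<le> h * (r / 2)" if l: "l < n" for l
    proof -
      have b: "0 \<le> x l" "x l < x (Suc l)" "x (Suc l) \<le> c"
        using xb[of l] xb[of "Suc l"] l h by (auto simp: x_def algebra_simps)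
      have "continuous_on {x l..x (Suc l)} F"
        unfolding continuous_on_eq_continuous_within
      proof
        fix z assume "z \<in> {x l..x (Suc l)}"
        then have "continuous (at z within {0..c}) F" using b
          by (intro DERIV_continuous[OF F]) auto
        then show "continuous (at z within {x l..x (Suc l)}) F"
          by (rule continuous_within_subset) (use b in auto)
      qed
      moreover have dF: "DERIV F z :> g z" if "x l < z" "z < x (Suc l)" for z
      proof -
        have "at z within {0..c} = at z" by (rule at_within_interior) (use that b in auto)
        then show ?thesis using F[of z] that b by auto
      qed
      ultimately obtain D z where z: "x l < z" "z < x (Suc l)" "DERIV F z :> D"
        "F (x (Suc l)) - F (x l) = (x (Suc l) - x l) * D"
        using MVT[OF b(2), of F] by (metis real_differentiable_def)
      have D: "D = g z" using DERIV_unique[OF z(3) dF] z by simp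
      have hs: "x (Suc l) - x l = h" by (simp add: x_def algebra_simps)
      then have eq: "F (x (Suc l)) - F (x l) - h * g (x l) = h * (g z - g (x l))"
        using z(4) D by (simp add: algebra_simps)
      have "dist (g z) (g (x l)) < r / 2"
        by (rule \<delta>(2)) (use z(1,2) b h(1,2) hs in \<open>auto simp: dist_real_def\<close>)
      then have "h * \<bar>g z - g (x l)\<bar> \<le> h * (r / 2)"
        using h by (intro mult_left_mono) (auto simp: dist_real_def)
      then show ?thesis unfolding eq using h by (simp add: abs_mult)
    qed
    have "F (x n) - F (x 0) = (\<Sum>l<n. F (x (Suc l)) - F (x l))" by (rule sum_lessThan_telescope[symmetric])
    then have "\<bar>F c - (\<Sum>l<n. h * g (x l))\<bar> = \<bar>\<Sum>l<n. F (x (Suc l)) - F (x l) - h * g (x l)\<bar>"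
      using h(3) by (simp add: sum_subtractf x_def F_def)
    also have "\<dots> \<le> (\<Sum>l<n. h * (r / 2))"
      by (rule order_trans[OF sum_abs sum_mono]) (use step in auto)
    also have "\<dots> = c * (r / 2)" using h(3) by simp
    finally have "\<bar>F c - (\<Sum>l<n. h * g (x l))\<bar> / c \<le> r / 2" using c by (simp add: field_simps)
    moreover have "(\<Sum>l<n. g (c * real l / real n)) / real n - integral {0..c} g / c
        = - (F c - (\<Sum>l<n. h * g (x l))) / c"
    proof -
      have "(\<Sum>l<n. h * g (x l)) = c * ((\<Sum>l<n. g (c * real l / real n)) / real n)"
        unfolding sum_divide_distrib sum_distrib_left
        by (intro sum.cong refl) (simp add: h_def x_def mult_ac)
      then show ?thesis using c by (simp add: F_def diff_divide_distrib)
    qed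
    ultimately show "norm ((\<Sum>l<n. g (c * real l / real n)) / real n - integral {0..c} g / c) < r"
      using r c by (simp only: real_norm_def abs_divide abs_minus_cancel)
  qed
qed

context band_weights
begin

definition sym_mean :: real where
  "sym_mean = integral {0..2 * pi} (\<lambda>x. cmod (symbol x) powr (1 / p)) / (2 * pi)"

lemma continuous_symbol: "continuous_on A symbol"
  unfolding symbol_def[abs_def] by (intro continuous_intros)

lemma riem_tendsto: "(\<lambda>n. riem (int n)) \<longlonglongrightarrow> sym_mean"
proof -
  have "continuous_on {0..2 * pi} (\<lambda>x. cmod (symbol x) powr (1 / p))"
    using p_pos by (intro continuous_on_powr' continuous_intros continuous_symbol) auto
  from riemann_sum_tendsto[OF this] have
    "(\<lambda>n. (\<Sum>l<n. cmod (symbol (2 * pi * real l / real n)) powr (1 / p)) / real n) \<longlonglongrightarrow> sym_mean"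
    by (simp add: sym_mean_def)
  moreover have "riem (int n) = (\<Sum>l<n. cmod (symbol (2 * pi * real l / real n)) powr (1 / p)) / real n" for n
    unfolding riem_def
    by (subst sum.reindex_bij_witness[where i=int and j=nat and T="{..<n}" and h="\<lambda>l. cmod (symbol (2 * pi * real l / real n)) powr (1 / p)"]) auto
  ultimately show ?thesis by simp
qed

definition rate :: real where
  "rate = C0 / 2 * (dp powr (1 / p) + dm powr (1 / p)) * sym_mean"

text \<open>Block length \<open>n\<close> and tolerance \<open>1 / Suc n\<close> are driven by one
  index. The block bound holds for every fixed large \<open>n\<close>, so one suitable
  \<open>n\<close> is chosen before \<open>t\<close> grows.\<close>

lemma tphi_upper:
  assumes "\<eta> > 0"
  shows "\<forall>\<^sub>F t in at_top. \<forall>I. finite I \<longrightarrow> tphi t I \<le> (rate + \<eta>) * t powr \<beta>"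
proof -
  define e where "e n = 1 / real (Suc n)" for n
  define Y where "Y n = C0 / 2 * ((dp + e n) powr (1 / p) + (dm + e n) powr (1 / p))
      * (riem (int n) + 2 * of_int L / real n * sqrt energy powr (1 / p)) + e n" for n
  have e0: "e \<longlonglongrightarrow> 0" unfolding e_def[abs_def] using LIMSEQ_inverse_real_of_nat by (simp add: inverse_eq_divide)
  have epos: "e n > 0" for n by (simp add: e_def)
  have pw: "(\<lambda>n. (x + e n) powr (1 / p)) \<longlonglongrightarrow> x powr (1 / p)" if "x \<ge> 0" for x
    using tendsto_add[OF tendsto_const[of x] e0] p_pos that epos
    by (intro tendsto_powr') (auto intro!: always_eventually add_nonneg_nonneg less_imp_le)
  have "(\<lambda>n. 2 * of_int L / real n * sqrt energy powr (1 / p)) \<longlonglongrightarrow> 0"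
    by (rule tendsto_mult_left_zero[OF lim_const_over_n])
  then have "Y \<longlonglongrightarrow> C0 / 2 * (dp powr (1 / p) + dm powr (1 / p)) * (sym_mean + 0) + 0"
    unfolding Y_def[abs_def] by (intro tendsto_intros pw dpm riem_tendsto e0)
  then have "Y \<longlonglongrightarrow> rate" by (simp add: rate_def)
  then have "\<forall>\<^sub>F n in sequentially. Y n < rate + \<eta>"
    by (rule order_tendstoD) (use assms in simp)
  moreover have "\<forall>\<^sub>F n in sequentially. int n > 2 * L"
    using eventually_gt_at_top[of "nat (2 * L)"] by eventually_elim simp
  ultimately have "\<forall>\<^sub>F n in sequentially. Y n < rate + \<eta> \<and> int n > 2 * L" by eventually_elim simp
  then obtain n where n: "Y n < rate + \<eta>" "int n > 2 * L"
    unfolding eventually_sequentially by blast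
  from tphi_upper_B[OF n(2) epos[of n]] show ?thesis
  proof eventually_elim
    case (elim t)
    have "Y n * t powr \<beta> \<le> (rate + \<eta>) * t powr \<beta>" by (rule mult_right_mono[OF less_imp_le[OF n(1)]]) simp
    moreover have "tphi t I \<le> Y n * t powr \<beta>" if "finite I" for I
      using elim that unfolding Y_def by simp
    ultimately show ?case by (meson order_trans)
  qed
qed

lemma tphi_lower:
  assumes "\<eta> > 0"
  shows "\<forall>\<^sub>F t in at_top. \<exists>I. finite I \<and> tphi t I \<ge> (rate - \<eta>) * t powr \<beta>"
proof -
  define e where "e n = 1 / real (Suc n)" for n
  define Y where "Y n = C0 / 2 * (max 0 (dp - e n) powr (1 / p) + max 0 (dm - e n) powr (1 / p))
      * (riem (int n) - 2 * of_int L / of_int (int n) * sqrt energy powr (1 / p)) - e n" for n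
  have e0: "e \<longlonglongrightarrow> 0" unfolding e_def[abs_def] using LIMSEQ_inverse_real_of_nat by (simp add: inverse_eq_divide)
  have epos: "e n > 0" for n by (simp add: e_def)
  have pw: "(\<lambda>n. max 0 (x - e n) powr (1 / p)) \<longlonglongrightarrow> x powr (1 / p)" if "x \<ge> 0" for x
  proof (rule tendsto_powr')
    have "(\<lambda>n. max 0 (x - e n)) \<longlonglongrightarrow> max 0 (x - 0)" by (intro tendsto_intros e0)
    then show "(\<lambda>n. max 0 (x - e n)) \<longlonglongrightarrow> x" using that by simp
  qed (use p_pos in auto)
  have "(\<lambda>n. 2 * of_int L / real n * sqrt energy powr (1 / p)) \<longlonglongrightarrow> 0"
    by (rule tendsto_mult_left_zero[OF lim_const_over_n])
  then have "Y \<longlonglongrightarrow> C0 / 2 * (dp powr (1 / p) + dm powr (1 / p)) * (sym_mean - 0) - 0"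
    unfolding Y_def[abs_def] of_int_of_nat_eq by (intro tendsto_intros pw dpm riem_tendsto e0)
  then have "Y \<longlonglongrightarrow> rate" by (simp add: rate_def)
  then have "\<forall>\<^sub>F n in sequentially. Y n > rate - \<eta>"
    by (rule order_tendstoD) (use assms in simp)
  moreover have "\<forall>\<^sub>F n in sequentially. int n > 2 * L"
    using eventually_gt_at_top[of "nat (2 * L)"] by eventually_elim simp
  ultimately have "\<forall>\<^sub>F n in sequentially. Y n > rate - \<eta> \<and> int n > 2 * L" by eventually_elim simp
  then obtain n where n: "Y n > rate - \<eta>" "int n > 2 * L"
    unfolding eventually_sequentially by blast
  from tphi_lower_B[OF n(2) epos[of n]] show ?thesis
  proof eventually_elim
    case (elim t)
    then obtain I where I: "finite I" "tphi t I \<ge> Y n * t powr \<beta>" unfolding Y_def by blast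
    have "(rate - \<eta>) * t powr \<beta> \<le> Y n * t powr \<beta>" by (rule mult_right_mono[OF less_imp_le[OF n(1)]]) simp
    then have "(rate - \<eta>) * t powr \<beta> \<le> tphi t I" using I(2) by (rule order_trans)
    then show ?case using I(1) by blast
  qed
qed

end

section \<open>Convergence of the moving average\<close>

context prob_space
begin

lemma indep_vars_reindex_inj:
  assumes ind: "indep_vars (\<lambda>_. N) Y UNIV" and f: "inj f"
  shows "indep_vars (\<lambda>_. N) (\<lambda>i. Y (f i)) UNIV"
proof -
  let ?F = "\<lambda>i. {Y i -` A \<inter> space M | A. A \<in> sets N}"
  have F: "indep_sets ?F UNIV" and rv: "\<And>i. random_variable N (Y i)"
    using ind unfolding indep_vars_def2 by auto
  have "indep_sets (\<lambda>i. ?F (f i)) UNIV"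
    unfolding indep_sets_def
  proof (intro conjI ballI allI impI)
    show "?F (f i) \<subseteq> events" for i using F unfolding indep_sets_def by blast
    fix J A assume J: "J \<noteq> {}" "finite J" and A: "A \<in> (\<Pi> i\<in>J. ?F (f i))"
    define A' where "A' y = A (inv f y)" for y
    have inv: "A' (f j) = A j" for j by (simp add: A'_def inv_f_f[OF f])
    have "A' \<in> Pi (f ` J) ?F" using A by (auto simp: inv Pi_iff)
    then have "prob (\<Inter>j\<in>f ` J. A' j) = (\<Prod>j\<in>f ` J. prob (A' j))"
      by (intro indep_setsD[OF F]) (use J in auto)
    then show "prob (\<Inter>j\<in>J. A j) = (\<Prod>j\<in>J. prob (A j))"
      by (simp add: prod.reindex[OF inj_on_subset[OF f]] inv)
  qed
  then show ?thesis unfolding indep_vars_def2 using rv by auto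
qed

lemma integrable_mult_square:
  fixes f g :: "'a \<Rightarrow> real"
  assumes "f \<in> borel_measurable M" "g \<in> borel_measurable M"
    "integrable M (\<lambda>x. (f x)\<^sup>2)" "integrable M (\<lambda>x. (g x)\<^sup>2)"
  shows "integrable M (\<lambda>x. f x * g x)"
proof (rule Bochner_Integration.integrable_bound)
  show "integrable M (\<lambda>x. (f x)\<^sup>2 + (g x)\<^sup>2)"
    by (rule Bochner_Integration.integrable_add[OF assms(3,4)])
  show "AE x in M. norm (f x * g x) \<le> norm ((f x)\<^sup>2 + (g x)\<^sup>2)"
  proof (rule AE_I2)
    fix x
    have "2 * (\<bar>f x\<bar> * \<bar>g x\<bar>) \<le> (f x)\<^sup>2 + (g x)\<^sup>2"
      using sum_squares_bound[of "\<bar>f x\<bar>" "\<bar>g x\<bar>"] by (simp add: mult.assoc)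
    moreover have "0 \<le> \<bar>f x\<bar> * \<bar>g x\<bar>" by simp
    ultimately have "\<bar>f x\<bar> * \<bar>g x\<bar> \<le> (f x)\<^sup>2 + (g x)\<^sup>2" by linarith
    then show "norm (f x * g x) \<le> norm ((f x)\<^sup>2 + (g x)\<^sup>2)" by (simp add: abs_mult)
  qed
qed (use assms in measurable)

lemma integrable_square_add:
  fixes f g :: "'a \<Rightarrow> real"
  assumes "f \<in> borel_measurable M" "g \<in> borel_measurable M"
    "integrable M (\<lambda>x. (f x)\<^sup>2)" "integrable M (\<lambda>x. (g x)\<^sup>2)"
  shows "integrable M (\<lambda>x. (f x + g x)\<^sup>2)"
proof -
  have "integrable M (\<lambda>x. (f x)\<^sup>2 + (g x)\<^sup>2 + 2 * (f x * g x))"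
    by (intro Bochner_Integration.integrable_add integrable_mult_right integrable_mult_square assms)
  then show ?thesis by (simp add: power2_sum mult.assoc)
qed

context
  fixes \<xi> :: "nat \<Rightarrow> 'a \<Rightarrow> real"
  assumes ind: "indep_vars (\<lambda>_. borel) \<xi> UNIV"
    and sq: "\<And>i. integrable M (\<lambda>\<omega>. (\<xi> i \<omega>)\<^sup>2)"
    and mean: "\<And>i. expectation (\<xi> i) = 0"
begin

lemma rv_\<xi>: "\<xi> i \<in> borel_measurable M"
  using ind by (auto simp: indep_vars_def)

lemma integrable_\<xi>: "integrable M (\<xi> i)"
  by (rule square_integrable_imp_integrable[OF rv_\<xi> sq])

lemma rv_sum_\<xi>: "(\<lambda>\<omega>. \<Sum>i\<in>A. \<xi> i \<omega>) \<in> borel_measurable M"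
  by (intro borel_measurable_sum rv_\<xi>)

lemma integrable_sum_square:
  "finite A \<Longrightarrow> integrable M (\<lambda>\<omega>. (\<Sum>i\<in>A. \<xi> i \<omega>)\<^sup>2)"
proof (induction A rule: finite_induct)
  case (insert i A)
  then show ?case using integrable_square_add[OF rv_\<xi>[of i] rv_sum_\<xi>[of A] sq[of i]] by simp
qed simp

lemma mean_sum: "expectation (\<lambda>\<omega>. \<Sum>i\<in>A. \<xi> i \<omega>) = 0"
  using integrable_\<xi> mean by simp

lemma expectation_sum_square:
  "expectation (\<lambda>\<omega>. (\<Sum>i<n. \<xi> i \<omega>)\<^sup>2) = (\<Sum>i<n. expectation (\<lambda>\<omega>. (\<xi> i \<omega>)\<^sup>2))"
proof (induction n)
  case (Suc n)
  let ?S = "\<lambda>\<omega>. \<Sum>i<n. \<xi> i \<omega>"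
  have "indep_vars (\<lambda>_. borel) \<xi> (insert n {..<n})" by (rule indep_vars_subset[OF ind]) simp
  then have iv: "indep_var borel (\<xi> n) borel ?S"
    by (intro indep_vars_sum) auto
  have iS: "integrable M ?S" using integrable_\<xi> by simp
  have "expectation (\<lambda>\<omega>. \<xi> n \<omega> * ?S \<omega>) = 0"
    using indep_var_lebesgue_integral[OF iv integrable_\<xi> iS] mean by simp
  moreover have "integrable M (\<lambda>\<omega>. \<xi> n \<omega> * ?S \<omega>)"
    by (rule indep_var_integrable[OF iv integrable_\<xi> iS])
  moreover have "(?S \<omega> + \<xi> n \<omega>)\<^sup>2 = (?S \<omega>)\<^sup>2 + (\<xi> n \<omega>)\<^sup>2 + 2 * (\<xi> n \<omega> * ?S \<omega>)" for \<omega>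
    by (simp add: power2_sum)
  ultimately show ?case using Suc.IH integrable_sum_square[of "{..<n}"] sq[of n] by simp
qed simp

text \<open>Decompose by the first index \<open>k\<close> at which the partial sum reaches
  \<open>c\<close>. The later increment has mean 0 and is independent of the past, so on this event
  the second moment of the final sum is at least that of the sum stopped at
  \<open>k\<close>.\<close>

lemma kolmogorov_maximal:
  assumes c: "c > 0"
  shows "prob {\<omega>\<in>space M. \<exists>k\<le>n. c \<le> \<bar>\<Sum>i<k. \<xi> i \<omega>\<bar>} \<le> (\<Sum>i<n. expectation (\<lambda>\<omega>. (\<xi> i \<omega>)\<^sup>2)) / c\<^sup>2"
proof -
  define S where "S k \<omega> = (\<Sum>i<k. \<xi> i \<omega>)" for k \<omega>
  have rvS [measurable]: "S k \<in> borel_measurable M" for k unfolding S_def[abs_def] by (rule rv_sum_\<xi>)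
  have sqS: "integrable M (\<lambda>\<omega>. (S k \<omega>)\<^sup>2)" for k unfolding S_def by (rule integrable_sum_square) simp
  define C where "C k = {\<omega>\<in>space M. c \<le> \<bar>S k \<omega>\<bar> \<and> (\<forall>j<k. \<bar>S j \<omega>\<bar> < c)}" for k
  have C [measurable]: "C k \<in> sets M" for k unfolding C_def by measurable
  have disj: "disjoint_family_on C {..n}"
    unfolding disjoint_family_on_def C_def by (auto simp: not_less) (metis linorder_neqE_nat not_less)
  have union: "{\<omega>\<in>space M. \<exists>k\<le>n. c \<le> \<bar>\<Sum>i<k. \<xi> i \<omega>\<bar>} = (\<Union>k\<in>{..n}. C k)"
  proof (intro equalityI subsetI)
    fix \<omega> assume "\<omega> \<in> {\<omega>\<in>space M. \<exists>k\<le>n. c \<le> \<bar>\<Sum>i<k. \<xi> i \<omega>\<bar>}"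
    then obtain k where k: "\<omega> \<in> space M" "k \<le> n" "c \<le> \<bar>S k \<omega>\<bar>" by (auto simp: S_def)
    define l where "l = (LEAST l. c \<le> \<bar>S l \<omega>\<bar>)"
    have 1: "c \<le> \<bar>S l \<omega>\<bar>" unfolding l_def by (rule LeastI[of _ k]) (rule k(3))
    have 2: "l \<le> k" unfolding l_def by (rule Least_le) (rule k(3))
    have 3: "\<bar>S j \<omega>\<bar> < c" if "j < l" for j
      using not_less_Least[of j "\<lambda>l. c \<le> \<bar>S l \<omega>\<bar>"] that by (simp add: l_def not_le)
    have "\<omega> \<in> C l" "l \<le> n" using k(1,2) 1 2 3 by (auto simp: C_def)
    then show "\<omega> \<in> (\<Union>k\<in>{..n}. C k)" by blast
  qed (auto simp: C_def S_def)
  have each: "c\<^sup>2 * prob (C k) \<le> expectation (\<lambda>\<omega>. (S n \<omega>)\<^sup>2 * indicator (C k) \<omega>)" if k: "k \<le> n" for k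
  proof -
    define R where "R \<omega> = (\<Sum>i\<in>{k..<n}. \<xi> i \<omega>)" for \<omega>
    have split: "S n \<omega> = S k \<omega> + R \<omega>" for \<omega>
      unfolding S_def R_def using k
      by (metis atLeast0LessThan le0 sum.atLeastLessThan_concat)
    \<comment> \<open>\<open>S k\<close> times the indicator of \<open>C k\<close>, written as a
      function of the first \<open>k\<close> variables only, to expose its independence from
      \<open>R\<close>.\<close>
    define F where "F x = (if c \<le> \<bar>\<Sum>i<k. x i\<bar> \<and> (\<forall>j<k. \<bar>\<Sum>i<j. x i\<bar> < c) then \<Sum>i<k. x i else 0)" for x :: "nat \<Rightarrow> real"
    have msum: "(\<lambda>x :: nat \<Rightarrow> real. \<Sum>i<j. x i) \<in> borel_measurable (PiM {..<k} (\<lambda>_. borel))" if "j \<le> k" for j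
      using borel_measurable_sum[of "{..<j}" "\<lambda>i x. x i" "PiM {..<k} (\<lambda>_. borel :: real measure)"] that
        measurable_component_singleton[of _ "{..<k}" "\<lambda>_. borel :: real measure"] by auto
    have F: "F \<in> borel_measurable (PiM {..<k} (\<lambda>_. borel))"
    proof -
      have [measurable]: "(\<lambda>x :: nat \<Rightarrow> real. \<Sum>i<k. x i) \<in> borel_measurable (PiM {..<k} (\<lambda>_. borel))" by (rule msum) simp
      have "Measurable.pred (PiM {..<k} (\<lambda>_. borel)) (\<lambda>x :: nat \<Rightarrow> real. \<forall>j\<in>{..<k}. \<bar>\<Sum>i<j. x i\<bar> < c)"
      proof (rule pred_intros_finite(3))
        fix j assume j: "j \<in> {..<k}"
        have [measurable]: "(\<lambda>x :: nat \<Rightarrow> real. \<Sum>i<j. x i) \<in> borel_measurable (PiM {..<k} (\<lambda>_. borel))"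
          by (rule msum) (use j in simp)
        show "Measurable.pred (PiM {..<k} (\<lambda>_. borel)) (\<lambda>x :: nat \<Rightarrow> real. \<bar>\<Sum>i<j. x i\<bar> < c)" by measurable
      qed simp
      then have [measurable]: "Measurable.pred (PiM {..<k} (\<lambda>_. borel)) (\<lambda>x :: nat \<Rightarrow> real. \<forall>j<k. \<bar>\<Sum>i<j. x i\<bar> < c)" by simp
      show ?thesis unfolding F_def[abs_def] by measurable
    qed
    have G: "(\<lambda>x :: nat \<Rightarrow> real. \<Sum>i\<in>{k..<n}. x i) \<in> borel_measurable (PiM {k..<n} (\<lambda>_. borel))"
      using borel_measurable_sum[of "{k..<n}" "\<lambda>i x. x i" "PiM {k..<n} (\<lambda>_. borel :: real measure)"]
        measurable_component_singleton[of _ "{k..<n}" "\<lambda>_. borel :: real measure"] by auto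
    have "indep_var borel (F \<circ> (\<lambda>\<omega>. restrict (\<lambda>i. \<xi> i \<omega>) {..<k})) borel ((\<lambda>x. \<Sum>i\<in>{k..<n}. x i) \<circ> (\<lambda>\<omega>. restrict (\<lambda>i. \<xi> i \<omega>) {k..<n}))"
      by (rule indep_var_compose[OF indep_var_restrict[OF ind] F G]) auto
    moreover have "(\<lambda>x. \<Sum>i\<in>{k..<n}. x i) \<circ> (\<lambda>\<omega>. restrict (\<lambda>i. \<xi> i \<omega>) {k..<n}) = R"
      by (auto simp: R_def fun_eq_iff)
    moreover have FF: "(F \<circ> (\<lambda>\<omega>. restrict (\<lambda>i. \<xi> i \<omega>) {..<k})) \<omega> = S k \<omega> * indicator (C k) \<omega>" if "\<omega> \<in> space M" for \<omega>
      using that by (auto simp: F_def S_def C_def indicator_def)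
    ultimately have iv: "indep_var borel (F \<circ> (\<lambda>\<omega>. restrict (\<lambda>i. \<xi> i \<omega>) {..<k})) borel R" by simp
    let ?F = "F \<circ> (\<lambda>\<omega>. restrict (\<lambda>i. \<xi> i \<omega>) {..<k})"
    have iR: "integrable M R" unfolding R_def[abs_def] using integrable_\<xi> by simp
    have iSk: "integrable M (S k)" unfolding S_def[abs_def] using integrable_\<xi> by simp
    have iF: "integrable M ?F"
    proof -
      have "integrable M (\<lambda>\<omega>. S k \<omega> * indicator (C k) \<omega>)"
        using integrable_mult_indicator[OF C iSk] by (simp add: mult.commute)
      then show ?thesis by (subst Bochner_Integration.integrable_cong[OF refl FF])
    qed
    have 0: "expectation (\<lambda>\<omega>. S k \<omega> * indicator (C k) \<omega> * R \<omega>) = 0"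
    proof -
      have "expectation (\<lambda>\<omega>. ?F \<omega> * R \<omega>) = expectation ?F * expectation R"
        by (rule indep_var_lebesgue_integral[OF iv iF iR])
      also have "expectation R = 0" unfolding R_def[abs_def] by (rule mean_sum)
      finally have "expectation (\<lambda>\<omega>. ?F \<omega> * R \<omega>) = 0" by (simp only: mult_zero_right)
      moreover have "expectation (\<lambda>\<omega>. S k \<omega> * indicator (C k) \<omega> * R \<omega>) = expectation (\<lambda>\<omega>. ?F \<omega> * R \<omega>)"
        by (rule Bochner_Integration.integral_cong[OF refl]) (simp only: FF)
      ultimately show ?thesis by (simp only:)
    qed
    have i0: "integrable M (\<lambda>\<omega>. S k \<omega> * indicator (C k) \<omega> * R \<omega>)"
      using indep_var_integrable[OF iv iF iR]
      by (subst Bochner_Integration.integrable_cong[OF refl, where g="\<lambda>\<omega>. ?F \<omega> * R \<omega>"]) (simp_all only: FF)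
    have i1: "integrable M (\<lambda>\<omega>. c\<^sup>2 * indicator (C k) \<omega>)"
      by (intro integrable_mult_right integrable_real_indicator C) (simp add: emeasure_eq_measure)
    have in1: "integrable M (\<lambda>\<omega>. (S n \<omega>)\<^sup>2 * indicator (C k) \<omega>)"
      using integrable_mult_indicator[OF C sqS[of n]] by (simp add: mult.commute)
    have "c\<^sup>2 * prob (C k) = expectation (\<lambda>\<omega>. c\<^sup>2 * indicator (C k) \<omega>)" by simp
    also have "\<dots> = expectation (\<lambda>\<omega>. c\<^sup>2 * indicator (C k) \<omega> + 2 * (S k \<omega> * indicator (C k) \<omega> * R \<omega>))"
      using i1 i0 0 by simp
    also have "\<dots> \<le> expectation (\<lambda>\<omega>. (S n \<omega>)\<^sup>2 * indicator (C k) \<omega>)"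
    proof (rule integral_mono)
      show "integrable M (\<lambda>\<omega>. c\<^sup>2 * indicator (C k) \<omega> + 2 * (S k \<omega> * indicator (C k) \<omega> * R \<omega>))"
        by (intro Bochner_Integration.integrable_add integrable_mult_right i1 i0)
      fix \<omega> assume "\<omega> \<in> space M"
      show "c\<^sup>2 * indicator (C k) \<omega> + 2 * (S k \<omega> * indicator (C k) \<omega> * R \<omega>) \<le> (S n \<omega>)\<^sup>2 * indicator (C k) \<omega>"
      proof (cases "\<omega> \<in> C k")
        case True
        then have "c\<^sup>2 \<le> \<bar>S k \<omega>\<bar>\<^sup>2" using c by (intro power_mono) (auto simp: C_def)
        moreover have "(S n \<omega>)\<^sup>2 = (S k \<omega>)\<^sup>2 + 2 * (S k \<omega> * R \<omega>) + (R \<omega>)\<^sup>2"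
          unfolding split by (simp add: power2_sum)
        moreover have "(R \<omega>)\<^sup>2 \<ge> 0" by simp
        moreover have "\<bar>S k \<omega>\<bar>\<^sup>2 = (S k \<omega>)\<^sup>2" by simp
        ultimately have "c\<^sup>2 + 2 * (S k \<omega> * R \<omega>) \<le> (S n \<omega>)\<^sup>2" by linarith
        then show ?thesis using True by simp
      qed simp
    qed (rule in1)
    finally show ?thesis .
  qed
  have in1: "integrable M (\<lambda>\<omega>. (S n \<omega>)\<^sup>2 * indicator (C k) \<omega>)" for k
    using integrable_mult_indicator[OF C sqS[of n]] by (simp add: mult.commute)
  have "c\<^sup>2 * prob (\<Union>k\<in>{..n}. C k) = (\<Sum>k\<in>{..n}. c\<^sup>2 * prob (C k))"
    using finite_measure_finite_Union[OF _ _ disj] C by (simp add: sum_distrib_left image_subset_iff)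
  also have "\<dots> \<le> (\<Sum>k\<in>{..n}. expectation (\<lambda>\<omega>. (S n \<omega>)\<^sup>2 * indicator (C k) \<omega>))"
    by (rule sum_mono) (use each in auto)
  also have "\<dots> = expectation (\<lambda>\<omega>. \<Sum>k\<in>{..n}. (S n \<omega>)\<^sup>2 * indicator (C k) \<omega>)"
    using in1 by (subst Bochner_Integration.integral_sum) auto
  also have "\<dots> \<le> expectation (\<lambda>\<omega>. (S n \<omega>)\<^sup>2)"
  proof (rule integral_mono)
    show "integrable M (\<lambda>\<omega>. \<Sum>k\<in>{..n}. (S n \<omega>)\<^sup>2 * indicator (C k) \<omega>)"
      using in1 by (intro Bochner_Integration.integrable_sum) auto
    fix \<omega>
    have "(\<Sum>k\<in>{..n}. (S n \<omega>)\<^sup>2 * indicator (C k) \<omega>) = (S n \<omega>)\<^sup>2 * (\<Sum>k\<in>{..n}. indicator (C k) \<omega>)"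
      by (simp add: sum_distrib_left)
    also have "(\<Sum>k\<in>{..n}. indicator (C k) \<omega>) = (indicator (\<Union>k\<in>{..n}. C k) \<omega> :: real)"
      by (rule indicator_UN_disjoint[OF _ disj, symmetric]) simp
    also have "(S n \<omega>)\<^sup>2 * indicator (\<Union>k\<in>{..n}. C k) \<omega> \<le> (S n \<omega>)\<^sup>2" by (simp add: indicator_def)
    finally show "(\<Sum>k\<in>{..n}. (S n \<omega>)\<^sup>2 * indicator (C k) \<omega>) \<le> (S n \<omega>)\<^sup>2" .
  qed (rule sqS)
  also have "\<dots> = (\<Sum>i<n. expectation (\<lambda>\<omega>. (\<xi> i \<omega>)\<^sup>2))" unfolding S_def by (rule expectation_sum_square)
  finally show ?thesis unfolding union using c by (simp add: le_divide_eq mult.commute)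
qed

end

text \<open>The maximal inequality bounds the probability of a large oscillation after index
  \<open>N\<close> by the remaining variance, which tends to 0. Hence almost every path is
  Cauchy.\<close>

lemma kolmogorov_convergence:
  fixes \<xi> :: "nat \<Rightarrow> 'a \<Rightarrow> real"
  assumes ind: "indep_vars (\<lambda>_. borel) \<xi> UNIV"
    and sq: "\<And>i. integrable M (\<lambda>\<omega>. (\<xi> i \<omega>)\<^sup>2)"
    and mean: "\<And>i. expectation (\<xi> i) = 0"
    and summ: "summable (\<lambda>i. expectation (\<lambda>\<omega>. (\<xi> i \<omega>)\<^sup>2))"
  shows "AE \<omega> in M. convergent (\<lambda>n. \<Sum>i<n. \<xi> i \<omega>)"
proof -
  have [measurable]: "\<xi> i \<in> borel_measurable M" for i using ind by (auto simp: indep_vars_def)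
  define v where "v i = expectation (\<lambda>\<omega>. (\<xi> i \<omega>)\<^sup>2)" for i
  have v0: "v i \<ge> 0" for i by (simp add: v_def)
  have small: "AE \<omega> in M. \<exists>N. \<forall>k. \<bar>\<Sum>i<k. \<xi> (i + N) \<omega>\<bar> < e" if e: "e > 0" for e
  proof -
    define D where "D N n = {\<omega>\<in>space M. \<exists>k\<le>n. e \<le> \<bar>\<Sum>i<k. \<xi> (i + N) \<omega>\<bar>}" for N n
    define E where "E N = {\<omega>\<in>space M. \<exists>k. e \<le> \<bar>\<Sum>i<k. \<xi> (i + N) \<omega>\<bar>}" for N
    have Dm: "D N n \<in> sets M" for N n unfolding D_def by measurable
    have Em: "E N \<in> sets M" for N unfolding E_def by measurable
    have D: "prob (D N n) \<le> (\<Sum>i. v (i + N)) / e\<^sup>2" for N n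
    proof -
      have "indep_vars (\<lambda>_. borel) (\<lambda>i. \<xi> (i + N)) UNIV"
        by (rule indep_vars_reindex_inj[OF ind]) (simp add: inj_def)
      from kolmogorov_maximal[OF this sq mean e, of n]
      have "prob (D N n) \<le> (\<Sum>i<n. v (i + N)) / e\<^sup>2" by (simp add: D_def v_def)
      also have "\<dots> \<le> (\<Sum>i. v (i + N)) / e\<^sup>2"
        using summ v0 by (intro divide_right_mono sum_le_suminf) (auto simp: v_def[symmetric] summable_iff_shift)
      finally show ?thesis .
    qed
    \<comment> \<open>The bound for \<open>D N n\<close> is uniform in \<open>n\<close>, so it
      passes to the increasing union over \<open>n\<close>.\<close>
    have E: "prob (E N) \<le> (\<Sum>i. v (i + N)) / e\<^sup>2" for N
    proof (rule LIMSEQ_le_const2)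
      show "(\<lambda>n. prob (D N n)) \<longlonglongrightarrow> prob (E N)"
      proof -
        have "(\<lambda>n. prob (D N n)) \<longlonglongrightarrow> prob (\<Union>n. D N n)"
          by (rule finite_Lim_measure_incseq) (use Dm in \<open>auto simp: incseq_def D_def intro: order_trans\<close>)
        also have "(\<Union>n. D N n) = E N" by (auto simp: D_def E_def)
        finally show ?thesis .
      qed
    qed (use D in auto)
    have "summable v" using summ by (simp add: v_def[abs_def])
    then have "(\<lambda>N. (\<Sum>i. v (i + N)) / e\<^sup>2) \<longlonglongrightarrow> 0 / e\<^sup>2"
      by (intro tendsto_divide tendsto_const suminf_exist_split2) (use e in auto)
    moreover have "prob (\<Inter>N. E N) \<le> (\<Sum>i. v (i + N)) / e\<^sup>2" for N
      using E[of N] finite_measure_mono[of "\<Inter>N. E N" "E N"] Em by (auto intro: order_trans)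
    ultimately have "prob (\<Inter>N. E N) \<le> 0" by (intro LIMSEQ_le_const) auto
    then have "prob (\<Inter>N. E N) = 0" using measure_nonneg[of M "\<Inter>N. E N"] by linarith
    then have "(\<Inter>N. E N) \<in> null_sets M"
      using Em by (auto simp: null_sets_def emeasure_eq_measure)
    from AE_not_in[OF this] show ?thesis
      by (rule AE_mp) (auto simp: E_def not_le intro!: AE_I2)
  qed
  have "AE \<omega> in M. \<forall>j::nat. \<exists>N. \<forall>k. \<bar>\<Sum>i<k. \<xi> (i + N) \<omega>\<bar> < 1 / real (Suc j)"
    unfolding AE_all_countable by (intro allI small) simp
  then show ?thesis
  proof (rule AE_mp, intro AE_I2 impI)
    fix \<omega> assume *: "\<forall>j::nat. \<exists>N. \<forall>k. \<bar>\<Sum>i<k. \<xi> (i + N) \<omega>\<bar> < 1 / real (Suc j)"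
    have "Cauchy (\<lambda>n. \<Sum>i<n. \<xi> i \<omega>)"
    proof (rule metric_CauchyI)
      fix r :: real assume "r > 0"
      then obtain j where j: "1 / real (Suc j) < r / 2" using nat_approx_posE[of "r/2"] by auto
      obtain N where N: "\<And>k. \<bar>\<Sum>i<k. \<xi> (i + N) \<omega>\<bar> < 1 / real (Suc j)" using * by blast
      have tail: "\<bar>(\<Sum>i<m. \<xi> i \<omega>) - (\<Sum>i<N. \<xi> i \<omega>)\<bar> < r / 2" if "m \<ge> N" for m
      proof -
        have "(\<Sum>i<N + k. \<xi> i \<omega>) = (\<Sum>i<N. \<xi> i \<omega>) + (\<Sum>i<k. \<xi> (i + N) \<omega>)" for k
          by (induction k) (simp_all add: add.commute)
        from this[of "m - N"] have "(\<Sum>i<m. \<xi> i \<omega>) = (\<Sum>i<N. \<xi> i \<omega>) + (\<Sum>i<m - N. \<xi> (i + N) \<omega>)"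
          using that by simp
        then show ?thesis using N[of "m - N"] j by simp
      qed
      show "\<exists>M. \<forall>m\<ge>M. \<forall>n\<ge>M. dist (\<Sum>i<m. \<xi> i \<omega>) (\<Sum>i<n. \<xi> i \<omega>) < r"
        using tail by (intro exI[of _ N] allI impI) (smt (verit) dist_real_def field_sum_of_halves)
    qed
    then show "convergent (\<lambda>n. \<Sum>i<n. \<xi> i \<omega>)" by (rule Cauchy_convergent)
  qed
qed

end

section \<open>Gaussian moving averages and their truncations\<close>

definition trunc :: "nat \<Rightarrow> (int \<Rightarrow> real) \<Rightarrow> int \<Rightarrow> real" where
  "trunc N a m = (if \<bar>m\<bar> \<le> int N then a m else 0)"

lemma finite_range_trunc: "finite_range (int N) (trunc N a)"
  by unfold_locales (auto simp: trunc_def)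

locale iid_normal = prob_space M for M :: "'a measure" +
  fixes X :: "int \<Rightarrow> 'a \<Rightarrow> real"
  assumes indep: "indep_vars (\<lambda>_. borel) X UNIV"
    and gauss: "\<And>j. distributed M lborel (X j) (\<lambda>x. ennreal (std_normal_density x))"
begin

lemma rv_X [measurable]: "X j \<in> borel_measurable M"
  using indep by (auto simp: indep_vars_def)

lemma distr_X: "distr M borel (X j) = std_normal_distribution"
proof -
  have "distr M borel (X j) = distr M lborel (X j)" by (rule distr_cong) auto
  also have "\<dots> = std_normal_distribution" using gauss by (rule distributed_distr_eq_density)
  finally show ?thesis .
qed

lemma joint_law:
  assumes "S \<noteq> {}"
  shows "distr M (PiM S (\<lambda>_. borel)) (\<lambda>\<omega>. \<lambda>j\<in>S. X j \<omega>) = gauss_prod S"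
proof -
  have "indep_vars (\<lambda>_. borel) X S" by (rule indep_vars_subset[OF indep]) simp
  then show ?thesis
    using indep_vars_iff_distr_eq_PiM[where M'="\<lambda>_. borel" and X=X and I=S, OF assms] by (simp add: distr_X)
qed

lemma expectation_gauss_prod:
  assumes "S \<noteq> {}" "g \<in> borel_measurable (PiM S (\<lambda>_. borel))"
  shows "expectation (\<lambda>\<omega>. g (\<lambda>j\<in>S. X j \<omega>)) = integral\<^sup>L (gauss_prod S) (g :: _ \<Rightarrow> real)"
  unfolding joint_law[OF assms(1), symmetric]
  by (rule integral_distr[symmetric]) (use assms in measurable)

lemma laplace_linear_forms:
  assumes "finite S" "finite I" "S \<noteq> {}"
  shows "expectation (\<lambda>\<omega>. exp (- (\<Sum>i\<in>I. (\<Sum>j\<in>S. X j \<omega> * v i j)\<^sup>2) / 2)) = gauss_int I S v"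
proof -
  let ?g = "\<lambda>x. exp (- (\<Sum>i\<in>I. (\<Sum>j\<in>S. x j * v i j)\<^sup>2) / 2)"
  have [measurable]: "(\<lambda>x. x j) \<in> borel_measurable (PiM S (\<lambda>_. borel :: real measure))" if "j \<in> S" for j
    using measurable_component_singleton[OF that, of "\<lambda>_. borel :: real measure"] .
  have "?g \<in> borel_measurable (PiM S (\<lambda>_. borel))" by measurable
  from expectation_gauss_prod[OF assms(3) this]
  have "expectation (\<lambda>\<omega>. exp (- (\<Sum>i\<in>I. (\<Sum>j\<in>S. X j \<omega> * v i j)\<^sup>2) / 2)) = gauss_int S I (\<lambda>j i. v i j)"
    unfolding gauss_int_def by (simp cong: sum.cong)
  \<comment> \<open>The expectation integrates over the columns \<open>j\<close>; duality returns
    the form in which the rows \<open>i\<close> come first.\<close>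
  then show ?thesis using gauss_int_dual[OF assms(2,1)] by simp
qed

lemma expectation_X: "expectation (X j) = 0" and expectation_X2: "expectation (\<lambda>\<omega>. (X j \<omega>)\<^sup>2) = 1"
  and integrable_X2: "integrable M (\<lambda>\<omega>. (X j \<omega>)\<^sup>2)"
proof -
  have X2: "integrable std_normal_distribution (\<lambda>x. x\<^sup>2)" "(\<integral>x. x\<^sup>2 \<partial>std_normal_distribution) = 1"
    using std_normal_distribution_even_moments[of 1] by auto
  have *: "expectation (\<lambda>\<omega>. g (X j \<omega>)) = (\<integral>x. g x \<partial>std_normal_distribution)" if "g \<in> borel_measurable borel" for g :: "real \<Rightarrow> real"
    unfolding distr_X[of j, symmetric] by (rule integral_distr[symmetric]) (use that in measurable)
  show "expectation (\<lambda>\<omega>. (X j \<omega>)\<^sup>2) = 1" using *[of "\<lambda>x. x\<^sup>2"] X2(2) by simp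
  show "integrable M (\<lambda>\<omega>. (X j \<omega>)\<^sup>2)"
    using X2(1) integrable_distr_eq[of "X j" M borel "\<lambda>x. x\<^sup>2"] by (simp add: distr_X)
  have "(\<integral>x. x \<partial>std_normal_distribution) = - (\<integral>x. x \<partial>std_normal_distribution)"
    using std_normal_flip[of "\<lambda>x. x"] by simp
  then show "expectation (X j) = 0" using *[of "\<lambda>x. x"] by simp
qed

lemma AE_convergent_linear:
  fixes c :: "nat \<Rightarrow> real" and \<sigma> :: "nat \<Rightarrow> int"
  assumes c: "summable (\<lambda>i. (c i)\<^sup>2)" and \<sigma>: "inj \<sigma>"
  shows "AE \<omega> in M. convergent (\<lambda>n. \<Sum>i<n. c i * X (\<sigma> i) \<omega>)"
proof (rule kolmogorov_convergence)
  show "indep_vars (\<lambda>_. borel) (\<lambda>i \<omega>. c i * X (\<sigma> i) \<omega>) UNIV"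
  proof -
    have "indep_vars (\<lambda>_. borel) (\<lambda>i. X (\<sigma> i)) UNIV"
      by (rule indep_vars_reindex_inj[OF indep \<sigma>])
    from indep_vars_compose2[OF this, of "\<lambda>i x. c i * x" "\<lambda>_. borel"] show ?thesis by simp
  qed
  show "integrable M (\<lambda>\<omega>. (c i * X (\<sigma> i) \<omega>)\<^sup>2)" for i
    using integrable_X2 by (simp add: power_mult_distrib)
  show "expectation (\<lambda>\<omega>. c i * X (\<sigma> i) \<omega>) = 0" for i
    using expectation_X by simp
  show "summable (\<lambda>i. expectation (\<lambda>\<omega>. (c i * X (\<sigma> i) \<omega>)\<^sup>2))"
    using c by (simp add: power_mult_distrib expectation_X2)
qed

end

locale ma_process = iid_normal M X for M :: "'a measure" and X +
  fixes a :: "int \<Rightarrow> real"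
  assumes a_l2: "(\<lambda>m. (a m)\<^sup>2) summable_on UNIV"
begin

text \<open>The variance that truncation at \<open>N\<close> removes from each
  \<open>U_k\<close>.\<close>

definition tail_energy :: "nat \<Rightarrow> real" where
  "tail_energy N = infsum (\<lambda>m. (a m)\<^sup>2) {m. \<bar>m\<bar> > int N}"

lemma summable_tail: "(\<lambda>m. (a m)\<^sup>2) summable_on A"
  by (rule summable_on_subset_banach[OF a_l2]) simp

lemma tail_energy_nonneg: "tail_energy N \<ge> 0"
  unfolding tail_energy_def by (rule infsum_nonneg) simp

lemma tail_energy_ge:
  assumes "finite F" "\<And>m. m \<in> F \<Longrightarrow> \<bar>m\<bar> > int N"
  shows "(\<Sum>m\<in>F. (a m)\<^sup>2) \<le> tail_energy N"
  unfolding tail_energy_def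
  by (rule finite_sum_le_infsum[OF summable_tail]) (use assms in auto)

lemma tail_energy_tendsto: "tail_energy \<longlonglongrightarrow> 0"
proof (rule LIMSEQ_I)
  fix r :: real assume r: "r > 0"
  have "(sum (\<lambda>m. (a m)\<^sup>2) \<longlongrightarrow> infsum (\<lambda>m. (a m)\<^sup>2) UNIV) (finite_subsets_at_top UNIV)"
    by (rule has_sum_infsum[OF a_l2, unfolded has_sum_def])
  from tendstoD[OF this r] obtain F where F: "finite F"
    "\<forall>G. finite G \<and> F \<subseteq> G \<and> G \<subseteq> UNIV \<longrightarrow> dist (\<Sum>m\<in>G. (a m)\<^sup>2) (infsum (\<lambda>m. (a m)\<^sup>2) UNIV) < r"
    unfolding eventually_finite_subsets_at_top by blast
  obtain N0 where N0: "F \<subseteq> {- int N0..int N0}" by (rule finite_int_bounded[OF F(1)])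
  show "\<exists>no. \<forall>n\<ge>no. norm (tail_energy n - 0) < r"
  proof (intro exI[of _ N0] allI impI)
    fix n assume n: "n \<ge> N0"
    let ?G = "{- int n..int n}"
    have "F \<subseteq> ?G" using N0 n by auto
    then have 1: "dist (\<Sum>m\<in>?G. (a m)\<^sup>2) (infsum (\<lambda>m. (a m)\<^sup>2) UNIV) < r" using F(2) by simp
    have "infsum (\<lambda>m. (a m)\<^sup>2) (?G \<union> {m. \<bar>m\<bar> > int n}) = infsum (\<lambda>m. (a m)\<^sup>2) ?G + tail_energy n"
      unfolding tail_energy_def by (rule infsum_Un_disjoint[OF summable_tail summable_tail]) auto
    moreover have "?G \<union> {m. \<bar>m\<bar> > int n} = UNIV" by auto
    ultimately have "infsum (\<lambda>m. (a m)\<^sup>2) UNIV = (\<Sum>m\<in>?G. (a m)\<^sup>2) + tail_energy n" by simp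
    then show "norm (tail_energy n - 0) < r" using 1 by (simp add: dist_real_def)
  qed
qed

lemma summable_one_sided:
  assumes "inj (\<sigma> :: nat \<Rightarrow> int)"
  shows "summable (\<lambda>i. (a (\<sigma> i))\<^sup>2)"
proof -
  have "(\<lambda>m. (a m)\<^sup>2) summable_on range \<sigma>" by (rule summable_tail)
  then have "((\<lambda>m. (a m)\<^sup>2) \<circ> \<sigma>) summable_on UNIV" using summable_on_reindex[OF assms] by blast
  then show ?thesis using summable_on_imp_summable by (force simp: comp_def)
qed

lemma AE_convergent_ma: "AE \<omega> in M. convergent (ma_partial a X k \<omega>)"
proof -
  have "AE \<omega> in M. convergent (\<lambda>n. \<Sum>i<n. a (int i) * X (k - int i) \<omega>)"
    by (rule AE_convergent_linear) (auto intro!: summable_one_sided simp: inj_def)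
  moreover have "AE \<omega> in M. convergent (\<lambda>n. \<Sum>i<n. a (- int i - 1) * X (k + int i + 1) \<omega>)"
    by (rule AE_convergent_linear[where \<sigma>="\<lambda>i. k + int i + 1"]) (auto intro!: summable_one_sided simp: inj_def)
  ultimately show ?thesis
  proof eventually_elim
    case (elim \<omega>)
    \<comment> \<open>A symmetric partial sum gains two terms per step. Splitting by the sign of
      \<open>m\<close> gives two ordinary series; the nonnegative one has the extra term
      \<open>m = 0\<close>.\<close>
    have eq: "ma_partial a X k \<omega> N = (\<Sum>i<Suc N. a (int i) * X (k - int i) \<omega>) + (\<Sum>i<N. a (- int i - 1) * X (k + int i + 1) \<omega>)" for N
    proof -
      have "{- int N..int N} = int ` {..<Suc N} \<union> (\<lambda>i. - int i - 1) ` {..<N}"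
      proof (intro equalityI subsetI)
        fix m assume m: "m \<in> {- int N..int N}"
        have "m = int (nat m) \<and> nat m < Suc N \<or> m = - int (nat (- m - 1)) - 1 \<and> nat (- m - 1) < N"
          using m by auto
        then show "m \<in> int ` {..<Suc N} \<union> (\<lambda>i. - int i - 1) ` {..<N}" by blast
      qed auto
      moreover have "int ` {..<Suc N} \<inter> (\<lambda>i. - int i - 1) ` {..<N} = {}" by auto
      ultimately show ?thesis unfolding ma_partial_def
        by (simp only:) (subst sum.union_disjoint, auto simp: sum.reindex inj_on_def algebra_simps)
    qed
    from elim(1) have "convergent (\<lambda>N. \<Sum>i<Suc N. a (int i) * X (k - int i) \<omega>)"
      using convergent_Suc_iff[of "\<lambda>n. \<Sum>i<n. a (int i) * X (k - int i) \<omega>"] by simp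
    from convergent_add[OF this elim(2)] show ?case unfolding eq[abs_def] .
  qed
qed

lemma AE_ma_tendsto: "AE \<omega> in M. \<forall>k. ma_partial a X k \<omega> \<longlonglongrightarrow> ma_U a X k \<omega>"
proof -
  have "AE \<omega> in M. \<forall>k. convergent (ma_partial a X k \<omega>)"
    unfolding AE_all_countable using AE_convergent_ma by blast
  then show ?thesis
    by (rule AE_mp) (auto intro!: AE_I2 simp: ma_U_def convergent_LIMSEQ_iff)
qed

lemma rv_ma_partial [measurable]: "(\<lambda>\<omega>. ma_partial a X k \<omega> N) \<in> borel_measurable M"
  unfolding ma_partial_def by measurable

lemma rv_ma_U [measurable]: "(\<lambda>\<omega>. ma_U a X k \<omega>) \<in> borel_measurable M"
proof -
  have "{\<omega>\<in>space M. convergent (ma_partial a X k \<omega>)} \<in> sets M"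
    using sets_Collect_Cauchy[of "\<lambda>N \<omega>. ma_partial a X k \<omega> N" M] by (simp add: Cauchy_convergent_iff)
  moreover have "(\<lambda>\<omega>. lim (ma_partial a X k \<omega>)) \<in> borel_measurable M"
    using borel_measurable_lim_metric[of "\<lambda>N \<omega>. ma_partial a X k \<omega> N" M] by simp
  ultimately show ?thesis unfolding ma_U_def by (intro measurable_If) auto
qed

definition full_phi :: "(int \<Rightarrow> real) \<Rightarrow> int set \<Rightarrow> real" where
  "full_phi s I = - ln (expectation (\<lambda>\<omega>. exp (- (\<Sum>k\<in>I. (s k)\<^sup>2 * (ma_U a X k \<omega>)\<^sup>2) / 2)))"

lemma ma_partial_eq:
  assumes "finite S" "{k - int N..k + int N} \<subseteq> S"
  shows "ma_partial a X k \<omega> N = (\<Sum>j\<in>S. X j \<omega> * trunc N a (k - j))"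
proof -
  have "(\<Sum>j\<in>S. X j \<omega> * trunc N a (k - j)) = (\<Sum>j\<in>{k - int N..k + int N}. X j \<omega> * trunc N a (k - j))"
    by (rule sum.mono_neutral_right) (use assms in \<open>auto simp: trunc_def\<close>)
  also have "\<dots> = (\<Sum>m\<in>{- int N..int N}. a m * X (k - m) \<omega>)"
    by (rule sum.reindex_bij_witness[where i="\<lambda>m. k - m" and j="\<lambda>j. k - j"]) (auto simp: trunc_def)
  finally show ?thesis by (simp add: ma_partial_def)
qed

text \<open>A symmetric partial sum is itself a moving average of finite range, with coefficients
  \<open>trunc N a\<close>, so the matrix functional applies to it exactly.\<close>

lemma laplace_ma_partial:
  assumes I: "finite I"
  shows "expectation (\<lambda>\<omega>. exp (- (\<Sum>k\<in>I. (s k)\<^sup>2 * (ma_partial a X k \<omega> N)\<^sup>2) / 2)) = exp (- band_phi (int N) (trunc N a) s I)"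
proof (cases "I = {}")
  case True
  then show ?thesis by (simp add: band_phi_def prob_space)
next
  case False
  let ?S = "\<Union>k\<in>I. {k - int N..k + int N}"
  have S: "finite ?S" "?S \<noteq> {}" using I False by auto
  have "(\<Sum>k\<in>I. (s k)\<^sup>2 * (ma_partial a X k \<omega> N)\<^sup>2) = (\<Sum>k\<in>I. (\<Sum>j\<in>?S. X j \<omega> * (s k * trunc N a (k - j)))\<^sup>2)" for \<omega>
  proof (rule sum.cong[OF refl])
    fix k assume k: "k \<in> I"
    have "(\<Sum>j\<in>?S. X j \<omega> * (s k * trunc N a (k - j))) = s k * ma_partial a X k \<omega> N"
      by (subst ma_partial_eq[OF S(1), of k]) (use k in \<open>auto simp: sum_distrib_left mult_ac\<close>)
    then show "(s k)\<^sup>2 * (ma_partial a X k \<omega> N)\<^sup>2 = (\<Sum>j\<in>?S. X j \<omega> * (s k * trunc N a (k - j)))\<^sup>2"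
      by (simp add: power_mult_distrib)
  qed
  then have "expectation (\<lambda>\<omega>. exp (- (\<Sum>k\<in>I. (s k)\<^sup>2 * (ma_partial a X k \<omega> N)\<^sup>2) / 2))
      = gauss_int I ?S (\<lambda>k j. s k * trunc N a (k - j))"
    using laplace_linear_forms[OF S(1) I S(2)] by simp
  then show ?thesis by (simp add: band_phi_def gauss_phi_def exp_minus gauss_int_pos)
qed

lemma laplace_tendsto:
  assumes I: "finite I"
  shows "(\<lambda>N. exp (- band_phi (int N) (trunc N a) s I)) \<longlonglongrightarrow>
    expectation (\<lambda>\<omega>. exp (- (\<Sum>k\<in>I. (s k)\<^sup>2 * (ma_U a X k \<omega>)\<^sup>2) / 2))"
  unfolding laplace_ma_partial[OF I, symmetric]
proof (rule integral_dominated_convergence[where w="\<lambda>_. 1"])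
  show "AE \<omega> in M. (\<lambda>N. exp (- (\<Sum>k\<in>I. (s k)\<^sup>2 * (ma_partial a X k \<omega> N)\<^sup>2) / 2)) \<longlonglongrightarrow>
      exp (- (\<Sum>k\<in>I. (s k)\<^sup>2 * (ma_U a X k \<omega>)\<^sup>2) / 2)"
    using AE_ma_tendsto
  proof eventually_elim
    case (elim \<omega>)
    then show ?case by (intro tendsto_intros) auto
  qed
qed (auto simp: sum_nonneg)

lemma expectation_pos:
  fixes f :: "'a \<Rightarrow> real"
  assumes "f \<in> borel_measurable M" "\<And>\<omega>. 0 < f \<omega>" "\<And>\<omega>. f \<omega> \<le> 1"
  shows "0 < expectation f"
proof -
  have int: "integrable M f"
    by (rule integrable_bounded_prob[where B=1]) (use assms in \<open>auto intro: prob_space_axioms simp: abs_of_pos\<close>)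
  have "expectation f \<noteq> 0"
    using integral_nonneg_eq_0_iff_AE[OF int] assms(2) AE_False by (auto simp: less_imp_le less_imp_neq[symmetric])
  moreover have "0 \<le> expectation f" by (rule Bochner_Integration.integral_nonneg) (simp add: less_imp_le assms(2))
  ultimately show ?thesis by simp
qed

lemma band_phi_tendsto:
  assumes I: "finite I"
  shows "(\<lambda>N. band_phi (int N) (trunc N a) s I) \<longlonglongrightarrow> full_phi s I"
proof -
  have pos: "0 < expectation (\<lambda>\<omega>. exp (- (\<Sum>k\<in>I. (s k)\<^sup>2 * (ma_U a X k \<omega>)\<^sup>2) / 2))"
    by (rule expectation_pos) (auto simp: sum_nonneg)
  have "(\<lambda>N. - ln (exp (- band_phi (int N) (trunc N a) s I))) \<longlonglongrightarrow> full_phi s I"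
    unfolding full_phi_def by (intro tendsto_minus tendsto_ln laplace_tendsto I) (use pos in simp)
  then show ?thesis by simp
qed

text \<open>The difference of two truncations is a moving average of small energy, so each bound is an
  instance of \<open>gauss_phi_perturb\<close>.\<close>
lemma band_phi_compare:
  assumes I: "finite I" and LN: "L \<le> N" and \<delta>: "\<delta> > 0"
  shows "band_phi (int N) (trunc N a) s I \<le> band_phi (int L) (trunc L a) (\<lambda>k. sqrt (1 + \<delta>) * s k) I
      + (\<Sum>k\<in>I. ln (1 + (1 + 1 / \<delta>) * ((s k)\<^sup>2 * tail_energy L)) / 2)" (is ?A)
    and "band_phi (int L) (trunc L a) s I \<le> band_phi (int N) (trunc N a) (\<lambda>k. sqrt (1 + \<delta>) * s k) I
      + (\<Sum>k\<in>I. ln (1 + (1 + 1 / \<delta>) * ((s k)\<^sup>2 * tail_energy L)) / 2)" (is ?B)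
proof -
  interpret N: finite_range "int N" "trunc N a" by (rule finite_range_trunc)
  interpret L: finite_range "int L" "trunc L a" by (rule finite_range_trunc)
  let ?S = "\<Union>k\<in>I. {k - int N..k + int N}"
  have S: "finite ?S" using I by auto
  define w where "w m = trunc N a m - trunc L a m" for m
  have phiN: "band_phi (int N) (trunc N a) s I = gauss_phi I ?S (\<lambda>k j. s k * trunc N a (k - j))" for s
    by (simp add: band_phi_def)
  have phiL: "band_phi (int L) (trunc L a) s I = gauss_phi I ?S (\<lambda>k j. s k * trunc L a (k - j))" for s
    by (rule L.bphi_eq[OF S]) (use LN in auto)
  have tail: "(\<Sum>j\<in>?S. (s k * w (k - j))\<^sup>2) \<le> (s k)\<^sup>2 * tail_energy L" for k
  proof -
    have "(\<Sum>j\<in>?S. (w (k - j))\<^sup>2) = (\<Sum>m\<in>(\<lambda>j. k - j) ` ?S. (w m)\<^sup>2)"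
      by (simp add: sum.reindex inj_on_def)
    also have "\<dots> = (\<Sum>m\<in>{m\<in>(\<lambda>j. k - j) ` ?S. \<bar>m\<bar> > int L}. (w m)\<^sup>2)"
      using S LN by (intro sum.mono_neutral_right) (auto simp: w_def trunc_def)
    also have "\<dots> \<le> (\<Sum>m\<in>{m\<in>(\<lambda>j. k - j) ` ?S. \<bar>m\<bar> > int L}. (a m)\<^sup>2)"
      by (rule sum_mono) (auto simp: w_def trunc_def)
    also have "\<dots> \<le> tail_energy L" by (rule tail_energy_ge) (use S in auto)
    finally show ?thesis
      by (simp add: power_mult_distrib sum_distrib_left[symmetric] mult_left_mono)
  qed
  have err: "(\<Sum>k\<in>I. ln (1 + (1 + 1 / \<delta>) * (\<Sum>j\<in>?S. (s k * w (k - j))\<^sup>2)) / 2)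
      \<le> (\<Sum>k\<in>I. ln (1 + (1 + 1 / \<delta>) * ((s k)\<^sup>2 * tail_energy L)) / 2)"
  proof (rule sum_mono)
    fix k
    have "(1 + 1 / \<delta>) * (\<Sum>j\<in>?S. (s k * w (k - j))\<^sup>2) \<le> (1 + 1 / \<delta>) * ((s k)\<^sup>2 * tail_energy L)"
      using \<delta> by (intro mult_left_mono tail) simp
    moreover have "0 \<le> (1 + 1 / \<delta>) * (\<Sum>j\<in>?S. (s k * w (k - j))\<^sup>2)"
      using \<delta> by (intro mult_nonneg_nonneg sum_nonneg) auto
    ultimately show "ln (1 + (1 + 1 / \<delta>) * (\<Sum>j\<in>?S. (s k * w (k - j))\<^sup>2)) / 2
      \<le> ln (1 + (1 + 1 / \<delta>) * ((s k)\<^sup>2 * tail_energy L)) / 2" by simp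
  qed
  have eqN: "gauss_phi I ?S (\<lambda>k j. s k * trunc N a (k - j)) = gauss_phi I ?S (\<lambda>k j. s k * trunc L a (k - j) + s k * w (k - j))"
    by (rule gauss_phi_cong) (simp add: w_def algebra_simps)
  have eqL: "gauss_phi I ?S (\<lambda>k j. s k * trunc L a (k - j)) = gauss_phi I ?S (\<lambda>k j. s k * trunc N a (k - j) + (- (s k * w (k - j))))"
    by (rule gauss_phi_cong) (simp add: w_def algebra_simps)
  show ?A
    using gauss_phi_perturb[OF I S \<delta>, of "\<lambda>k j. s k * trunc L a (k - j)" "\<lambda>k j. s k * w (k - j)"] err
    unfolding phiN phiL eqN by (simp add: mult.assoc)
  show ?B
    using gauss_phi_perturb[OF I S \<delta>, of "\<lambda>k j. s k * trunc N a (k - j)" "\<lambda>k j. - (s k * w (k - j))"] err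
    unfolding phiN phiL eqL by (simp add: mult.assoc)
qed

text \<open>In \<open>band_phi_compare\<close> the error does not depend on the larger range
  \<open>N\<close>, so both bounds survive \<open>N \<rightarrow> \<infinity>\<close>.\<close>

lemma full_phi_compare:
  assumes I: "finite I" and \<delta>: "\<delta> > 0"
  shows "full_phi s I \<le> band_phi (int L) (trunc L a) (\<lambda>k. sqrt (1 + \<delta>) * s k) I
      + (\<Sum>k\<in>I. ln (1 + (1 + 1 / \<delta>) * ((s k)\<^sup>2 * tail_energy L)) / 2)"
    and "band_phi (int L) (trunc L a) s I \<le> full_phi (\<lambda>k. sqrt (1 + \<delta>) * s k) I
      + (\<Sum>k\<in>I. ln (1 + (1 + 1 / \<delta>) * ((s k)\<^sup>2 * tail_energy L)) / 2)"
proof -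
  show "full_phi s I \<le> band_phi (int L) (trunc L a) (\<lambda>k. sqrt (1 + \<delta>) * s k) I
      + (\<Sum>k\<in>I. ln (1 + (1 + 1 / \<delta>) * ((s k)\<^sup>2 * tail_energy L)) / 2)"
    by (rule LIMSEQ_le_const2[OF band_phi_tendsto[OF I]]) (use band_phi_compare(1)[OF I _ \<delta>] in blast)
  show "band_phi (int L) (trunc L a) s I \<le> full_phi (\<lambda>k. sqrt (1 + \<delta>) * s k) I
      + (\<Sum>k\<in>I. ln (1 + (1 + 1 / \<delta>) * ((s k)\<^sup>2 * tail_energy L)) / 2)"
    by (rule LIMSEQ_le_const[OF tendsto_add[OF band_phi_tendsto[OF I] tendsto_const]])
       (use band_phi_compare(2)[OF I _ \<delta>] in blast)
qed

end

section \<open>Removing the truncation\<close>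

text \<open>Split by whether \<open>u\<close> or \<open>\<theta> * y\<close> dominates. No convexity
  is involved, so exponents below and above 1 are handled together, as required for
  \<open>q = 1 / p\<close>.\<close>

lemma powr_perturb:
  fixes x y u :: real
  assumes "0 \<le> x" "0 \<le> y" "0 \<le> u" "x \<le> y + u" "\<theta> > 0" "q > 0"
  shows "x powr q \<le> (1 + \<theta>) powr q * y powr q + (1 + 1 / \<theta>) powr q * u powr q"
proof (cases "u \<le> \<theta> * y")
  case True
  then have "x powr q \<le> ((1 + \<theta>) * y) powr q"
    using assms by (intro powr_mono2) (auto simp: algebra_simps)
  also have "\<dots> = (1 + \<theta>) powr q * y powr q" using assms by (simp add: powr_mult)
  also have "\<dots> \<le> (1 + \<theta>) powr q * y powr q + (1 + 1 / \<theta>) powr q * u powr q" by simp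
  finally show ?thesis .
next
  case False
  then have "y \<le> u / \<theta>" using assms by (simp add: field_simps)
  then have "x \<le> (1 + 1 / \<theta>) * u" using assms by (simp add: algebra_simps)
  then have "x powr q \<le> ((1 + 1 / \<theta>) * u) powr q"
    using assms by (intro powr_mono2) auto
  also have "\<dots> = (1 + 1 / \<theta>) powr q * u powr q" using assms by (simp add: powr_mult)
  also have "\<dots> \<le> (1 + \<theta>) powr q * y powr q + (1 + 1 / \<theta>) powr q * u powr q" by simp
  finally show ?thesis .
qed

text \<open>Above the level \<open>s\<close> the factor \<open>u powr (q - 2)\<close> is at most
  \<open>s powr (q - 2)\<close>. A small \<open>s\<close> makes the constant term negligible, after
  which the square term is controlled by the L2 distance.\<close>

lemma powr_le_square:
  fixes u :: real
  assumes "0 \<le> u" "s > 0" "0 < q" "q < 2"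
  shows "u powr q \<le> s powr q + s powr (q - 2) * u\<^sup>2"
proof (cases "u \<le> s")
  case True
  then have "u powr q \<le> s powr q" using assms by (intro powr_mono2) auto
  then show ?thesis by (simp add: add_increasing2)
next
  case False
  then have u: "u > 0" using assms by simp
  have "u powr q = u powr (q - 2) * u\<^sup>2"
    using u by (simp add: powr_numeral[symmetric] powr_add[symmetric] del: powr_numeral)
  also have "\<dots> \<le> s powr (q - 2) * u\<^sup>2"
    using False assms by (intro mult_right_mono powr_mono2') auto
  finally show ?thesis by (simp add: add_increasing)
qed

lemma set_integrable_powr:
  fixes g :: "real \<Rightarrow> complex"
  assumes "g \<in> borel_measurable lborel" "set_integrable lborel {0..c} (\<lambda>x. (cmod (g x))\<^sup>2)" "0 < q" "q < 2"
  shows "set_integrable lborel {0..c} (\<lambda>x. cmod (g x) powr q)"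
proof (rule set_integrable_bound)
  show "set_integrable lborel {0..c} (\<lambda>x. 1 + (cmod (g x))\<^sup>2)"
    by (rule set_integral_add(1)[OF borel_integrable_atLeastAtMost' assms(2)]) (intro continuous_intros)
  show "set_borel_measurable lborel {0..c} (\<lambda>x. cmod (g x) powr q)"
    unfolding set_borel_measurable_def using assms(1) by measurable
  show "AE x in lborel. x \<in> {0..c} \<longrightarrow> norm (cmod (g x) powr q) \<le> norm (1 + (cmod (g x))\<^sup>2)"
    using powr_le_square[of "cmod (g x)" 1 q for x] assms(3,4) by (auto intro!: AE_I2)
qed

lemma set_integral_powr_perturb:
  fixes g h :: "real \<Rightarrow> complex"
  assumes g: "g \<in> borel_measurable lborel" "set_integrable lborel {0..c} (\<lambda>x. (cmod (g x))\<^sup>2)"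
    and h: "h \<in> borel_measurable lborel" "set_integrable lborel {0..c} (\<lambda>x. (cmod (h x))\<^sup>2)"
    and q: "0 < q" "q < 2" and \<theta>: "\<theta> > 0" and s: "s > 0" and c: "c \<ge> 0"
  shows "(LINT x:{0..c}|lborel. cmod (g x) powr q) \<le> (1 + \<theta>) powr q * (LINT x:{0..c}|lborel. cmod (h x) powr q)
    + (1 + 1 / \<theta>) powr q * (s powr q * c + s powr (q - 2) * (LINT x:{0..c}|lborel. (cmod (g x - h x))\<^sup>2))"
proof -
  have gh: "set_integrable lborel {0..c} (\<lambda>x. (cmod (g x - h x))\<^sup>2)"
  proof (rule set_integrable_bound)
    show "set_integrable lborel {0..c} (\<lambda>x. 2 * (cmod (g x))\<^sup>2 + 2 * (cmod (h x))\<^sup>2)"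
      by (intro set_integral_add set_integrable_mult_right) (use g h in auto)
    show "set_borel_measurable lborel {0..c} (\<lambda>x. (cmod (g x - h x))\<^sup>2)"
      unfolding set_borel_measurable_def using g(1) h(1) by measurable
    show "AE x in lborel. x \<in> {0..c} \<longrightarrow> norm ((cmod (g x - h x))\<^sup>2) \<le> norm (2 * (cmod (g x))\<^sup>2 + 2 * (cmod (h x))\<^sup>2)"
    proof (intro AE_I2 impI)
      fix x
      have "(cmod (g x - h x))\<^sup>2 \<le> (cmod (g x) + cmod (h x))\<^sup>2"
        by (intro power_mono norm_triangle_ineq4) simp
      also have "\<dots> \<le> 2 * (cmod (g x))\<^sup>2 + 2 * (cmod (h x))\<^sup>2"
        using sum_squares_bound[of "cmod (g x)" "cmod (h x)"] by (simp add: power2_sum)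
      finally show "norm ((cmod (g x - h x))\<^sup>2) \<le> norm (2 * (cmod (g x))\<^sup>2 + 2 * (cmod (h x))\<^sup>2)" by simp
    qed
  qed
  let ?A = "(1 + \<theta>) powr q" and ?B = "(1 + 1 / \<theta>) powr q"
  have i1: "set_integrable lborel {0..c} (\<lambda>x. cmod (g x) powr q)" by (rule set_integrable_powr[OF g q])
  have i2: "set_integrable lborel {0..c} (\<lambda>x. cmod (h x) powr q)" by (rule set_integrable_powr[OF h q])
  have ic: "set_integrable lborel {0..c} (\<lambda>x. s powr q)"
    by (rule borel_integrable_atLeastAtMost') (intro continuous_intros)
  have "(LINT x:{0..c}|lborel. cmod (g x) powr q) \<le>
      (LINT x:{0..c}|lborel. ?A * cmod (h x) powr q + ?B * (s powr q + s powr (q - 2) * (cmod (g x - h x))\<^sup>2))"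
  proof (rule set_integral_mono[OF i1])
    show "set_integrable lborel {0..c} (\<lambda>x. ?A * cmod (h x) powr q + ?B * (s powr q + s powr (q - 2) * (cmod (g x - h x))\<^sup>2))"
      by (intro set_integral_add set_integrable_mult_right i2 ic gh)
    fix x
    have "cmod (g x) powr q \<le> ?A * cmod (h x) powr q + ?B * cmod (g x - h x) powr q"
      using norm_triangle_ineq[of "h x" "g x - h x"] \<theta> q by (intro powr_perturb) auto
    also have "\<dots> \<le> ?A * cmod (h x) powr q + ?B * (s powr q + s powr (q - 2) * (cmod (g x - h x))\<^sup>2)"
      by (intro add_left_mono mult_left_mono powr_le_square) (use s q in auto)
    finally show "cmod (g x) powr q \<le> ?A * cmod (h x) powr q + ?B * (s powr q + s powr (q - 2) * (cmod (g x - h x))\<^sup>2)" .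
  qed
  also have "\<dots> = ?A * (LINT x:{0..c}|lborel. cmod (h x) powr q)
    + ?B * ((LINT x:{0..c}|lborel. s powr q) + s powr (q - 2) * (LINT x:{0..c}|lborel. (cmod (g x - h x))\<^sup>2))"
    using i2 ic gh by (simp add: set_integral_add set_integrable_mult_right)
  also have "(LINT x:{0..c}|lborel. s powr q) = s powr q * c"
    using c by (simp add: set_lebesgue_integral_def mult.commute)
  finally show ?thesis .
qed

text \<open>The perturbation bound is applied in both directions. The choices are made in order:
  \<theta>, then \<open>s\<close> against \<open>1 + 1 / \<theta>\<close>, then \<open>n\<close>
  against the factor \<open>s powr (q - 2)\<close> in front of the L2 distance.\<close>

lemma L2_approx_powr_tendsto:
  fixes f :: "real \<Rightarrow> complex" and g :: "nat \<Rightarrow> real \<Rightarrow> complex"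
  assumes f: "f \<in> borel_measurable lborel" "set_integrable lborel {0..c} (\<lambda>x. (cmod (f x))\<^sup>2)"
    and g: "\<And>n. g n \<in> borel_measurable lborel" "\<And>n. set_integrable lborel {0..c} (\<lambda>x. (cmod (g n x))\<^sup>2)"
    and lim: "(\<lambda>n. LINT x:{0..c}|lborel. (cmod (f x - g n x))\<^sup>2) \<longlonglongrightarrow> 0"
    and q: "0 < q" "q < 2" and c: "c \<ge> 0"
  shows "(\<lambda>n. LINT x:{0..c}|lborel. cmod (g n x) powr q) \<longlonglongrightarrow> (LINT x:{0..c}|lborel. cmod (f x) powr q)"
proof -
  define A where "A n = (LINT x:{0..c}|lborel. cmod (g n x) powr q)" for n
  define A0 where "A0 = (LINT x:{0..c}|lborel. cmod (f x) powr q)"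
  define E where "E n = (LINT x:{0..c}|lborel. (cmod (f x - g n x))\<^sup>2)" for n
  have sym: "(LINT x:{0..c}|lborel. (cmod (g n x - f x))\<^sup>2) = E n" for n
    by (simp add: E_def norm_minus_commute)
  have bound: "\<forall>\<^sub>F n in sequentially. A n < (1 + \<theta>) powr q * A0 + e \<and> A0 < (1 + \<theta>) powr q * A n + e"
    if \<theta>: "\<theta> > 0" and e: "e > 0" for \<theta> e
  proof -
    let ?B = "(1 + 1 / \<theta>) powr q"
    have "((\<lambda>s. ?B * (s powr q * c)) \<longlongrightarrow> ?B * (0 * c)) (at_right 0)"
      by (intro tendsto_intros) (use q in real_asymp)
    then obtain s where s: "?B * (s powr q * c) < e" "s > 0"
      by (rule at_right_0_obtain_less) (use e in auto)
    have "(\<lambda>n. ?B * (s powr q * c + s powr (q - 2) * E n)) \<longlonglongrightarrow> ?B * (s powr q * c + s powr (q - 2) * 0)"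
      unfolding E_def by (intro tendsto_intros lim)
    then have "\<forall>\<^sub>F n in sequentially. ?B * (s powr q * c + s powr (q - 2) * E n) < e"
      by (rule order_tendstoD) (use s in simp)
    then show ?thesis
    proof eventually_elim
      case (elim n)
      have "A n \<le> (1 + \<theta>) powr q * A0 + ?B * (s powr q * c + s powr (q - 2) * E n)"
        unfolding A_def A0_def sym[symmetric] by (rule set_integral_powr_perturb[OF g(1) g(2) f q \<theta> s(2) c])
      moreover have "A0 \<le> (1 + \<theta>) powr q * A n + ?B * (s powr q * c + s powr (q - 2) * E n)"
        unfolding A_def A0_def E_def by (rule set_integral_powr_perturb[OF f g(1) g(2) q \<theta> s(2) c])
      ultimately show ?case using elim by linarith
    qed
  qed
  have "A \<longlonglongrightarrow> A0"
  proof (rule order_tendstoI)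
    fix b assume b: "A0 < b"
    have "((\<lambda>\<theta>. (1 + \<theta>) powr q * A0 + \<theta>) \<longlongrightarrow> (1 + 0) powr q * A0 + 0) (at_right 0)"
      by (intro tendsto_intros) auto
    then obtain \<theta> where \<theta>: "(1 + \<theta>) powr q * A0 + \<theta> < b" "\<theta> > 0"
      by (rule at_right_0_obtain_less) (use b in auto)
    show "\<forall>\<^sub>F n in sequentially. A n < b"
      using bound[OF \<theta>(2) \<theta>(2)] by eventually_elim (use \<theta>(1) in simp)
  next
    fix b assume b: "b < A0"
    have "((\<lambda>\<theta>. (A0 - \<theta>) / (1 + \<theta>) powr q) \<longlongrightarrow> (A0 - 0) / (1 + 0) powr q) (at_right 0)"
      by (intro tendsto_intros) auto
    then obtain \<theta> where \<theta>: "b < (A0 - \<theta>) / (1 + \<theta>) powr q" "\<theta> > 0"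
      by (rule at_right_0_obtain_greater) (use b in auto)
    show "\<forall>\<^sub>F n in sequentially. b < A n"
      using bound[OF \<theta>(2) \<theta>(2)]
    proof eventually_elim
      case (elim n)
      have pos: "(1 + \<theta>) powr q > 0" using \<theta>(2) by simp
      have "A0 - \<theta> < A n * (1 + \<theta>) powr q" using elim by (simp add: mult.commute)
      then have "(A0 - \<theta>) / (1 + \<theta>) powr q < A n" using pos by (simp add: divide_less_eq)
      then show ?case using \<theta>(1) by simp
    qed
  qed
  then show ?thesis by (simp add: A_def[abs_def] A0_def)
qed

locale weighted_ma = ma_process M X a + weights d p dp dm
  for M :: "'a measure" and X and a and d p dp dm +
  fixes f :: "real \<Rightarrow> complex"
  assumes fourier: "is_L2_fourier_sum a f"
begin

definition f_mean :: real where
  "f_mean = (1 / (2 * pi)) * (LINT x:{0..2 * pi}|lborel. cmod (f x) powr (1 / p))"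

definition full_rate :: real where
  "full_rate = C0 / 2 * (dp powr (1 / p) + dm powr (1 / p)) * f_mean"

lemma band_weights_trunc: "band_weights (int L) (trunc L a) d p dp dm"
  using finite_range_trunc weights_axioms by (rule band_weights.intro)

definition trunc_rate :: "nat \<Rightarrow> real" where
  "trunc_rate L = band_weights.rate (int L) (trunc L a) p dp dm"

lemma trunc_rate_tendsto: "trunc_rate \<longlonglongrightarrow> full_rate"
proof -
  define g where "g L x = (\<Sum>m\<in>{- int L..int L}. complex_of_real (a m) * exp (\<i> * of_int m * of_real x))" for L :: nat and x
  have cont: "continuous_on A (g L)" for A L unfolding g_def by (intro continuous_intros)
  have sym: "finite_range.symbol (int L) (trunc L a) = g L" for L
    using finite_range.symbol_def[OF finite_range_trunc, of L a]
    by (auto simp: g_def trunc_def fun_eq_iff intro!: sum.cong)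
  have int: "set_integrable lborel {0..2 * pi} (\<lambda>x. h (g L x))" if "continuous_on UNIV h" for L and h :: "complex \<Rightarrow> real"
    by (rule borel_integrable_atLeastAtMost') (intro continuous_on_compose2[OF that cont] subset_UNIV)
  \<comment> \<open>It is \<open>p > 1/2\<close> that puts the exponent below 2, so that L2
    convergence of the partial Fourier sums controls the integrals.\<close>
  have q: "0 < 1 / p" "1 / p < 2" using p_gt by (auto simp: field_simps)
  have rate: "trunc_rate L = C0 / 2 * (dp powr (1 / p) + dm powr (1 / p)) *
      ((LINT x:{0..2 * pi}|lborel. cmod (g L x) powr (1 / p)) / (2 * pi))" for L
  proof -
    interpret bw: band_weights "int L" "trunc L a" d p dp dm by (rule band_weights_trunc)
    have "continuous_on UNIV (\<lambda>z::complex. cmod z powr (1 / p))"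
      using q by (intro continuous_on_powr' continuous_intros) auto
    from set_borel_integral_eq_integral(2)[OF int[OF this]]
    show ?thesis unfolding trunc_rate_def bw.rate_def bw.sym_mean_def sym by simp
  qed
  have "(\<lambda>L. LINT x:{0..2 * pi}|lborel. cmod (g L x) powr (1 / p)) \<longlonglongrightarrow> (LINT x:{0..2 * pi}|lborel. cmod (f x) powr (1 / p))"
  proof (rule L2_approx_powr_tendsto)
    show "f \<in> borel_measurable lborel" "set_integrable lborel {0..2 * pi} (\<lambda>x. (cmod (f x))\<^sup>2)"
      using fourier by (auto simp: is_L2_fourier_sum_def)
    show "(\<lambda>n. LINT x:{0..2*pi}|lborel. (cmod (f x - g n x))\<^sup>2) \<longlonglongrightarrow> 0"
      using fourier by (simp add: is_L2_fourier_sum_def g_def)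
    show "g n \<in> borel_measurable lborel" for n
      using borel_measurable_continuous_onI[OF cont[of UNIV n]] by simp
    show "set_integrable lborel {0..2 * pi} (\<lambda>x. (cmod (g n x))\<^sup>2)" for n
      by (rule int) (intro continuous_intros)
  qed (use q in auto)
  then have "(\<lambda>L. C0 / 2 * (dp powr (1 / p) + dm powr (1 / p)) *
      ((LINT x:{0..2 * pi}|lborel. cmod (g L x) powr (1 / p)) / (2 * pi))) \<longlonglongrightarrow>
      C0 / 2 * (dp powr (1 / p) + dm powr (1 / p)) * ((LINT x:{0..2 * pi}|lborel. cmod (f x) powr (1 / p)) / (2 * pi))"
    by (intro tendsto_intros) auto
  then show ?thesis unfolding rate[symmetric] full_rate_def f_mean_def by simp
qed

definition fphi :: "real \<Rightarrow> int set \<Rightarrow> real" where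
  "fphi t I = full_phi (\<lambda>k. sqrt t * d k) I"

text \<open>The factor \<open>sqrt (1 + \<delta>)\<close> on the weights is a rescaling of
  \<open>t\<close>, and the error is of order \<open>t powr \<beta>\<close> with a constant that
  vanishes with the tail energy.\<close>

lemma fphi_compare:
  obtains K where "K > 0"
    "\<And>L \<delta> t I. finite I \<Longrightarrow> \<delta> > 0 \<Longrightarrow> t \<ge> 0 \<Longrightarrow>
      fphi t I \<le> band_weights.tphi (int L) (trunc L a) d ((1 + \<delta>) * t) I + K * ((1 + 1 / \<delta>) * tail_energy L) powr \<beta> * t powr \<beta>"
    "\<And>L \<delta> t I. finite I \<Longrightarrow> \<delta> > 0 \<Longrightarrow> t \<ge> 0 \<Longrightarrow>
      band_weights.tphi (int L) (trunc L a) d t I \<le> fphi ((1 + \<delta>) * t) I + K * ((1 + 1 / \<delta>) * tail_energy L) powr \<beta> * t powr \<beta>"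
proof -
  obtain K where K: "K > 0" "\<And>I x. finite I \<Longrightarrow> x \<ge> 0 \<Longrightarrow> (\<Sum>k\<in>I. ln (1 + x * (d k)\<^sup>2) / 2) \<le> K * x powr \<beta>"
    using ln_weights_sum_le by blast
  have err: "(\<Sum>k\<in>I. ln (1 + (1 + 1 / \<delta>) * ((sqrt t * d k)\<^sup>2 * tail_energy L)) / 2)
      \<le> K * ((1 + 1 / \<delta>) * tail_energy L) powr \<beta> * t powr \<beta>" if "finite I" "\<delta> > 0" "t \<ge> 0" for I \<delta> t L
  proof -
    have "(\<Sum>k\<in>I. ln (1 + (1 + 1 / \<delta>) * tail_energy L * t * (d k)\<^sup>2) / 2) \<le> K * ((1 + 1 / \<delta>) * tail_energy L * t) powr \<beta>"
      by (rule K(2)) (use that tail_energy_nonneg in auto)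
    also have "\<dots> = K * ((1 + 1 / \<delta>) * tail_energy L) powr \<beta> * t powr \<beta>"
      using that tail_energy_nonneg by (simp add: powr_mult)
    finally show ?thesis using that by (simp add: power_mult_distrib mult_ac)
  qed
  have sq: "sqrt (1 + \<delta>) * (sqrt t * x) = sqrt ((1 + \<delta>) * t) * x" for \<delta> t x :: real
    by (simp add: real_sqrt_mult)
  have tp: "band_weights.tphi (int L) (trunc L a) d t I = band_phi (int L) (trunc L a) (\<lambda>k. sqrt t * d k) I" for L t I
    by (rule band_weights.tphi_def[OF band_weights_trunc])
  show thesis
  proof (rule that[OF K(1)])
    fix L :: nat and \<delta> t :: real and I :: "int set" assume *: "finite I" "\<delta> > 0" "t \<ge> 0"
    show "fphi t I \<le> band_weights.tphi (int L) (trunc L a) d ((1 + \<delta>) * t) I + K * ((1 + 1 / \<delta>) * tail_energy L) powr \<beta> * t powr \<beta>"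
      using full_phi_compare(1)[OF *(1,2), of "\<lambda>k. sqrt t * d k" L] err[OF *, of L]
      unfolding fphi_def tp sq by linarith
    show "band_weights.tphi (int L) (trunc L a) d t I \<le> fphi ((1 + \<delta>) * t) I + K * ((1 + 1 / \<delta>) * tail_energy L) powr \<beta> * t powr \<beta>"
      using full_phi_compare(2)[OF *(1,2), where s="\<lambda>k. sqrt t * d k" and L=L] err[OF *, of L]
      unfolding fphi_def tp sq by linarith
  qed
qed

lemma tail_energy_powr_tendsto:
  assumes "\<delta> > 0"
  shows "(\<lambda>L. ((1 + 1 / \<delta>) * tail_energy L) powr \<beta>) \<longlonglongrightarrow> 0"
proof -
  have "(\<lambda>L. (1 + 1 / \<delta>) * tail_energy L) \<longlonglongrightarrow> (1 + 1 / \<delta>) * 0"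
    by (intro tendsto_intros tail_energy_tendsto)
  then have "(\<lambda>L. ((1 + 1 / \<delta>) * tail_energy L) powr \<beta>) \<longlonglongrightarrow> 0 powr \<beta>"
    using \<beta> assms tail_energy_nonneg by (intro tendsto_powr') auto
  then show ?thesis by simp
qed

text \<open>First \<delta> is fixed, then \<open>L\<close> is taken so large that the tail energy
  beats \<open>1 + 1 / \<delta>\<close>, and only then does \<open>t\<close> grow.\<close>

lemma fphi_upper:
  assumes \<eta>: "\<eta> > 0"
  shows "\<forall>\<^sub>F t in at_top. \<forall>I. finite I \<longrightarrow> fphi t I \<le> (full_rate + \<eta>) * t powr \<beta>"
proof -
  obtain K where K: "\<And>L \<delta> t I. finite I \<Longrightarrow> \<delta> > 0 \<Longrightarrow> t \<ge> 0 \<Longrightarrow>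
      fphi t I \<le> band_weights.tphi (int L) (trunc L a) d ((1 + \<delta>) * t) I + K * ((1 + 1 / \<delta>) * tail_energy L) powr \<beta> * t powr \<beta>"
    using fphi_compare by metis
  have "((\<lambda>\<delta>. (full_rate + \<delta>) * (1 + \<delta>) powr \<beta>) \<longlongrightarrow> (full_rate + 0) * (1 + 0) powr \<beta>) (at_right 0)"
    by (intro tendsto_intros) auto
  then obtain \<delta> where \<delta>: "(full_rate + \<delta>) * (1 + \<delta>) powr \<beta> < full_rate + \<eta>" "\<delta> > 0"
    by (rule at_right_0_obtain_less) (use \<eta> in auto)
  from tail_energy_powr_tendsto[OF \<delta>(2)] have "(\<lambda>L. (trunc_rate L + \<delta>) * (1 + \<delta>) powr \<beta> + K * ((1 + 1 / \<delta>) * tail_energy L) powr \<beta>) \<longlonglongrightarrow>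
      (full_rate + \<delta>) * (1 + \<delta>) powr \<beta> + K * 0"
    by (intro tendsto_intros trunc_rate_tendsto)
  then have "\<forall>\<^sub>F L in sequentially. (trunc_rate L + \<delta>) * (1 + \<delta>) powr \<beta> + K * ((1 + 1 / \<delta>) * tail_energy L) powr \<beta> < full_rate + \<eta>"
    by (rule order_tendstoD) (use \<delta> in simp)
  then obtain L where L: "(trunc_rate L + \<delta>) * (1 + \<delta>) powr \<beta> + K * ((1 + 1 / \<delta>) * tail_energy L) powr \<beta> < full_rate + \<eta>"
    unfolding eventually_sequentially by blast
  interpret bw: band_weights "int L" "trunc L a" d p dp dm by (rule band_weights_trunc)
  have "filterlim (\<lambda>t. (1 + \<delta>) * t) at_top at_top" using \<delta>(2) by real_asymp
  from eventually_compose_filterlim[OF bw.tphi_upper[OF \<delta>(2)] this]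
  have "\<forall>\<^sub>F t in at_top. \<forall>I. finite I \<longrightarrow> bw.tphi ((1 + \<delta>) * t) I \<le> (trunc_rate L + \<delta>) * ((1 + \<delta>) * t) powr \<beta>"
    by (simp add: trunc_rate_def)
  then show ?thesis using eventually_gt_at_top[of 0]
  proof eventually_elim
    case (elim t)
    show ?case
    proof (intro allI impI)
      fix I :: "int set" assume I: "finite I"
      have "fphi t I \<le> bw.tphi ((1 + \<delta>) * t) I + K * ((1 + 1 / \<delta>) * tail_energy L) powr \<beta> * t powr \<beta>"
        using K[OF I \<delta>(2)] elim(2) by simp
      also have "\<dots> \<le> (trunc_rate L + \<delta>) * ((1 + \<delta>) * t) powr \<beta> + K * ((1 + 1 / \<delta>) * tail_energy L) powr \<beta> * t powr \<beta>"
        using elim(1) I by simp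
      also have "\<dots> = ((trunc_rate L + \<delta>) * (1 + \<delta>) powr \<beta> + K * ((1 + 1 / \<delta>) * tail_energy L) powr \<beta>) * t powr \<beta>"
        unfolding powr_mult[of "1 + \<delta>" t] by (simp only: distrib_right mult.assoc)
      also have "\<dots> \<le> (full_rate + \<eta>) * t powr \<beta>"
        by (rule mult_right_mono[OF less_imp_le[OF L]]) simp
      finally show "fphi t I \<le> (full_rate + \<eta>) * t powr \<beta>" .
    qed
  qed
qed

lemma fphi_lower:
  assumes \<eta>: "\<eta> > 0"
  shows "\<forall>\<^sub>F t in at_top. \<exists>I. finite I \<and> fphi t I \<ge> (full_rate - \<eta>) * t powr \<beta>"
proof -
  obtain K where K: "\<And>L \<delta> t I. finite I \<Longrightarrow> \<delta> > 0 \<Longrightarrow> t \<ge> 0 \<Longrightarrow>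
      band_weights.tphi (int L) (trunc L a) d t I \<le> fphi ((1 + \<delta>) * t) I + K * ((1 + 1 / \<delta>) * tail_energy L) powr \<beta> * t powr \<beta>"
    using fphi_compare by metis
  have "((\<lambda>\<delta>. (full_rate - \<delta>) * (1 / (1 + \<delta>)) powr \<beta>) \<longlongrightarrow> (full_rate - 0) * (1 / (1 + 0)) powr \<beta>) (at_right 0)"
    by (intro tendsto_intros) auto
  then obtain \<delta> where \<delta>: "full_rate - \<eta> < (full_rate - \<delta>) * (1 / (1 + \<delta>)) powr \<beta>" "\<delta> > 0"
    by (rule at_right_0_obtain_greater) (use \<eta> in auto)
  from tail_energy_powr_tendsto[OF \<delta>(2)] have "(\<lambda>L. (trunc_rate L - \<delta>) * (1 / (1 + \<delta>)) powr \<beta> - K * ((1 + 1 / \<delta>) * tail_energy L) powr \<beta> * (1 / (1 + \<delta>)) powr \<beta>) \<longlonglongrightarrow>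
      (full_rate - \<delta>) * (1 / (1 + \<delta>)) powr \<beta> - K * 0 * (1 / (1 + \<delta>)) powr \<beta>"
    by (intro tendsto_intros trunc_rate_tendsto)
  then have "\<forall>\<^sub>F L in sequentially. (trunc_rate L - \<delta>) * (1 / (1 + \<delta>)) powr \<beta> - K * ((1 + 1 / \<delta>) * tail_energy L) powr \<beta> * (1 / (1 + \<delta>)) powr \<beta> > full_rate - \<eta>"
    by (rule order_tendstoD) (use \<delta> in simp)
  then obtain L where L: "(trunc_rate L - \<delta>) * (1 / (1 + \<delta>)) powr \<beta> - K * ((1 + 1 / \<delta>) * tail_energy L) powr \<beta> * (1 / (1 + \<delta>)) powr \<beta> > full_rate - \<eta>"
    unfolding eventually_sequentially by blast
  interpret bw: band_weights "int L" "trunc L a" d p dp dm by (rule band_weights_trunc)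
  have "filterlim (\<lambda>t. 1 / (1 + \<delta>) * t) at_top at_top" using \<delta>(2) by real_asymp
  from eventually_compose_filterlim[OF bw.tphi_lower[OF \<delta>(2)] this]
  have "\<forall>\<^sub>F t in at_top. \<exists>I. finite I \<and> bw.tphi (1 / (1 + \<delta>) * t) I \<ge> (trunc_rate L - \<delta>) * (1 / (1 + \<delta>) * t) powr \<beta>"
    by (simp add: trunc_rate_def)
  then show ?thesis using eventually_gt_at_top[of 0]
  proof eventually_elim
    case (elim t)
    then obtain I where I: "finite I" "bw.tphi (1 / (1 + \<delta>) * t) I \<ge> (trunc_rate L - \<delta>) * (1 / (1 + \<delta>) * t) powr \<beta>" by blast
    \<comment> \<open>The comparison bounds \<open>fphi\<close> from below at
      \<open>(1 + \<delta>)\<close> times the argument of \<open>tphi\<close>, so the latter is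
      evaluated at the reduced argument.\<close>
    define t' where "t' = 1 / (1 + \<delta>) * t"
    have t': "t' \<ge> 0" "(1 + \<delta>) * t' = t" using elim(2) \<delta>(2) by (auto simp: t'_def)
    have tb: "t' powr \<beta> = (1 / (1 + \<delta>)) powr \<beta> * t powr \<beta>"
      unfolding t'_def by (rule powr_mult)
    have "(full_rate - \<eta>) * t powr \<beta> \<le> ((trunc_rate L - \<delta>) * (1 / (1 + \<delta>)) powr \<beta> - K * ((1 + 1 / \<delta>) * tail_energy L) powr \<beta> * (1 / (1 + \<delta>)) powr \<beta>) * t powr \<beta>"
      by (rule mult_right_mono[OF less_imp_le[OF L]]) simp
    also have "\<dots> = (trunc_rate L - \<delta>) * t' powr \<beta> - K * ((1 + 1 / \<delta>) * tail_energy L) powr \<beta> * t' powr \<beta>"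
      unfolding tb by (simp add: algebra_simps)
    also have "\<dots> \<le> fphi t I"
      using K[OF I(1) \<delta>(2) t'(1), of L] I(2) unfolding t'_def[symmetric] t'(2) by linarith
    finally show ?case using I(1) by blast
  qed
qed

end

section \<open>From the Laplace transform to small deviations\<close>

text \<open>Split according to \<open>T \<le> r1\<close>, \<open>r1 < T \<le> r\<close> and \<open>r < T\<close>.\<close>
lemma (in prob_space) laplace_split:
  fixes T :: "'a \<Rightarrow> ennreal"
  assumes [measurable]: "T \<in> borel_measurable M"
  defines "Y \<equiv> \<lambda>t \<omega>. if T \<omega> = \<infinity> then 0 else exp (- t * enn2real (T \<omega>) / 2)"
  assumes t: "t > 0" and \<theta>: "0 < \<theta>" "\<theta> < 1" and r: "0 \<le> r1" "0 \<le> r"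
  shows "expectation (Y t) \<le> exp (- t * r1 / 2) * prob {\<omega>\<in>space M. T \<omega> \<le> ennreal r}
      + exp (- \<theta> * t * r / 2) * expectation (Y ((1 - \<theta>) * t)) + exp (\<theta> * t * r1 / 2) * expectation (Y ((1 + \<theta>) * t))"
    and "expectation (Y t) \<ge> exp (- t * r / 2) * prob {\<omega>\<in>space M. T \<omega> \<le> ennreal r}"
proof -
  have Ym: "Y t \<in> borel_measurable M" for t unfolding Y_def by measurable
  have Y0: "0 \<le> Y t \<omega>" for t \<omega> by (simp add: Y_def)
  have iY: "integrable M (Y t)" if "t > 0" for t
    by (rule integrable_bounded_prob[where B=1]) (use that Ym in \<open>auto simp: Y_def intro: prob_space_axioms\<close>)
  let ?A = "{\<omega>\<in>space M. T \<omega> \<le> ennreal r}"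
  have A [measurable]: "?A \<in> sets M" by measurable
  have iA: "integrable M (indicator ?A :: 'a \<Rightarrow> real)"
    by (intro integrable_real_indicator A) (simp add: emeasure_eq_measure)
  have i2: "integrable M (Y ((1 - \<theta>) * t))" and i3: "integrable M (Y ((1 + \<theta>) * t))"
    using t \<theta> by (auto intro!: iY)
  have "expectation (Y t) \<le> expectation (\<lambda>\<omega>. exp (- t * r1 / 2) * indicator ?A \<omega>
      + exp (- \<theta> * t * r / 2) * Y ((1 - \<theta>) * t) \<omega> + exp (\<theta> * t * r1 / 2) * Y ((1 + \<theta>) * t) \<omega>)"
  proof (rule integral_mono[OF iY[OF t]])
    show "integrable M (\<lambda>\<omega>. exp (- t * r1 / 2) * indicator ?A \<omega>
      + exp (- \<theta> * t * r / 2) * Y ((1 - \<theta>) * t) \<omega> + exp (\<theta> * t * r1 / 2) * Y ((1 + \<theta>) * t) \<omega>)"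
      by (intro Bochner_Integration.integrable_add integrable_mult_right iA i2 i3)
    fix \<omega> assume \<omega>: "\<omega> \<in> space M"
    have nn: "0 \<le> exp (- t * r1 / 2) * indicator ?A \<omega>" "0 \<le> exp (- \<theta> * t * r / 2) * Y ((1 - \<theta>) * t) \<omega>"
      "0 \<le> exp (\<theta> * t * r1 / 2) * Y ((1 + \<theta>) * t) \<omega>" using Y0 by simp_all
    show "Y t \<omega> \<le> exp (- t * r1 / 2) * indicator ?A \<omega>
      + exp (- \<theta> * t * r / 2) * Y ((1 - \<theta>) * t) \<omega> + exp (\<theta> * t * r1 / 2) * Y ((1 + \<theta>) * t) \<omega>"
    proof (cases "T \<omega> = \<infinity>")
      case True
      then have "Y t \<omega> = 0" by (simp add: Y_def)
      then show ?thesis using nn by linarith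
    next
      case False
      define x where "x = enn2real (T \<omega>)"
      have Tx: "T \<omega> = ennreal x" "x \<ge> 0" using False by (auto simp: x_def less_top)
      have Yx: "Y t \<omega> = exp (- t * x / 2)" for t using False by (simp add: Y_def x_def)
      consider "x \<le> r1" | "r1 < x" "x \<le> r" | "x > r" by linarith
      then show ?thesis
      proof cases
        case 1
        have "\<theta> * t * x \<le> \<theta> * t * r1" using 1 t \<theta> by (intro mult_left_mono) auto
        then have "- t * x / 2 \<le> \<theta> * t * r1 / 2 + - ((1 + \<theta>) * t) * x / 2" by (simp add: algebra_simps diff_divide_distrib)
        then have "Y t \<omega> \<le> exp (\<theta> * t * r1 / 2) * Y ((1 + \<theta>) * t) \<omega>"
          unfolding Yx exp_add[symmetric] by simp
        then show ?thesis using nn by linarith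
      next
        case 2
        have "t * r1 \<le> t * x" using 2 t by simp
        then have "Y t \<omega> \<le> exp (- t * r1 / 2)" unfolding Yx by simp
        moreover have "\<omega> \<in> ?A" using 2 \<omega> Tx r by (simp add: ennreal_leI)
        ultimately show ?thesis using nn by simp
      next
        case 3
        have "\<theta> * t * r \<le> \<theta> * t * x" using 3 t \<theta> by (intro mult_left_mono) auto
        then have "- t * x / 2 \<le> - \<theta> * t * r / 2 + - ((1 - \<theta>) * t) * x / 2" by (simp add: algebra_simps add_divide_distrib)
        then have "Y t \<omega> \<le> exp (- \<theta> * t * r / 2) * Y ((1 - \<theta>) * t) \<omega>"
          unfolding Yx exp_add[symmetric] by simp
        then show ?thesis using nn by linarith
      qed
    qed
  qed
  also have "\<dots> = exp (- t * r1 / 2) * prob ?A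
      + exp (- \<theta> * t * r / 2) * expectation (Y ((1 - \<theta>) * t)) + exp (\<theta> * t * r1 / 2) * expectation (Y ((1 + \<theta>) * t))"
    using iA i2 i3 by simp
  finally show "expectation (Y t) \<le> exp (- t * r1 / 2) * prob ?A
      + exp (- \<theta> * t * r / 2) * expectation (Y ((1 - \<theta>) * t)) + exp (\<theta> * t * r1 / 2) * expectation (Y ((1 + \<theta>) * t))" .
  have "exp (- t * r / 2) * prob ?A = expectation (\<lambda>\<omega>. exp (- t * r / 2) * indicator ?A \<omega>)" by simp
  also have "\<dots> \<le> expectation (Y t)"
  proof (rule integral_mono[OF integrable_mult_right[OF iA] iY[OF t]])
    fix \<omega> assume \<omega>: "\<omega> \<in> space M"
    show "exp (- t * r / 2) * indicator ?A \<omega> \<le> Y t \<omega>"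
    proof (cases "\<omega> \<in> ?A")
      case True
      then have "T \<omega> \<le> ennreal r" by simp
      then have fin: "T \<omega> \<noteq> \<infinity>" and le: "enn2real (T \<omega>) \<le> r"
        using r by (auto simp: enn2real_leI top_unique)
      have "t * enn2real (T \<omega>) \<le> t * r" using le t by simp
      then show ?thesis using True fin by (simp add: Y_def)
    qed (simp add: Y0)
  qed
  finally show "exp (- t * r / 2) * prob ?A \<le> expectation (Y t)" .
qed

text \<open>Both expressions equal 1 at \<open>\<theta> = 0\<close> and have derivative
  \<open>b * \<eta> > 0\<close> there. The gap above 1 makes the mass outside the window
  exponentially small in the Tauberian argument.\<close>

lemma powr_tangent_gap:
  assumes "0 < b" "0 < \<eta>"
  obtains \<theta> :: real where "0 < \<theta>" "\<theta> < 1" "(1 - \<theta>) powr b + \<theta> * b * (1 + \<eta>) > 1" "(1 + \<theta>) powr b - \<theta> * b * (1 - \<eta>) > 1"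
proof -
  let ?f = "\<lambda>x. (1 - x) powr b + x * b * (1 + \<eta>)" and ?g = "\<lambda>x. (1 + x) powr b - x * b * (1 - \<eta>)"
  have bn: "0 < b * \<eta>" using assms by simp
  have "(?f has_real_derivative b * \<eta>) (at 0)"
    by (auto intro!: derivative_eq_intros simp: algebra_simps)
  then obtain d1 where d1: "d1 > 0" "\<And>h. h > 0 \<Longrightarrow> h < d1 \<Longrightarrow> ?f 0 < ?f (0 + h)"
    using DERIV_pos_inc_right[OF _ bn, of ?f 0] by blast
  have "(?g has_real_derivative b * \<eta>) (at 0)"
    by (auto intro!: derivative_eq_intros simp: algebra_simps)
  then obtain d2 where d2: "d2 > 0" "\<And>h. h > 0 \<Longrightarrow> h < d2 \<Longrightarrow> ?g 0 < ?g (0 + h)"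
    using DERIV_pos_inc_right[OF _ bn, of ?g 0] by blast
  define h where "h = min (1/2) (min (d1/2) (d2/2))"
  have "h > 0" "h < 1" "h < d1" "h < d2" using d1(1) d2(1) by (auto simp: h_def min_def)
  then show thesis using d1(2)[of h] d2(2)[of h] by (intro that[of h]) auto
qed

text \<open>The exponential Tauberian theorem of de Bruijn. For the lower bound the exponentially tilted
  law concentrates on \<open>T \<in> [(1 - \<eta>) m, (1 + \<eta>) m]\<close>, where \<open>m = 2 \<kappa> b t powr (b - 1)\<close>
  is twice the derivative of the exponent \<open>\<kappa> t powr b\<close>.\<close>
lemma (in prob_space) exponential_tauberian:
  fixes T :: "'a \<Rightarrow> ennreal"
  assumes T [measurable]: "T \<in> borel_measurable M"
  defines "Y \<equiv> \<lambda>t \<omega>. if T \<omega> = \<infinity> then 0 else exp (- t * enn2real (T \<omega>) / 2)"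
  assumes b: "0 < b" "b < 1" and \<kappa>: "\<kappa> > 0"
    and lim: "((\<lambda>t. - ln (expectation (Y t)) / t powr b) \<longlongrightarrow> \<kappa>) at_top"
  defines "\<gamma> \<equiv> b / (1 - b)"
  shows "((\<lambda>r. ln (prob {\<omega>\<in>space M. T \<omega> \<le> ennreal r}) * r powr \<gamma>) \<longlongrightarrow> - ((1 - b) * \<kappa> * (2 * \<kappa> * b) powr \<gamma>)) (at_right 0)"
proof -
  define l where "l t = expectation (Y t)" for t
  have l_alt: "expectation (\<lambda>\<omega>. if T \<omega> = \<infinity> then 0 else exp (- t * enn2real (T \<omega>) / 2)) = l t" for t
    unfolding l_def Y_def ..
  define G where "G r = prob {\<omega>\<in>space M. T \<omega> \<le> ennreal r}" for r
  define \<Phi> where "\<Phi> t = - ln (l t)" for t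
  have \<gamma>: "\<gamma> > 0" using b by (simp add: \<gamma>_def)
  have lim\<Phi>: "((\<lambda>t. \<Phi> t / t powr b) \<longlongrightarrow> \<kappa>) at_top" using lim by (simp add: \<Phi>_def l_def)
  have lnn: "l t \<ge> 0" for t unfolding l_def Y_def by (intro Bochner_Integration.integral_nonneg) simp
  have lpos: "\<forall>\<^sub>F t in at_top. l t > 0"
  proof -
    have "\<forall>\<^sub>F t in at_top. \<Phi> t / t powr b > 0" by (rule order_tendstoD(1)[OF lim\<Phi> \<kappa>])
    then show ?thesis by eventually_elim (use lnn in \<open>auto simp: \<Phi>_def less_le\<close>)
  qed
  have lexp: "l t = exp (- \<Phi> t)" if "l t > 0" for t using that by (simp add: \<Phi>_def)
  have scale: "((\<lambda>t. \<Phi> (c * t) / t powr b) \<longlongrightarrow> c powr b * \<kappa>) at_top" if c: "c > 0" for c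
  proof -
    have "filterlim (\<lambda>t. c * t) at_top at_top" using c by real_asymp
    from filterlim_compose[OF lim\<Phi> this]
    have "((\<lambda>t. c powr b * (\<Phi> (c * t) / (c * t) powr b)) \<longlongrightarrow> c powr b * \<kappa>) at_top" by (intro tendsto_intros)
    then show ?thesis
    proof (rule Lim_transform_eventually)
      show "\<forall>\<^sub>F t in at_top. c powr b * (\<Phi> (c * t) / (c * t) powr b) = \<Phi> (c * t) / t powr b"
        using eventually_gt_at_top[of 0] by eventually_elim (use c in \<open>simp add: powr_mult\<close>)
    qed
  qed
  define m where "m t = 2 * \<kappa> * b * t powr (b - 1)" for t
  have m: "m t > 0" "t * m t = 2 * \<kappa> * b * t powr b" if "t > 0" for t
  proof -
    show "m t > 0" using \<kappa> b that by (simp add: m_def)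
    have "t * t powr (b - 1) = t powr b" using that powr_mult_base[of t "b - 1"] by simp
    then show "t * m t = 2 * \<kappa> * b * t powr b" by (simp add: m_def mult.left_commute)
  qed
  have pw: "filterlim (\<lambda>t. t powr b) at_top at_top" using b by real_asymp
  have lower: "\<forall>\<^sub>F t in at_top. exp ((1 - \<eta>) * \<kappa> * b * t powr b) * l t / 2 \<le> G ((1 + \<eta>) * m t) \<and> l t > 0"
    if \<eta>: "0 < \<eta>" "\<eta> < 1" for \<eta>
  proof -
    obtain \<theta> where \<theta>: "0 < \<theta>" "\<theta> < 1" "(1 - \<theta>) powr b + \<theta> * b * (1 + \<eta>) > 1" "(1 + \<theta>) powr b - \<theta> * b * (1 - \<eta>) > 1"
      using powr_tangent_gap[OF b(1) \<eta>(1)] by blast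
    \<comment> \<open>The gap makes the difference of exponents a positive multiple of
      \<open>t powr b\<close>, so the contribution falls below a quarter of \<open>l t\<close>. Two
      such contributions leave half of \<open>l t\<close> for the window.\<close>
    have small: "\<forall>\<^sub>F t in at_top. exp (- u * \<kappa> * b * t powr b) * l (c * t) \<le> l t / 4"
      if c: "c > 0" and gap: "c powr b + u * b > 1" for c u
    proof -
      have "((\<lambda>t. u * \<kappa> * b + \<Phi> (c * t) / t powr b - \<Phi> t / t powr b) \<longlongrightarrow> u * \<kappa> * b + c powr b * \<kappa> - \<kappa>) at_top"
        by (intro tendsto_intros scale[OF c] lim\<Phi>)
      moreover have "u * \<kappa> * b + c powr b * \<kappa> - \<kappa> = \<kappa> * (c powr b + u * b - 1)" by (simp add: algebra_simps)
      ultimately have L: "((\<lambda>t. u * \<kappa> * b + \<Phi> (c * t) / t powr b - \<Phi> t / t powr b) \<longlongrightarrow> \<kappa> * (c powr b + u * b - 1)) at_top" by simp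
      have pos: "\<kappa> * (c powr b + u * b - 1) > 0" using \<kappa> gap by simp
      have "filterlim (\<lambda>t. (u * \<kappa> * b + \<Phi> (c * t) / t powr b - \<Phi> t / t powr b) * t powr b) at_top at_top"
        by (rule filterlim_tendsto_pos_mult_at_top[OF L pos pw])
      then have "\<forall>\<^sub>F t in at_top. (u * \<kappa> * b + \<Phi> (c * t) / t powr b - \<Phi> t / t powr b) * t powr b \<ge> ln 4"
        by (simp add: filterlim_at_top)
      moreover have "filterlim (\<lambda>t. c * t) at_top at_top" using c by real_asymp
      from eventually_compose_filterlim[OF lpos this] have "\<forall>\<^sub>F t in at_top. l (c * t) > 0" .
      ultimately show ?thesis using lpos eventually_gt_at_top[of 0]
      proof eventually_elim
        case (elim t)
        have "ln 4 \<le> u * \<kappa> * b * t powr b + \<Phi> (c * t) - \<Phi> t"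
          using elim(1,4) by (simp add: algebra_simps)
        then have "- u * \<kappa> * b * t powr b - \<Phi> (c * t) \<le> - \<Phi> t - ln 4" by simp
        then have "exp (- u * \<kappa> * b * t powr b - \<Phi> (c * t)) \<le> exp (- \<Phi> t - ln 4)" by simp
        then show ?case unfolding lexp[OF elim(2)] lexp[OF elim(3)] by (simp add: exp_diff exp_add[symmetric])
      qed
    qed
    have s1: "\<forall>\<^sub>F t in at_top. exp (- (\<theta> * (1 + \<eta>)) * \<kappa> * b * t powr b) * l ((1 - \<theta>) * t) \<le> l t / 4"
      by (rule small) (use \<theta> in \<open>auto simp: algebra_simps\<close>)
    have s2: "\<forall>\<^sub>F t in at_top. exp (- (- (\<theta> * (1 - \<eta>))) * \<kappa> * b * t powr b) * l ((1 + \<theta>) * t) \<le> l t / 4"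
      by (rule small) (use \<theta> in \<open>auto simp: algebra_simps\<close>)
    show ?thesis using s1 s2 lpos eventually_gt_at_top[of 0]
    proof eventually_elim
      case (elim t)
      have r: "0 \<le> (1 - \<eta>) * m t" "0 \<le> (1 + \<eta>) * m t" using m(1)[OF elim(4)] \<eta> by auto
      have e1: "- t * ((1 - \<eta>) * m t) / 2 = - ((1 - \<eta>) * \<kappa> * b * t powr b)"
      proof -
        have "- t * ((1 - \<eta>) * m t) / 2 = (- (1 - \<eta>) / 2) * (t * m t)" by (simp add: field_simps)
        also have "\<dots> = (- (1 - \<eta>) / 2) * (2 * \<kappa> * b * t powr b)" by (simp only: m(2)[OF elim(4)])
        also have "\<dots> = - ((1 - \<eta>) * \<kappa> * b * t powr b)" by (simp add: field_simps)
        finally show ?thesis .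
      qed
      have e2: "- \<theta> * t * ((1 + \<eta>) * m t) / 2 = - (\<theta> * (1 + \<eta>)) * \<kappa> * b * t powr b"
      proof -
        have "- \<theta> * t * ((1 + \<eta>) * m t) / 2 = (- (\<theta> * (1 + \<eta>)) / 2) * (t * m t)" by (simp add: field_simps)
        also have "\<dots> = (- (\<theta> * (1 + \<eta>)) / 2) * (2 * \<kappa> * b * t powr b)" by (simp only: m(2)[OF elim(4)])
        also have "\<dots> = - (\<theta> * (1 + \<eta>)) * \<kappa> * b * t powr b" by (simp add: field_simps)
        finally show ?thesis .
      qed
      have e3: "\<theta> * t * ((1 - \<eta>) * m t) / 2 = - (- (\<theta> * (1 - \<eta>))) * \<kappa> * b * t powr b"
      proof -
        have "\<theta> * t * ((1 - \<eta>) * m t) / 2 = (\<theta> * (1 - \<eta>) / 2) * (t * m t)" by (simp add: field_simps)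
        also have "\<dots> = (\<theta> * (1 - \<eta>) / 2) * (2 * \<kappa> * b * t powr b)" by (simp only: m(2)[OF elim(4)])
        also have "\<dots> = - (- (\<theta> * (1 - \<eta>))) * \<kappa> * b * t powr b" by (simp add: field_simps)
        finally show ?thesis .
      qed
      have "l t \<le> exp (- ((1 - \<eta>) * \<kappa> * b * t powr b)) * G ((1 + \<eta>) * m t) + l t / 4 + l t / 4"
        using laplace_split(1)[OF T elim(4) \<theta>(1,2) r] elim(1,2)
        unfolding l_alt G_def[symmetric] e1 e2 e3 by linarith
      then have "l t / 2 \<le> exp (- ((1 - \<eta>) * \<kappa> * b * t powr b)) * G ((1 + \<eta>) * m t)" by simp
      then have "exp ((1 - \<eta>) * \<kappa> * b * t powr b) * (l t / 2) \<le>
          exp ((1 - \<eta>) * \<kappa> * b * t powr b) * (exp (- ((1 - \<eta>) * \<kappa> * b * t powr b)) * G ((1 + \<eta>) * m t))"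
        by (rule mult_left_mono) simp
      then show ?case using elim(3) by (simp add: mult.assoc[symmetric] exp_add[symmetric])
    qed
  qed
  \<comment> \<open>The solution of \<open>c * m t = r\<close>: for \<open>c = 1 + \<eta>\<close>
    the upper edge of the window is at \<open>r\<close>, and for \<open>c = 1\<close> its
    center.\<close>
  define t where "t c r = (2 * \<kappa> * b * c / r) powr (1 / (1 - b))" for c r :: real
  have tc: "filterlim (t c) at_top (at_right 0)" if "c > 0" for c
    unfolding t_def[abs_def] using that b \<kappa> by real_asymp
  have tm: "c * m (t c r) = r" "t c r powr b = (2 * \<kappa> * b * c) powr \<gamma> * r powr (- \<gamma>)" "t c r > 0" if "c > 0" "r > 0" for c r
  proof -
    have q: "2 * \<kappa> * b * c / r > 0" using that \<kappa> b by simp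
    show "t c r > 0" unfolding t_def using that \<kappa> b by simp
    have "t c r powr (b - 1) = (2 * \<kappa> * b * c / r) powr (- 1)"
    proof -
      have "1 / (1 - b) * (b - 1) = - 1" using b by (simp add: field_simps)
      then show ?thesis unfolding t_def powr_powr by (simp only:)
    qed
    also have "\<dots> = r / (2 * \<kappa> * b * c)" using that \<kappa> b by (simp add: powr_minus_divide abs_mult)
    finally show "c * m (t c r) = r" using that \<kappa> b by (simp add: m_def)
    have "t c r powr b = (2 * \<kappa> * b * c / r) powr \<gamma>"
      unfolding t_def powr_powr \<gamma>_def by simp
    also have "\<dots> = (2 * \<kappa> * b * c) powr \<gamma> * r powr (- \<gamma>)"
      using that \<kappa> b by (simp add: powr_divide powr_minus_divide)
    finally show "t c r powr b = (2 * \<kappa> * b * c) powr \<gamma> * r powr (- \<gamma>)" .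
  qed
  let ?K = "(1 - b) * \<kappa> * (2 * \<kappa> * b) powr \<gamma>"
  have lowlim: "\<forall>\<^sub>F r in at_right 0. ((1 - \<eta>) * \<kappa> * b - \<Phi> (t (1 + \<eta>) r) / t (1 + \<eta>) r powr b - ln 2 / t (1 + \<eta>) r powr b)
      * (2 * \<kappa> * b * (1 + \<eta>)) powr \<gamma> \<le> ln (G r) * r powr \<gamma> \<and> G r > 0" if \<eta>: "0 < \<eta>" "\<eta> < 1" for \<eta>
  proof -
    have c: "1 + \<eta> > 0" using \<eta> by simp
    show ?thesis using eventually_compose_filterlim[OF lower[OF \<eta>] tc[OF c]] eventually_at_right_less[of 0]
    proof eventually_elim
      case (elim r)
      define s where "s = t (1 + \<eta>) r"
      note tms = tm[OF c elim(2), folded s_def]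
      have ls: "l s > 0" and le: "exp ((1 - \<eta>) * \<kappa> * b * s powr b) * l s / 2 \<le> G r"
        using elim(1) tms(1) unfolding s_def[symmetric] by auto
      have "exp ((1 - \<eta>) * \<kappa> * b * s powr b) * l s / 2 > 0" using ls by simp
      with le have Gp: "G r > 0" by linarith
      have "exp ((1 - \<eta>) * \<kappa> * b * s powr b - \<Phi> s - ln 2) \<le> G r"
        using le unfolding lexp[OF ls] by (simp add: exp_diff exp_add[symmetric])
      then have "(1 - \<eta>) * \<kappa> * b * s powr b - \<Phi> s - ln 2 \<le> ln (G r)"
        using Gp by (simp add: ln_ge_iff)
      then have "((1 - \<eta>) * \<kappa> * b * s powr b - \<Phi> s - ln 2) * r powr \<gamma> \<le> ln (G r) * r powr \<gamma>"
        by (rule mult_right_mono) simp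
      moreover have "r powr \<gamma> = (2 * \<kappa> * b * (1 + \<eta>)) powr \<gamma> / s powr b"
        unfolding tms(2) using elim(2) \<kappa> b \<eta> by (simp add: powr_minus_divide)
      moreover have "s powr b > 0" using tms(3) by simp
      ultimately show ?case using Gp unfolding s_def[symmetric] by (simp add: field_simps)
    qed
  qed
  have "((\<lambda>r. ln (G r) * r powr \<gamma>) \<longlongrightarrow> - ?K) (at_right 0)"
  proof (rule order_tendstoI)
    fix y assume y: "y < - ?K"
    have "((\<lambda>\<eta>. ((1 - \<eta>) * \<kappa> * b - \<kappa> - 0) * (2 * \<kappa> * b * (1 + \<eta>)) powr \<gamma>) \<longlongrightarrow> ((1 - 0) * \<kappa> * b - \<kappa> - 0) * (2 * \<kappa> * b * (1 + 0)) powr \<gamma>) (at_right 0)"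
      using \<kappa> b by (intro tendsto_intros) auto
    then obtain \<eta> where \<eta>: "0 < \<eta>" "\<eta> < 1" "((1 - \<eta>) * \<kappa> * b - \<kappa> - 0) * (2 * \<kappa> * b * (1 + \<eta>)) powr \<gamma> > y"
      by (rule at_right_0_obtain_greater) (use y in \<open>auto simp: algebra_simps\<close>)
    have c: "1 + \<eta> > 0" using \<eta> by simp
    have "((\<lambda>x. ln 2 / x powr b) \<longlongrightarrow> 0) at_top" using b by real_asymp
    then have "((\<lambda>r. ((1 - \<eta>) * \<kappa> * b - \<Phi> (t (1 + \<eta>) r) / t (1 + \<eta>) r powr b - ln 2 / t (1 + \<eta>) r powr b)
      * (2 * \<kappa> * b * (1 + \<eta>)) powr \<gamma>) \<longlongrightarrow> ((1 - \<eta>) * \<kappa> * b - \<kappa> - 0) * (2 * \<kappa> * b * (1 + \<eta>)) powr \<gamma>) (at_right 0)"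
      by (intro tendsto_mult tendsto_diff tendsto_const filterlim_compose[OF lim\<Phi> tc[OF c]]
          filterlim_compose[OF _ tc[OF c], of "\<lambda>x. ln 2 / x powr b"])
    from order_tendstoD(1)[OF this \<eta>(3)] lowlim[OF \<eta>(1,2)]
    show "\<forall>\<^sub>F r in at_right 0. y < ln (G r) * r powr \<gamma>" by eventually_elim linarith
  next
    \<comment> \<open>The upper bound is the exponential Markov inequality at the argument with
      \<open>m = r\<close>, which yields the exponent \<open>\<kappa> * b - \<kappa>\<close> in
      units of \<open>t powr b\<close>.\<close>
    fix y assume y: "- ?K < y"
    have "((\<lambda>r. (\<kappa> * b - \<Phi> (t 1 r) / t 1 r powr b) * (2 * \<kappa> * b * 1) powr \<gamma>) \<longlongrightarrow> (\<kappa> * b - \<kappa>) * (2 * \<kappa> * b * 1) powr \<gamma>) (at_right 0)"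
      by (intro tendsto_mult tendsto_diff tendsto_const filterlim_compose[OF lim\<Phi> tc]) simp
    then have "\<forall>\<^sub>F r in at_right 0. (\<kappa> * b - \<Phi> (t 1 r) / t 1 r powr b) * (2 * \<kappa> * b * 1) powr \<gamma> < y"
      by (rule order_tendstoD) (use y in \<open>simp add: algebra_simps\<close>)
    moreover have "\<forall>\<^sub>F r in at_right 0. G r > 0"
      using lowlim[of "1/2"] by (auto elim: eventually_mono)
    moreover have "\<forall>\<^sub>F r in at_right 0. l (t 1 r) > 0"
      by (rule eventually_compose_filterlim[OF lpos tc]) simp
    ultimately show "\<forall>\<^sub>F r in at_right 0. ln (G r) * r powr \<gamma> < y"
      using eventually_at_right_less[of 0]
    proof eventually_elim
      case (elim r)
      define s where "s = t 1 r"
      note tms = tm[OF zero_less_one elim(4), folded s_def]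
      have sr: "- s * r / 2 = - (\<kappa> * b * s powr b)" using m(2)[OF tms(3)] tms(1) by simp
      have "exp (- (\<kappa> * b * s powr b)) * G r \<le> l s"
        using laplace_split(2)[OF T tms(3), of "1/2" 0 r] elim(4)
        unfolding l_alt G_def[symmetric] sr by simp
      then have "ln (exp (- (\<kappa> * b * s powr b)) * G r) \<le> ln (l s)"
        using elim(2,3) by (simp add: s_def)
      then have "ln (G r) \<le> \<kappa> * b * s powr b - \<Phi> s"
        using elim(2) by (simp add: ln_mult_pos \<Phi>_def)
      then have "ln (G r) * r powr \<gamma> \<le> (\<kappa> * b * s powr b - \<Phi> s) * r powr \<gamma>"
        by (rule mult_right_mono) simp
      moreover have "r powr \<gamma> = (2 * \<kappa> * b * 1) powr \<gamma> / s powr b"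
        unfolding tms(2) using elim(4) \<kappa> b by (simp add: powr_minus_divide)
      moreover have "s powr b > 0" using tms(3) by simp
      ultimately have "ln (G r) * r powr \<gamma> \<le> (\<kappa> * b - \<Phi> s / s powr b) * (2 * \<kappa> * b * 1) powr \<gamma>"
        by (simp add: field_simps)
      then show ?case using elim(1) unfolding s_def by simp
    qed
  qed
  then show ?thesis by (simp add: G_def)
qed

context finite_range
begin

text \<open>By discrete Parseval the Riemann sums of the squared modulus are constant as soon as
  they have more than \<open>2 * L\<close> points, so their limit is that constant.\<close>

lemma symbol_mean_square:
  "(LINT x:{0..2 * pi}|lborel. (cmod (symbol x))\<^sup>2) = 2 * pi * energy"
proof -
  have cont: "continuous_on {0..2 * pi} (\<lambda>x. (cmod (symbol x))\<^sup>2)"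
    unfolding symbol_def[abs_def] by (intro continuous_intros)
  have "(\<lambda>n. (\<Sum>l<n. (cmod (symbol (2 * pi * real l / real n)))\<^sup>2) / real n)
      \<longlonglongrightarrow> integral {0..2 * pi} (\<lambda>x. (cmod (symbol x))\<^sup>2) / (2 * pi)"
    by (rule riemann_sum_tendsto[OF cont]) simp
  moreover have "(\<lambda>n. (\<Sum>l<n. (cmod (symbol (2 * pi * real l / real n)))\<^sup>2) / real n) \<longlonglongrightarrow> energy"
  proof (rule tendsto_eventually)
    show "\<forall>\<^sub>F n in sequentially. (\<Sum>l<n. (cmod (symbol (2 * pi * real l / real n)))\<^sup>2) / real n = energy"
      using eventually_gt_at_top[of "nat (2 * L)"]
    proof eventually_elim
      case (elim n)
      then have n: "int n > 2 * L" by simp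
      have "(\<Sum>l\<in>{0..<int n}. (cmod (symbol (2 * pi * of_int l / of_int (int n))))\<^sup>2) = (\<Sum>l<n. (cmod (symbol (2 * pi * real l / real n)))\<^sup>2)"
        by (rule sum.reindex_bij_witness[where i=int and j=nat]) auto
      then show ?case using symbol_parseval_scaled[OF n, of 1] elim by simp
    qed
  qed
  ultimately have "integral {0..2 * pi} (\<lambda>x. (cmod (symbol x))\<^sup>2) / (2 * pi) = energy"
    by (rule LIMSEQ_unique)
  then show ?thesis
    using set_borel_integral_eq_integral(2)[OF borel_integrable_atLeastAtMost'[OF cont]] by (simp add: field_simps)
qed

end

section \<open>The full weighted sum and its Laplace transform\<close>

context weighted_ma
begin

text \<open>The value may be \<infinity>; such outcomes lie in no small ball and count as 0 in the
  Laplace transform \<open>lap\<close>.\<close>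

definition wsum :: "'a \<Rightarrow> ennreal" where
  "wsum \<omega> = (\<Sum>\<^sub>\<infinity>k. ennreal ((d k)\<^sup>2 * (ma_U a X k \<omega>)\<^sup>2))"

definition psum :: "int set \<Rightarrow> 'a \<Rightarrow> real" where
  "psum I \<omega> = (\<Sum>k\<in>I. (d k)\<^sup>2 * (ma_U a X k \<omega>)\<^sup>2)"

lemma psum_nonneg: "psum I \<omega> \<ge> 0"
  by (simp add: psum_def sum_nonneg)

lemma rv_psum [measurable]: "psum I \<in> borel_measurable M"
  unfolding psum_def[abs_def] by measurable

lemma ennreal_psum: "ennreal (psum I \<omega>) = (\<Sum>k\<in>I. ennreal ((d k)\<^sup>2 * (ma_U a X k \<omega>)\<^sup>2))"
  unfolding psum_def by (rule sum_ennreal[symmetric]) simp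

lemma wsum_eq_SUP_finite: "wsum \<omega> = (SUP F\<in>{F. finite F}. ennreal (psum F \<omega>))"
  unfolding wsum_def ennreal_psum by (subst nonneg_infsum_complete) auto

lemma psum_le_wsum: "finite I \<Longrightarrow> ennreal (psum I \<omega>) \<le> wsum \<omega>"
  unfolding wsum_eq_SUP_finite by (rule SUP_upper) simp

lemma psum_mono: "finite J \<Longrightarrow> I \<subseteq> J \<Longrightarrow> psum I \<omega> \<le> psum J \<omega>"
  unfolding psum_def by (rule sum_mono2) auto

lemma incseq_psum: "incseq (\<lambda>n. ennreal (psum {- int n..int n} \<omega>))"
  unfolding incseq_def by (auto intro!: ennreal_leI psum_mono)

text \<open>Every finite set lies in a symmetric interval, so an increasing sequence replaces the
  directed family; measurability and the limit theorems need a sequence.\<close>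

lemma wsum_eq_SUP: "wsum \<omega> = (SUP n. ennreal (psum {- int n..int n} \<omega>))"
proof (rule antisym)
  show "wsum \<omega> \<le> (SUP n. ennreal (psum {- int n..int n} \<omega>))"
    unfolding wsum_eq_SUP_finite
  proof (rule SUP_least)
    fix F :: "int set" assume "F \<in> {F. finite F}"
    then have F: "finite F" by simp
    obtain m :: nat where m: "F \<subseteq> {- int m..int m}" by (rule finite_int_bounded[OF F])
    from m have "ennreal (psum F \<omega>) \<le> ennreal (psum {- int m..int m} \<omega>)"
      by (intro ennreal_leI psum_mono) simp_all
    also have "\<dots> \<le> (SUP n. ennreal (psum {- int n..int n} \<omega>))" by (rule SUP_upper) simp
    finally show "ennreal (psum F \<omega>) \<le> (SUP n. ennreal (psum {- int n..int n} \<omega>))" .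
  qed
  show "(SUP n. ennreal (psum {- int n..int n} \<omega>)) \<le> wsum \<omega>"
    by (rule SUP_least) (rule psum_le_wsum, simp)
qed

lemma psum_tendsto: "(\<lambda>n. ennreal (psum {- int n..int n} \<omega>)) \<longlonglongrightarrow> wsum \<omega>"
  unfolding wsum_eq_SUP by (rule LIMSEQ_SUP[OF incseq_psum])

lemma rv_wsum [measurable]: "wsum \<in> borel_measurable M"
  unfolding wsum_eq_SUP[abs_def] by measurable

definition lap :: "real \<Rightarrow> 'a \<Rightarrow> real" where
  "lap t \<omega> = (if wsum \<omega> = \<infinity> then 0 else exp (- t * enn2real (wsum \<omega>) / 2))"

lemma rv_lap [measurable]: "lap t \<in> borel_measurable M"
  unfolding lap_def[abs_def] by measurable

lemma lap_tendsto:
  assumes t: "t > 0"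
  shows "(\<lambda>n. exp (- t * psum {- int n..int n} \<omega> / 2)) \<longlonglongrightarrow> lap t \<omega>"
proof (cases "wsum \<omega> = \<infinity>")
  case True
  then have "filterlim (\<lambda>n. psum {- int n..int n} \<omega>) at_top sequentially"
    using psum_tendsto[of \<omega>] by (simp add: ennreal_tendsto_top_eq_at_top)
  moreover have "((\<lambda>x. exp (- t * x / 2)) \<longlongrightarrow> 0) at_top" using t by real_asymp
  ultimately show ?thesis using True filterlim_compose by (fastforce simp: lap_def)
next
  case False
  define x where "x = enn2real (wsum \<omega>)"
  have x: "wsum \<omega> = ennreal x" "x \<ge> 0" using False by (auto simp: x_def less_top)
  have "(\<lambda>n. psum {- int n..int n} \<omega>) \<longlonglongrightarrow> x"
    using psum_tendsto[of \<omega>] x by (simp add: tendsto_ennreal_iff psum_nonneg)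
  then have "(\<lambda>n. exp (- t * psum {- int n..int n} \<omega> / 2)) \<longlonglongrightarrow> exp (- t * x / 2)"
    by (intro tendsto_intros) auto
  then show ?thesis using False by (simp add: lap_def x_def)
qed

lemma lap_le:
  assumes "t > 0" "finite I"
  shows "lap t \<omega> \<le> exp (- t * psum I \<omega> / 2)"
proof (cases "wsum \<omega> = \<infinity>")
  case False
  then have "psum I \<omega> \<le> enn2real (wsum \<omega>)"
    using psum_le_wsum[OF assms(2), of \<omega>] psum_nonneg[of I \<omega>]
    by (metis enn2real_ennreal enn2real_mono infinity_ennreal_def less_top)
  then have "t * psum I \<omega> \<le> t * enn2real (wsum \<omega>)" using assms by simp
  then show ?thesis using False by (simp add: lap_def)
qed (simp add: lap_def)

lemma expectation_psum:
  assumes "t > 0" "finite I"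
  shows "expectation (\<lambda>\<omega>. exp (- t * psum I \<omega> / 2)) = exp (- fphi t I)"
proof -
  have eq: "(\<Sum>k\<in>I. (sqrt t * d k)\<^sup>2 * (ma_U a X k \<omega>)\<^sup>2) = t * psum I \<omega>" for \<omega>
    using assms(1) by (simp add: psum_def sum_distrib_left power_mult_distrib mult.assoc)
  have "0 < expectation (\<lambda>\<omega>. exp (- t * psum I \<omega> / 2))"
    by (rule expectation_pos) (use assms psum_nonneg in auto)
  then show ?thesis by (simp add: fphi_def full_phi_def eq)
qed

lemma integrable_exp_psum: "t > 0 \<Longrightarrow> integrable M (\<lambda>\<omega>. exp (- t * psum I \<omega> / 2))"
  by (rule integrable_bounded_prob[where B=1]) (use psum_nonneg in \<open>auto intro: prob_space_axioms\<close>)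

lemma expectation_lap_le:
  assumes "t > 0" "finite I"
  shows "expectation (lap t) \<le> exp (- fphi t I)"
  unfolding expectation_psum[OF assms, symmetric]
proof (rule integral_mono[OF _ integrable_exp_psum[OF assms(1)] lap_le[OF assms]])
  show "integrable M (lap t)"
    by (rule integrable_bounded_prob[where B=1]) (use assms in \<open>auto simp: lap_def intro: prob_space_axioms\<close>)
qed

lemma expectation_lap_tendsto:
  assumes "t > 0"
  shows "(\<lambda>n. exp (- fphi t {- int n..int n})) \<longlonglongrightarrow> expectation (lap t)"
  unfolding expectation_psum[OF assms finite_atLeastAtMost_int, symmetric]
  by (rule integral_dominated_convergence[where w="\<lambda>_. 1"])
     (use assms psum_nonneg lap_tendsto[OF assms] in auto)

text \<open>\<open>fphi_upper\<close> is uniform in the index set and so passes to the limit along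
  intervals. In the other direction the single finite set from \<open>fphi_lower\<close> suffices,
  since dropping squares only increases the Laplace transform.\<close>

lemma laplace_asymptotics: "((\<lambda>t. - ln (expectation (lap t)) / t powr \<beta>) \<longlongrightarrow> full_rate) at_top"
proof -
  have ge: "\<forall>\<^sub>F t in at_top. exp (- ((full_rate + \<eta>) * t powr \<beta>)) \<le> expectation (lap t)" if "\<eta> > 0" for \<eta>
    using fphi_upper[OF that] eventually_gt_at_top[of 0]
  proof eventually_elim
    case (elim t)
    show ?case
      by (rule LIMSEQ_le_const[OF expectation_lap_tendsto[OF elim(2)]]) (use elim(1) in auto)
  qed
  have pos: "\<forall>\<^sub>F t in at_top. expectation (lap t) > 0"
    using ge[of 1] by (rule eventually_mono) (auto intro: less_le_trans[OF exp_gt_zero])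
  show ?thesis
  proof (rule order_tendstoI)
    fix y assume y: "y < full_rate"
    define \<eta> where "\<eta> = (full_rate - y) / 2"
    have \<eta>: "\<eta> > 0" "y < full_rate - \<eta>" using y by (auto simp: \<eta>_def field_simps)
    show "\<forall>\<^sub>F t in at_top. y < - ln (expectation (lap t)) / t powr \<beta>"
      using fphi_lower[OF \<eta>(1)] pos eventually_gt_at_top[of 0]
    proof eventually_elim
      case (elim t)
      then obtain I where I: "finite I" "fphi t I \<ge> (full_rate - \<eta>) * t powr \<beta>" by blast
      have "ln (expectation (lap t)) \<le> - fphi t I"
        using expectation_lap_le[OF elim(3) I(1)] elim(2) by (simp add: ln_le_cancel_iff[symmetric] del: ln_le_cancel_iff)
      then have "(full_rate - \<eta>) * t powr \<beta> \<le> - ln (expectation (lap t))" using I(2) by simp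
      then have "full_rate - \<eta> \<le> - ln (expectation (lap t)) / t powr \<beta>"
        by (subst pos_le_divide_eq) (use elim(3) in auto)
      then show ?case using \<eta>(2) by linarith
    qed
  next
    fix y assume y: "full_rate < y"
    define \<eta> where "\<eta> = (y - full_rate) / 2"
    have \<eta>: "\<eta> > 0" "full_rate + \<eta> < y" using y by (auto simp: \<eta>_def field_simps)
    show "\<forall>\<^sub>F t in at_top. - ln (expectation (lap t)) / t powr \<beta> < y"
      using ge[OF \<eta>(1)] pos eventually_gt_at_top[of 0]
    proof eventually_elim
      case (elim t)
      have "- ((full_rate + \<eta>) * t powr \<beta>) \<le> ln (expectation (lap t))"
        using elim(1,2) by (simp add: ln_ge_iff)
      then have "- ln (expectation (lap t)) \<le> (full_rate + \<eta>) * t powr \<beta>" by simp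
      then have "- ln (expectation (lap t)) / t powr \<beta> \<le> full_rate + \<eta>"
        by (subst pos_divide_le_eq) (use elim(3) in auto)
      then show ?case using \<eta>(2) by linarith
    qed
  qed
qed

lemma small_ball:
  assumes "full_rate > 0"
  shows "((\<lambda>r. ln (prob {\<omega>\<in>space M. wsum \<omega> \<le> ennreal r}) * r powr (\<beta> / (1 - \<beta>)))
    \<longlongrightarrow> - ((1 - \<beta>) * full_rate * (2 * full_rate * \<beta>) powr (\<beta> / (1 - \<beta>)))) (at_right 0)"
  using laplace_asymptotics
  by (intro exponential_tauberian[OF rv_wsum \<beta>(1,2) assms]) (simp add: lap_def[abs_def])

lemma f_mean_nonneg: "f_mean \<ge> 0"
  unfolding f_mean_def set_lebesgue_integral_def by (intro mult_nonneg_nonneg Bochner_Integration.integral_nonneg) auto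

text \<open>\<open>f\<close> vanishes almost everywhere, so the squared L2 distance to the
  \<open>n\<close>-th partial sum is \<open>2 * pi\<close> times the sum of the squared coefficients
  up to \<open>n\<close>. It tends to 0, yet eventually dominates each of them.\<close>

lemma coeff_zero:
  assumes "f_mean = 0"
  shows "a m = 0"
proof -
  define g where "g L x = (\<Sum>m\<in>{- int L..int L}. complex_of_real (a m) * exp (\<i> * of_int m * of_real x))" for L :: nat and x
  have fm: "f \<in> borel_measurable lborel" "set_integrable lborel {0..2 * pi} (\<lambda>x. (cmod (f x))\<^sup>2)"
    and lim: "(\<lambda>n. LINT x:{0..2*pi}|lborel. (cmod (f x - g n x))\<^sup>2) \<longlonglongrightarrow> 0"
    using fourier by (auto simp: is_L2_fourier_sum_def g_def)
  have q: "0 < 1 / p" "1 / p < 2" using p_gt by (auto simp: field_simps)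
  have "(LINT x:{0..2 * pi}|lborel. cmod (f x) powr (1 / p)) = 0"
    using assms by (simp add: f_mean_def)
  then have "AE x in lborel. indicator {0..2 * pi} x *\<^sub>R (cmod (f x) powr (1 / p)) = 0"
    using integral_nonneg_eq_0_iff_AE[of lborel "\<lambda>x. indicator {0..2 * pi} x *\<^sub>R (cmod (f x) powr (1 / p))"]
      set_integrable_powr[OF fm q] unfolding set_lebesgue_integral_def set_integrable_def by simp
  then have f0: "AE x in lborel. x \<in> {0..2 * pi} \<longrightarrow> f x = 0"
    by (rule AE_mp) (auto simp: indicator_def split: if_splits)
  have en: "(\<Sum>m\<in>{- int n..int n}. (a m)\<^sup>2) = (LINT x:{0..2*pi}|lborel. (cmod (f x - g n x))\<^sup>2) / (2 * pi)" for n
  proof -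
    interpret fr: finite_range "int n" "trunc n a" by (rule finite_range_trunc)
    have sym: "fr.symbol = g n"
      by (auto simp: fr.symbol_def g_def trunc_def fun_eq_iff intro!: sum.cong)
    have gm: "g n \<in> borel_measurable borel"
      unfolding g_def[abs_def] by (intro borel_measurable_continuous_onI continuous_intros)
    have "(LINT x:{0..2*pi}|lborel. (cmod (f x - g n x))\<^sup>2) = (LINT x:{0..2*pi}|lborel. (cmod (g n x))\<^sup>2)"
      unfolding set_lebesgue_integral_def
    proof (rule integral_cong_AE)
      show "AE x in lborel. indicator {0..2*pi} x *\<^sub>R (cmod (f x - g n x))\<^sup>2 = indicator {0..2*pi} x *\<^sub>R (cmod (g n x))\<^sup>2"
        using f0 by eventually_elim (auto simp: indicator_def)
    qed (use fm(1) gm in measurable)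
    also have "\<dots> = 2 * pi * fr.energy"
      using fr.symbol_mean_square unfolding sym .
    also have "fr.energy = (\<Sum>m\<in>{- int n..int n}. (a m)\<^sup>2)"
      unfolding fr.energy_def by (intro sum.cong) (auto simp: trunc_def)
    finally show ?thesis by simp
  qed
  have "(\<lambda>n. \<Sum>m\<in>{- int n..int n}. (a m)\<^sup>2) \<longlonglongrightarrow> 0 / (2 * pi)"
    unfolding en by (intro tendsto_divide lim tendsto_const) simp
  moreover have "\<exists>N. \<forall>n\<ge>N. (a m)\<^sup>2 \<le> (\<Sum>m\<in>{- int n..int n}. (a m)\<^sup>2)"
    by (intro exI[of _ "nat \<bar>m\<bar>"] allI impI member_le_sum[of m _ "\<lambda>m. (a m)\<^sup>2"]) auto
  ultimately have "(a m)\<^sup>2 \<le> 0 / (2 * pi)" by (rule LIMSEQ_le_const)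
  then show ?thesis by simp
qed

lemma wsum_zero:
  assumes "\<And>m. a m = 0"
  shows "wsum \<omega> = 0"
proof -
  have "ma_U a X k \<omega> = 0" for k
    using assms by (simp add: ma_U_def ma_partial_def[abs_def] lim_const)
  then show ?thesis by (simp add: wsum_def)
qed

end

text \<open>The two forms of the limit constant agree: with \<open>\<beta> = 1 / (2 p)\<close> one has
  \<open>\<beta> / (1 - \<beta>) = 1 / (2 p - 1)\<close> and \<open>1 + \<beta> / (1 - \<beta>) = 2 p / (2 p - 1)\<close>.\<close>
lemma small_ball_constant:
  fixes p c D :: real
  assumes p: "p > 1/2" and c: "c > 0" and D: "D \<ge> 0" and F: "F \<ge> 0"
  defines "b \<equiv> 1 / (2 * p)"
  shows "(1 - b) * (c / 2 * D * F) * (2 * (c / 2 * D * F) * b) powr (b / (1 - b))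
    = (2 * p - 1) / 2 * (c / (2 * p)) powr (2 * p / (2 * p - 1)) * (F powr (2 * p) * D powr (2 * p)) powr (1 / (2 * p - 1))"
proof (cases "D = 0 \<or> F = 0")
  case False
  then have DF: "D > 0" "F > 0" using D F by auto
  define g where "g = 1 / (2 * p - 1)"
  have g: "b / (1 - b) = g" "2 * p / (2 * p - 1) = 1 + g" using p by (auto simp: b_def g_def field_simps)
  have x: "2 * (c / 2 * D * F) * b = (c / (2 * p)) * (D * F)" by (simp add: b_def)
  have 1: "(F powr (2 * p) * D powr (2 * p)) powr g = (D * F) powr (1 + g)"
    using DF g(2) by (simp add: powr_mult powr_powr g_def mult.commute)
  have 2: "(1 - b) * (c / 2 * D * F) = (2 * p - 1) / 2 * ((c / (2 * p)) * (D * F))"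
    using p by (simp add: b_def field_simps)
  have pos: "(c / (2 * p)) * (D * F) > 0" using DF c p by simp
  have "(1 - b) * (c / 2 * D * F) * (2 * (c / 2 * D * F) * b) powr (b / (1 - b))
      = (2 * p - 1) / 2 * (((c / (2 * p)) * (D * F)) * ((c / (2 * p)) * (D * F)) powr g)"
    unfolding g x 2 by simp
  also have "((c / (2 * p)) * (D * F)) * ((c / (2 * p)) * (D * F)) powr g = ((c / (2 * p)) * (D * F)) powr (1 + g)"
    unfolding powr_add powr_one[OF less_imp_le[OF pos]] ..
  also have "\<dots> = (c / (2 * p)) powr (1 + g) * (D * F) powr (1 + g)" by (rule powr_mult)
  finally show ?thesis unfolding g(2) g_def[symmetric] 1 by (simp only: mult.assoc)
qed auto

section \<open>From the hypotheses on the coefficients to the final statement\<close>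

lemma asymptotic_sandwich:
  fixes d :: "int \<Rightarrow> real"
  assumes pos: "\<And>k. d k > 0" and c: "c \<ge> 0" and \<eta>: "\<eta> > 0"
    and as: "(c > 0 \<longrightarrow> d \<sim>[F] (\<lambda>k. c * \<bar>real_of_int k\<bar> powr (- p))) \<and> (c = 0 \<longrightarrow> d \<in> o[F](\<lambda>k. \<bar>real_of_int k\<bar> powr (- p)))"
  shows "\<forall>\<^sub>F k in F. (c - \<eta>) * \<bar>real_of_int k\<bar> powr (- p) \<le> d k \<and> d k \<le> (c + \<eta>) * \<bar>real_of_int k\<bar> powr (- p)"
proof (cases "c = 0")
  case True
  then have "d \<in> o[F](\<lambda>k. \<bar>real_of_int k\<bar> powr (- p))" using as by simp
  from landau_o.smallD[OF this \<eta>] show ?thesis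
  proof eventually_elim
    case (elim k)
    \<comment> \<open>For limit constant 0 the lower bound is not positive, so positivity of
      \<open>d\<close> suffices.\<close>
    have "(0 - \<eta>) * \<bar>real_of_int k\<bar> powr (- p) \<le> 0" using \<eta> by (simp add: mult_nonpos_nonneg)
    then show ?case using elim pos[of k] True by simp
  qed
next
  case False
  then have c0: "c > 0" using c by simp
  then have "(\<lambda>k. d k - c * \<bar>real_of_int k\<bar> powr (- p)) \<in> o[F](\<lambda>k. c * \<bar>real_of_int k\<bar> powr (- p))"
    using as by (simp add: asymp_equiv_altdef)
  from landau_o.smallD[OF this, of "\<eta> / c"] \<eta> c0
  have "\<forall>\<^sub>F k in F. norm (d k - c * \<bar>real_of_int k\<bar> powr (- p)) \<le> \<eta> / c * norm (c * \<bar>real_of_int k\<bar> powr (- p))" by simp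
  then show ?thesis
  proof eventually_elim
    case (elim k)
    then have "\<bar>d k - c * \<bar>real_of_int k\<bar> powr (- p)\<bar> \<le> \<eta> * \<bar>real_of_int k\<bar> powr (- p)"
      using c0 by (simp add: abs_mult)
    then show ?case by (simp add: left_diff_distrib distrib_right abs_le_iff)
  qed
qed

theorem theorem1:
  fixes M :: "'a measure" and X :: "int \<Rightarrow> 'a \<Rightarrow> real" and a d :: "int \<Rightarrow> real"
    and p dp dm :: real and f :: "real \<Rightarrow> complex"
  assumes P: "prob_space M"
    and indep: "prob_space.indep_vars M (\<lambda>_. borel) X UNIV"
    and gauss: "\<And>j. distributed M lborel (X j) (\<lambda>x. ennreal (std_normal_density x))"
    and a_l2: "(\<lambda>m. (a m)\<^sup>2) summable_on UNIV"
    and d_pos: "\<And>k. d k > 0"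
    and p_gt: "p > 1/2"
    and dpm_nonneg: "dp \<ge> 0" "dm \<ge> 0" and dpm_nz: "dp \<noteq> 0 \<or> dm \<noteq> 0"
    and d_plus: "(dp > 0 \<longrightarrow> d \<sim>[at_top] (\<lambda>k. dp * \<bar>real_of_int k\<bar> powr (- p)))
               \<and> (dp = 0 \<longrightarrow> d \<in> o[at_top](\<lambda>k. \<bar>real_of_int k\<bar> powr (- p)))"
    and d_minus: "(dm > 0 \<longrightarrow> d \<sim>[at_bot] (\<lambda>k. dm * \<bar>real_of_int k\<bar> powr (- p)))
               \<and> (dm = 0 \<longrightarrow> d \<in> o[at_bot](\<lambda>k. \<bar>real_of_int k\<bar> powr (- p)))"
    and a_lr: "p < 1 \<Longrightarrow> \<exists>r. 0 < r \<and> r < 2 \<and> (\<lambda>m. \<bar>a m\<bar> powr r) summable_on UNIV"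
    and f_def: "is_L2_fourier_sum a f"
  shows
    "(\<lambda>\<epsilon>. ln (measure M {\<omega> \<in> space M.
         (\<Sum>\<^sub>\<infinity>k. ennreal ((d k)\<^sup>2 * (ma_U a X k \<omega>)\<^sup>2)) \<le> ennreal (\<epsilon>\<^sup>2)}))
     \<sim>[at_right 0]
     (\<lambda>\<epsilon>. - ((2*p - 1) / 2 * (pi / (2*p * sin (pi / (2*p)))) powr (2*p / (2*p - 1)))
          * (( ((1 / (2*pi)) * (LINT x:{0..2*pi}|lborel. (cmod (f x)) powr (1/p))) powr (2*p)
               * (dm powr (1/p) + dp powr (1/p)) powr (2*p)) / \<epsilon>\<^sup>2) powr (1 / (2*p - 1)))"
proof -
  interpret prob_space M by (rule P)
  interpret weighted_ma M X a d p dp dm f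
  proof unfold_locales
    show "\<forall>\<^sub>F k in at_top. (dp - \<eta>) * \<bar>real_of_int k\<bar> powr (- p) \<le> d k \<and> d k \<le> (dp + \<eta>) * \<bar>real_of_int k\<bar> powr (- p)"
      if "\<eta> > 0" for \<eta> by (rule asymptotic_sandwich[OF d_pos dpm_nonneg(1) that d_plus])
    show "\<forall>\<^sub>F k in at_bot. (dm - \<eta>) * \<bar>real_of_int k\<bar> powr (- p) \<le> d k \<and> d k \<le> (dm + \<eta>) * \<bar>real_of_int k\<bar> powr (- p)"
      if "\<eta> > 0" for \<eta> by (rule asymptotic_sandwich[OF d_pos dpm_nonneg(2) that d_minus])
  qed (use indep gauss a_l2 d_pos p_gt dpm_nonneg f_def in auto)
  define D where "D = dm powr (1/p) + dp powr (1/p)"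
  have D: "D > 0" using dpm_nonneg dpm_nz by (auto simp: D_def add_pos_nonneg add_nonneg_pos)
  define B where "B = (2*p - 1) / 2 * (pi / (2*p * sin (pi / (2*p)))) powr (2*p / (2*p - 1))"
  define g where "g = 1 / (2 * p - 1)"
  define C where "C = f_mean powr (2*p) * D powr (2*p)"
  have C0: "C \<ge> 0" by (simp add: C_def)
  define G where "G r = prob {\<omega>\<in>space M. wsum \<omega> \<le> ennreal r}" for r
  have "(\<lambda>\<epsilon>. ln (G (\<epsilon>\<^sup>2))) \<sim>[at_right 0] (\<lambda>\<epsilon>. - B * (C / \<epsilon>\<^sup>2) powr g)"
  proof (cases "f_mean = 0")
    case True
    \<comment> \<open>All coefficients vanish, the probability is 1 and both sides are identically
      0; asymptotic equivalence reads \<open>0 / 0\<close> as 1.\<close>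
    have "wsum \<omega> = 0" for \<omega> by (rule wsum_zero) (rule coeff_zero[OF True])
    then have "G r = 1" for r by (simp add: G_def prob_space)
    moreover have "C = 0" using True by (simp add: C_def)
    ultimately show ?thesis by simp
  next
    case False
    then have F: "f_mean > 0" using f_mean_nonneg by simp
    have rate: "full_rate = log_sum.C0 (2*p) / 2 * D * f_mean" by (simp add: full_rate_def D_def add.commute)
    have \<kappa>: "full_rate > 0" unfolding rate using log_sum.C0_pos[OF log_sum_axioms] D F by simp
    define K where "K = (1 - log_sum.\<beta> (2*p)) * full_rate * (2 * full_rate * log_sum.\<beta> (2*p)) powr (log_sum.\<beta> (2*p) / (1 - log_sum.\<beta> (2*p)))"
    have b: "log_sum.\<beta> (2*p) = 1 / (2 * p)" by (rule \<beta>_def)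
    have bg: "log_sum.\<beta> (2*p) / (1 - log_sum.\<beta> (2*p)) = g" unfolding b g_def using p_gt by (simp add: field_simps)
    have cB: "log_sum.C0 (2*p) / (2 * p) = pi / (2*p * sin (pi / (2*p)))"
      unfolding C0_def b by (simp add: mult.commute)
    have KB: "K = B * C powr g"
      unfolding K_def rate b B_def C_def g_def cB[symmetric]
      by (rule small_ball_constant[OF p_gt log_sum.C0_pos[OF log_sum_axioms]]) (use D F in auto)
    have K0: "K > 0"
      unfolding K_def using \<kappa> \<beta> by (intro mult_pos_pos) auto
    \<comment> \<open>The small-ball limit is in terms of \<open>r\<close>; substituting
      \<open>r = \<epsilon>\<^sup>2\<close> gives the radius of the theorem.\<close>
    have sq: "filterlim (\<lambda>\<epsilon>::real. \<epsilon>\<^sup>2) (at_right 0) (at_right 0)" by real_asymp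
    have "((\<lambda>\<epsilon>. ln (G (\<epsilon>\<^sup>2)) * (\<epsilon>\<^sup>2) powr g) \<longlongrightarrow> - K) (at_right 0)"
      using filterlim_compose[OF small_ball[OF \<kappa>] sq] unfolding G_def K_def bg .
    then have "((\<lambda>\<epsilon>. ln (G (\<epsilon>\<^sup>2)) * (\<epsilon>\<^sup>2) powr g / (- K)) \<longlongrightarrow> - K / - K) (at_right 0)"
      using K0 by (intro tendsto_divide tendsto_const) auto
    then have lim: "((\<lambda>\<epsilon>. ln (G (\<epsilon>\<^sup>2)) * (\<epsilon>\<^sup>2) powr g / (- K)) \<longlongrightarrow> 1) (at_right 0)" using K0 by simp
    show ?thesis
    proof (rule asymp_equivI')
      show "((\<lambda>\<epsilon>. ln (G (\<epsilon>\<^sup>2)) / (- B * (C / \<epsilon>\<^sup>2) powr g)) \<longlongrightarrow> 1) (at_right 0)"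
        using lim
      proof (rule Lim_transform_eventually)
        show "\<forall>\<^sub>F \<epsilon> in at_right 0. ln (G (\<epsilon>\<^sup>2)) * (\<epsilon>\<^sup>2) powr g / (- K) = ln (G (\<epsilon>\<^sup>2)) / (- B * (C / \<epsilon>\<^sup>2) powr g)"
          using eventually_at_right_less[of 0]
        proof eventually_elim
          case (elim \<epsilon>)
          have "- B * (C / \<epsilon>\<^sup>2) powr g = - K / (\<epsilon>\<^sup>2) powr g"
            unfolding KB using C0 by (simp add: powr_divide)
          then show ?case using elim by simp
        qed
      qed
    qed
  qed
  then show ?thesis unfolding G_def wsum_def B_def C_def D_def g_def f_mean_def .
qed

end
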